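(* For each positive integer $n$, the coefficients of the Chebyshev-Blaschke product $f_{n,\tau}$, i.e. the functions $\pm S_{n,j}$ ($1\le j\le\lfloor n/2\rfloor$) occurring in $$f_{n,\tau}(z)=z^{(1-(-1)^n)/2}\,\frac{z^{2\lfloor n/2\rfloor}+\sum_{j=1}^{\lfloor n/2\rfloor}(-1)^jS_{n,j}(\tau)z^{2\lfloor n/2\rfloor-2j}}{1+\sum_{j=1}^{\lfloor n/2\rfloor}(-1)^jS_{n,j}(\tau)z^{2j}},$$ are in the algebraic closure $\overline{\mathbb{Q}(j)}$ (that is, they are meromorphic functions on the upper half plane algebraic over $\mathbb{Q}(j)$), where $j$ in $\mathbb{Q}(j)$ is the $j$-invariant.
   Context: $\mathbb{H}$ is the open upper half plane. For $\tau\in\mathbb{H}$ put $q=e^{2\pi i\tau}$, $q^s=e^{2\pi i s\tau}$, and $$\vartheta_2(v,\tau)=\sum_{m=-\infty}^\infty q^{(m+1/2)^2}e^{(2m+1)iv},\qquad \vartheta_3(v,\tau)=\sum_{m=-\infty}^\infty q^{m^2}e^{2miv},$$ $$\omega_1(\tau)=\vartheta_3^2(0,\tau),\qquad \sqrt{k(\tau)}=\frac{\vartheta_2(0,\tau)}{\vartheta_3(0,\tau)}.$$ The Chebyshev-Blaschke product $f_{n,\tau}$ ($\tau\in\mathbb{R}_{>0}i$) is the finite Blaschke product on the unit disk defined by $f_{n,\tau}(z)=\sqrt{k(n\tau)}\,cd(n\omega_1(n\tau)u,n\tau)$ where $z=\sqrt{k(\tau)}\,cd(\omega_1(\tau)u,\tau)$,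 with $cd=cn/dn$ the quotient of Jacobi elliptic functions; equivalently $f_{n,\tau}\big(\vartheta_2(u,\tau)/\vartheta_3(u,\tau)\big)=\vartheta_2(nu,n\tau)/\vartheta_3(nu,n\tau)$. Explicitly, $$f_{n,\tau}(z)=z^{(1-(-1)^n)/2}\prod_{i=1}^{\lfloor n/2\rfloor}\frac{z^2-b_i}{1-b_iz^2},\qquad b_i(\tau)=\frac{\vartheta_2^2((2i-1)\pi/2n,\tau)}{\vartheta_3^2((2i-1)\pi/2n,\tau)}.$$ For $1\le j\le\lfloor n/2\rfloor$, $S_{n,j}=\sum_{1\le i_1<\cdots<i_j\le\lfloor n/2\rfloor}b_{i_1}\cdots b_{i_j}$; these are meromorphic functions of $\tau\in\mathbb{H}$. *)

theory Defs
  imports "HOL-Complex_Analysis.Complex_Analysis"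
begin

definition upper_half_plane :: "complex set" where
  "upper_half_plane = {\<tau>. Im \<tau> > 0}"

subsection \<open>Theta functions\<close>

text \<open>
  The nome is \<open>q = exp (2 \<pi> \<i> \<tau>)\<close>, not \<open>exp (\<pi> \<i> \<tau>)\<close>, so \<open>\<tau>\<close> is half of the
  half-period ratio used in the classical normalisation of the theta functions.
\<close>

definition q_pow :: "complex \<Rightarrow> real \<Rightarrow> complex" where
  "q_pow \<tau> s = exp (2 * of_real pi * \<i> * of_real s * \<tau>)"

definition theta2 :: "complex \<Rightarrow> complex \<Rightarrow> complex" where
  "theta2 v \<tau> =
     (\<Sum>\<^sub>\<infinity>m\<in>(UNIV :: int set). q_pow \<tau> ((of_int m + 1/2)\<^sup>2) * exp ((2 * of_int m + 1) * \<i> * v))"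

definition theta3 :: "complex \<Rightarrow> complex \<Rightarrow> complex" where
  "theta3 v \<tau> =
     (\<Sum>\<^sub>\<infinity>m\<in>(UNIV :: int set). q_pow \<tau> ((of_int m)\<^sup>2) * exp (2 * of_int m * \<i> * v))"

definition omega1 :: "complex \<Rightarrow> complex" where
  "omega1 \<tau> = (theta3 0 \<tau>)\<^sup>2"

definition sqrt_k :: "complex \<Rightarrow> complex" where
  "sqrt_k \<tau> = theta2 0 \<tau> / theta3 0 \<tau>"

text \<open>
  With \<open>w = u / \<omega>\<^sub>1(\<tau>)\<close>, the Jacobi elliptic functions are
  \<open>cn = \<vartheta>\<^sub>4(0) \<vartheta>\<^sub>2(w) / (\<vartheta>\<^sub>2(0) \<vartheta>\<^sub>4(w))\<close> and
  \<open>dn = \<vartheta>\<^sub>4(0) \<vartheta>\<^sub>3(w) / (\<vartheta>\<^sub>3(0) \<vartheta>\<^sub>4(w))\<close>.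
  In the meromorphic function \<open>cd = cn / dn\<close> the factors \<open>\<vartheta>\<^sub>4\<close> cancel; writing the cancelled
  form avoids spurious values at the common poles of \<open>cn\<close> and \<open>dn\<close>.
\<close>

definition jacobi_cd :: "complex \<Rightarrow> complex \<Rightarrow> complex" where
  "jacobi_cd u \<tau> =
     theta3 0 \<tau> * theta2 (u / omega1 \<tau>) \<tau> / (theta2 0 \<tau> * theta3 (u / omega1 \<tau>) \<tau>)"

subsection \<open>Chebyshev--Blaschke products and their coefficients\<close>

definition finite_blaschke_product :: "(complex \<Rightarrow> complex) \<Rightarrow> bool" where
  "finite_blaschke_product f \<longleftrightarrow>
     (\<exists>c as. cmod c = 1 \<and> (\<forall>a\<in>set as. cmod a < 1) \<and>
        (\<forall>z\<in>ball 0 1. f z = c * (\<Prod>a\<leftarrow>as. (z - a) / (1 - cnj a * z))))"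

text \<open>
  The functional equation is imposed at those \<open>u\<close> where \<open>z = \<surd>k(\<tau>) cd(\<omega>\<^sub>1(\<tau>) u, \<tau>)\<close> is finite
  (that is, \<open>\<vartheta>\<^sub>3(u, \<tau>) \<noteq> 0\<close>) and lies in the unit disk. Only the values of \<open>f\<close> on the open unit
  disk are constrained.
\<close>

definition is_chebyshev_blaschke :: "nat \<Rightarrow> complex \<Rightarrow> (complex \<Rightarrow> complex) \<Rightarrow> bool" where
  "is_chebyshev_blaschke n \<tau> f \<longleftrightarrow>
     finite_blaschke_product f \<and>
     (\<forall>u z. theta3 u \<tau> \<noteq> 0 \<longrightarrow> z = sqrt_k \<tau> * jacobi_cd (omega1 \<tau> * u) \<tau> \<longrightarrow> z \<in> ball 0 1 \<longrightarrow>
        f z = sqrt_k (of_nat n * \<tau>) *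
              jacobi_cd (of_nat n * omega1 (of_nat n * \<tau>) * u) (of_nat n * \<tau>))"

definition cb_b :: "nat \<Rightarrow> nat \<Rightarrow> complex \<Rightarrow> complex" where
  "cb_b n i \<tau> =
     (let v = of_real ((2 * real i - 1) * pi / (2 * real n))
      in (theta2 v \<tau>)\<^sup>2 / (theta3 v \<tau>)\<^sup>2)"

definition cb_S :: "nat \<Rightarrow> nat \<Rightarrow> complex \<Rightarrow> complex" where
  "cb_S n j \<tau> = (\<Sum>I | I \<subseteq> {1..n div 2} \<and> card I = j. \<Prod>i\<in>I. cb_b n i \<tau>)"

subsection \<open>The field generated by the \<open>j\<close>-invariant and its algebraic closure\<close>

definition eisenstein_G :: "nat \<Rightarrow> complex \<Rightarrow> complex" where
  "eisenstein_G k \<tau> =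
     (\<Sum>\<^sub>\<infinity>(m, n)\<in>(UNIV :: (int \<times> int) set) - {(0, 0)}. 1 / (of_int m + of_int n * \<tau>) ^ k)"

definition j_invariant :: "complex \<Rightarrow> complex" where
  "j_invariant \<tau> =
     (let g2 = 60 * eisenstein_G 4 \<tau>; g3 = 140 * eisenstein_G 6 \<tau>
      in 1728 * g2 ^ 3 / (g2 ^ 3 - 27 * g3\<^sup>2))"

text \<open>
  A meromorphic function on the upper half plane is represented by a function
  \<open>complex \<Rightarrow> complex\<close> whose values on a sparse set (in particular at its poles) are irrelevant.
  Accordingly, equality of meromorphic functions is equality outside a sparse subset of the
  upper half plane, expressed with the filter \<open>cosparse\<close>.
\<close>

definition rational_functions_of_j :: "(complex \<Rightarrow> complex) set" where
  "rational_functions_of_j =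
     {f. \<exists>A B :: rat poly. B \<noteq> 0 \<and>
        f = (\<lambda>\<tau>. poly (map_poly of_rat A) (j_invariant \<tau>) / poly (map_poly of_rat B) (j_invariant \<tau>))}"

definition mero_algebraic_over :: "(complex \<Rightarrow> complex) set \<Rightarrow> (complex \<Rightarrow> complex) \<Rightarrow> bool" where
  "mero_algebraic_over K F \<longleftrightarrow>
     F meromorphic_on upper_half_plane \<and>
     (\<exists>d c. (\<forall>i\<le>d. c i \<in> K) \<and>
        (\<exists>i\<le>d. \<not> (\<forall>\<^sub>\<approx>\<tau>\<in>upper_half_plane. c i \<tau> = 0)) \<and>
        (\<forall>\<^sub>\<approx>\<tau>\<in>upper_half_plane. (\<Sum>i\<le>d. c i \<tau> * F \<tau> ^ i) = 0))"

end

theory Submission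
  imports Defs "Jordan_Normal_Form.Char_Poly"
begin

text \<open>
  With \<open>W = \<vartheta>\<^sub>2(v, \<tau>) / \<vartheta>\<^sub>3(v, \<tau>)\<close>, numerator and denominator of the claimed formula for
  \<open>f\<^sub>n(W)\<close> become theta functions of order \<open>n\<close> with the zeros of \<open>\<vartheta>\<^sub>2(n v, n \<tau>)\<close> and
  \<open>\<vartheta>\<^sub>3(n v, n \<tau>)\<close>, so that Liouville's theorem identifies the two sides.

  For the algebraicity, \<open>W\<^sup>2 + 1/W\<^sup>2\<close> is an affine function of the Weierstrass function of the
  lattice \<open>\<int> + \<int> \<tau>\<close>, translated by a half period, and it takes the values \<open>2\<close> and \<open>-2\<close> at
  two of the half periods. Its values at certain torsion points are the numbers \<open>b\<^sub>i + 1/b\<^sub>i\<close>. A torsion point is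
  preperiodic under doubling, so the duplication formula makes its abscissa, normalised by a
  difference of half-period values, algebraic over \<open>\<rat>(j(\<tau>))\<close>. This is shown for each purely
  imaginary \<open>\<tau>\<close> separately; since there are only countably many algebraic relations over \<open>\<rat>\<close>, one of
  them holds for uncountably many \<open>\<tau>\<close>, hence identically.
\<close>

section \<open>Numbers algebraic over a subfield\<close>

text \<open>On the imaginary axis everything is explicit: \<open>q\<close> lies between 0 and 1, the
  theta functions are real on the real line, and membership in the lattice splits into real and
  imaginary parts. Weierstrass's function is not introduced by its own series: it is
  \<open>(Y - B) / A\<close> with unknown Laurent data \<open>A\<close>, \<open>B\<close>. Its
  derivative is identified with the absolutely convergent sum of inverse cubes, whose Taylor
  coefficients are Eisenstein series; this is where \<open>j\<close> enters. The half-period values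
  have weight 2, whereas \<open>j\<close> has weight 0; dividing by
  \<open>\<delta> = e3 - e2\<close> repairs this, and since \<open>Y\<close> is -2 and 2 at those
  two half periods, the same \<open>\<delta>\<close> eliminates \<open>A\<close> and
  \<open>B\<close>. Everything then depends on \<open>\<mu> = e2 / \<delta>\<close>: the normalised
  invariants are integer polynomials in \<open>\<mu>\<close>, and \<open>j\<close> is a rational
  function of \<open>\<mu>\<close>. So the torsion values are algebraic over a field that is itself
  algebraic over Q(j), which is why transitivity of algebraicity comes first. Working at single
  points permits subfields of the complex numbers in place of fields of meromorphic functions modulo
  sparse sets.\<close>

definition subfield_of_complex :: "complex set \<Rightarrow> bool" where
  "subfield_of_complex K \<longleftrightarrow> 1 \<in> K \<and> (\<forall>x\<in>K. \<forall>y\<in>K. x + y \<in> K \<and> x * y \<in> K) \<and>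
     (\<forall>x\<in>K. - x \<in> K \<and> inverse x \<in> K)"

text \<open>A set rather than a predicate, so that it can serve as a base field again:
  \<open>algebraic_over (algebraic_over K)\<close> occurs later.\<close>

definition algebraic_over :: "complex set \<Rightarrow> complex set" where
  "algebraic_over K = {x. \<exists>p. p \<noteq> 0 \<and> (\<forall>i. poly.coeff p i \<in> K) \<and> poly p x = 0}"

definition lin_span :: "complex set \<Rightarrow> complex set \<Rightarrow> complex set" where
  "lin_span K B = {x. \<exists>c. (\<forall>b\<in>B. c b \<in> K) \<and> x = (\<Sum>b\<in>B. c b * b)}"

definition set_mult :: "complex set \<Rightarrow> complex set \<Rightarrow> complex set" where
  "set_mult B C = (\<lambda>(b,c). b * c) ` (B \<times> C)"

locale complex_subfield =
  fixes K :: "complex set"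
  assumes K: "subfield_of_complex K"
begin

lemma one: "1 \<in> K" and add: "x \<in> K \<Longrightarrow> y \<in> K \<Longrightarrow> x + y \<in> K" and mult: "x \<in> K \<Longrightarrow> y \<in> K \<Longrightarrow> x * y \<in> K"
  and uminus: "x \<in> K \<Longrightarrow> - x \<in> K" and inverse: "x \<in> K \<Longrightarrow> inverse x \<in> K"
  using K by (auto simp: subfield_of_complex_def)

lemma zero: "0 \<in> K" using add[OF one uminus[OF one]] by simp

lemma diff: "x \<in> K \<Longrightarrow> y \<in> K \<Longrightarrow> x - y \<in> K" using add[of x "- y"] uminus by simp

lemma divide: "x \<in> K \<Longrightarrow> y \<in> K \<Longrightarrow> x / y \<in> K" using mult[of x "inverse y"] inverse by (simp add: divide_inverse)

lemma power: "x \<in> K \<Longrightarrow> x ^ n \<in> K" by (induction n) (auto intro: one mult)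

lemma sum: "(\<And>i. i \<in> A \<Longrightarrow> f i \<in> K) \<Longrightarrow> sum f A \<in> K"
  by (induction A rule: infinite_finite_induct) (auto intro: zero add)

lemma prod: "(\<And>i. i \<in> A \<Longrightarrow> f i \<in> K) \<Longrightarrow> prod f A \<in> K"
  by (induction A rule: infinite_finite_induct) (auto intro: one mult)

lemma of_nat: "of_nat n \<in> K" by (induction n) (auto intro: zero add one)

lemma numeral: "numeral n \<in> K" using of_nat[of "numeral n"] by simp

lemma coeff_add: "(\<forall>i. poly.coeff p i \<in> K) \<Longrightarrow> (\<forall>i. poly.coeff r i \<in> K) \<Longrightarrow> (\<forall>i. poly.coeff (p + r) i \<in> K)"
  by (auto intro: add)

lemma coeff_diff: "(\<forall>i. poly.coeff p i \<in> K) \<Longrightarrow> (\<forall>i. poly.coeff r i \<in> K) \<Longrightarrow> (\<forall>i. poly.coeff (p - r) i \<in> K)"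
  by (auto intro: diff)

lemma coeff_mult: "(\<forall>i. poly.coeff p i \<in> K) \<Longrightarrow> (\<forall>i. poly.coeff r i \<in> K) \<Longrightarrow> (\<forall>i. poly.coeff (p * r) i \<in> K)"
  unfolding Polynomial.coeff_mult by (auto intro!: sum mult)

lemma coeff_smult: "c \<in> K \<Longrightarrow> (\<forall>i. poly.coeff p i \<in> K) \<Longrightarrow> (\<forall>i. poly.coeff (Polynomial.smult c p) i \<in> K)"
  by (auto intro: mult)

lemma coeff_1: "\<forall>i. poly.coeff 1 i \<in> K"
  by (auto simp: one_pCons coeff_pCons zero one split: nat.split)

lemma coeff_power: "(\<forall>i. poly.coeff p i \<in> K) \<Longrightarrow> (\<forall>i. poly.coeff (p ^ n) i \<in> K)"
proof (induction n)
  case 0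
  then show ?case using coeff_1 by simp
next
  case (Suc n)
  then show ?case using coeff_mult[of p "p ^ n"] by simp
qed

lemma coeff_prod: "(\<And>x. x \<in> A \<Longrightarrow> \<forall>i. poly.coeff (f x) i \<in> K) \<Longrightarrow> \<forall>i. poly.coeff (prod f A) i \<in> K"
proof (induction A rule: infinite_finite_induct)
  case (insert x A)
  then show ?case using coeff_mult[of "f x" "prod f A"] by simp
qed (use coeff_1 in simp_all)

text \<open>The Leibniz formula expands the determinant into signed products of entries of
  \<open>char_poly_matrix\<close>, all of which have coefficients in \<open>K\<close>.\<close>

lemma char_poly_coeff:
  assumes A: "A \<in> carrier_mat n n" and K: "\<And>i j. i < n \<Longrightarrow> j < n \<Longrightarrow> A $$ (i, j) \<in> K"
  shows "\<forall>i. poly.coeff (char_poly A) i \<in> K"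
proof -
  have e: "\<forall>k. poly.coeff (char_poly_matrix A $$ (i, j)) k \<in> K" if "i < n" "j < n" for i j
    using that A K[OF that] unfolding char_poly_matrix_def
    by (auto simp: coeff_pCons zero one uminus split: nat.split)
  have sg: "\<forall>k. poly.coeff (signof p :: complex poly) k \<in> K" for p
    using coeff_1 uminus by (auto simp: sign_def)
  have "char_poly A = (\<Sum>p\<in>{p. p permutes {0..<n}}. signof p * (\<Prod>i = 0..<n. char_poly_matrix A $$ (i, p i)))"
    unfolding char_poly_def by (rule det_def') (use A in simp)
  moreover have "\<forall>k. poly.coeff (signof p * (\<Prod>i = 0..<n. char_poly_matrix A $$ (i, p i))) k \<in> K"
    if "p permutes {0..<n}" for p
    by (intro coeff_mult[rule_format] coeff_prod[rule_format] allI sg[rule_format] e[rule_format])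
       (use that in \<open>auto simp: permutes_in_image[OF that] dest: permutes_in_image[OF that, THEN iffD2]\<close>)
  ultimately show ?thesis by (auto simp: coeff_sum intro!: sum)
qed

text \<open>An \<open>x\<close> that stabilises a nonzero finitely generated module is a root of the
  characteristic polynomial of its multiplication map.\<close>
lemma algebraic_if_stable:
  assumes B: "finite B" "\<exists>b\<in>B. b \<noteq> 0" and st: "\<And>b. b \<in> B \<Longrightarrow> x * b \<in> lin_span K B"
  shows "x \<in> algebraic_over K"
proof -
  obtain bs where bs: "set bs = B" "distinct bs" using finite_distinct_list[OF B(1)] by blast
  define n where "n = length bs"
  obtain c where c: "\<And>b b'. b \<in> B \<Longrightarrow> b' \<in> B \<Longrightarrow> c b b' \<in> K" "\<And>b. b \<in> B \<Longrightarrow> x * b = (\<Sum>b'\<in>B. c b b' * b')"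
  proof -
    have "\<forall>b\<in>B. \<exists>c. (\<forall>b'\<in>B. c b' \<in> K) \<and> x * b = (\<Sum>b'\<in>B. c b' * b')"
      using st unfolding lin_span_def by blast
    then show ?thesis using that by metis
  qed
  define A where "A = mat n n (\<lambda>(i,j). c (bs ! i) (bs ! j))"
  \<comment> \<open>Row \<open>i\<close> of \<open>A\<close> expresses \<open>x * bs ! i\<close>
    through the generators, so the vector of generators is an eigenvector for
    \<open>x\<close>.\<close>
  define v where "v = vec n (\<lambda>i. bs ! i)"
  have A: "A \<in> carrier_mat n n" by (simp add: A_def)
  have mem: "i < n \<Longrightarrow> bs ! i \<in> B" for i using bs nth_mem n_def by blast
  have "A *\<^sub>v v = x \<cdot>\<^sub>v v"
  proof (rule eq_vecI)
    fix i assume "i < dim_vec (x \<cdot>\<^sub>v v)"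
    then have i: "i < n" by (simp add: v_def)
    have "(A *\<^sub>v v) $ i = (\<Sum>j = 0..<n. c (bs ! i) (bs ! j) * (bs ! j))"
      using i by (simp add: A_def v_def scalar_prod_def)
    also have "\<dots> = (\<Sum>b'\<in>B. c (bs ! i) b' * b')"
      by (rule sum.reindex_bij_betw[where g = "\<lambda>b. c (bs ! i) b * b"])
         (use bs bij_betw_nth[of bs "{0..<n}" B] in \<open>auto simp: n_def atLeast0LessThan\<close>)
    also have "\<dots> = x * (bs ! i)" using c(2)[OF mem[OF i]] by simp
    finally show "(A *\<^sub>v v) $ i = (x \<cdot>\<^sub>v v) $ i" using i by (simp add: v_def)
  qed (simp add: A_def v_def)
  moreover have "v \<noteq> 0\<^sub>v n"
  proof
    assume "v = 0\<^sub>v n"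
    then have "\<And>i. i < n \<Longrightarrow> bs ! i = 0" unfolding v_def by (metis index_vec index_zero_vec(1))
    then show False using B(2) bs by (metis in_set_conv_nth n_def)
  qed
  ultimately have "eigenvalue A x"
    using A unfolding eigenvalue_def eigenvector_def by (intro exI[of _ v]) (auto simp: v_def)
  then have "poly (char_poly A) x = 0" using eigenvalue_root_char_poly[OF A] by simp
  moreover have "char_poly A \<noteq> 0" using degree_monic_char_poly[OF A] by auto
  moreover have "\<forall>i. poly.coeff (char_poly A) i \<in> K"
    by (rule char_poly_coeff[OF A]) (use c(1) mem in \<open>auto simp: A_def\<close>)
  ultimately show ?thesis unfolding algebraic_over_def by blast
qed

lemma lin_span_base: "finite B \<Longrightarrow> b \<in> B \<Longrightarrow> b \<in> lin_span K B"
  unfolding lin_span_def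
  by (intro CollectI exI[of _ "\<lambda>b'. if b' = b then 1 else 0"])
     (auto simp: zero one if_distrib[of "\<lambda>x. x * _"] cong: if_cong)

lemma lin_span_0: "0 \<in> lin_span K B"
  unfolding lin_span_def by (intro CollectI exI[of _ "\<lambda>_. 0"]) (auto simp: zero)

lemma lin_span_add: 
  assumes "x \<in> lin_span K B" "y \<in> lin_span K B" shows "x + y \<in> lin_span K B"
proof -
  obtain c d where "\<forall>b\<in>B. c b \<in> K" "x = (\<Sum>b\<in>B. c b * b)" "\<forall>b\<in>B. d b \<in> K" "y = (\<Sum>b\<in>B. d b * b)"
    using assms unfolding lin_span_def by blast
  then show ?thesis unfolding lin_span_def
    by (intro CollectI exI[of _ "\<lambda>b. c b + d b"]) (auto simp: add ring_distribs sum.distrib)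
qed

lemma lin_span_mult: 
  assumes "x \<in> lin_span K B" "k \<in> K" shows "k * x \<in> lin_span K B"
proof -
  obtain c where "\<forall>b\<in>B. c b \<in> K" "x = (\<Sum>b\<in>B. c b * b)"
    using assms unfolding lin_span_def by blast
  then show ?thesis unfolding lin_span_def using assms(2)
    by (intro CollectI exI[of _ "\<lambda>b. k * c b"]) (auto simp: mult sum_distrib_left mult_ac)
qed

lemma lin_span_sum: "(\<And>i. i \<in> A \<Longrightarrow> f i \<in> lin_span K B) \<Longrightarrow> sum f A \<in> lin_span K B"
  by (induction A rule: infinite_finite_induct) (auto intro: lin_span_0 lin_span_add)

lemma lin_span_image:
  assumes "finite B" "\<And>b. b \<in> B \<Longrightarrow> x * b \<in> lin_span K B" "y \<in> lin_span K B"
  shows "x * y \<in> lin_span K B"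
proof -
  obtain c where c: "\<forall>b\<in>B. c b \<in> K" "y = (\<Sum>b\<in>B. c b * b)"
    using assms unfolding lin_span_def by blast
  have "x * y = (\<Sum>b\<in>B. c b * (x * b))" unfolding c by (simp add: sum_distrib_left mult_ac)
  also have "\<dots> \<in> lin_span K B" using c assms(2) by (intro lin_span_sum lin_span_mult[of "x * _"]) auto
  finally show ?thesis .
qed

text \<open>The nonzero element excludes \<open>B = {0}\<close>, whose span is stabilised by every
  number.\<close>

definition stable :: "complex \<Rightarrow> complex set \<Rightarrow> bool" where
  "stable x B \<longleftrightarrow> finite B \<and> (\<exists>b\<in>B. b \<noteq> 0) \<and> (\<forall>b\<in>B. x * b \<in> lin_span K B)"

text \<open>A nonzero constant has no root, so the degree is positive; division by the leading
  coefficient gives the relation.\<close>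

lemma monic_relation:
  assumes "p \<noteq> 0" "\<forall>i. poly.coeff p i \<in> K" "poly p x = 0"
  obtains d c where "d > (0::nat)" "\<And>i. c i \<in> K" "x ^ d = (\<Sum>i<d. c i * x ^ i)"
proof -
  define d where "d = Polynomial.degree p"
  define c where "c i = - (poly.coeff p i / poly.coeff p d)" for i
  have lc: "poly.coeff p d \<noteq> 0" using assms(1) by (simp add: d_def)
  have "d > 0"
  proof (rule ccontr)
    assume "\<not> d > 0"
    then have "p = [:poly.coeff p 0:]" using degree_0_id d_def by (metis gr0I)
    then show False using assms(1,3) by (metis mult_zero_right poly_pCons poly_0 add.right_neutral pCons_0_0)
  qed
  have "(\<Sum>i\<le>d. poly.coeff p i * x ^ i) = 0" using assms(3) unfolding poly_altdef d_def by simp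
  then have "(\<Sum>i<d. poly.coeff p i * x ^ i) + poly.coeff p d * x ^ d = 0"
    by (simp flip: lessThan_Suc_atMost)
  then have "x ^ d = (\<Sum>i<d. c i * x ^ i)"
    using lc by (simp add: c_def sum_negf field_simps sum_divide_distrib[symmetric] eq_neg_iff_add_eq_0)
  moreover have "c i \<in> K" for i using assms(2) by (auto simp: c_def intro: uminus divide)
  ultimately show ?thesis using that \<open>d > 0\<close> by blast
qed

text \<open>The powers of \<open>x\<close> below the degree of a monic relation work: the relation
  rewrites the one power that leaves the list.\<close>

lemma stable_exists:
  assumes "x \<in> algebraic_over K" shows "\<exists>B. stable x B"
proof -
  obtain p where p: "p \<noteq> 0" "\<forall>i. poly.coeff p i \<in> K" "poly p x = 0"
    using assms unfolding algebraic_over_def by blast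
  obtain d c where d: "d > (0::nat)" "\<And>i. c i \<in> K" "x ^ d = (\<Sum>i<d. c i * x ^ i)"
    using monic_relation[OF p] by blast
  define B where "B = (\<lambda>i. x ^ i) ` {..<d}"
  have fin: "finite B" by (simp add: B_def)
  have "1 \<in> B" using d(1) unfolding B_def by (intro image_eqI[of _ _ 0]) auto
  moreover have "x * b \<in> lin_span K B" if b: "b \<in> B" for b
  proof -
    obtain i where i: "i < d" "b = x ^ i" using b unfolding B_def by blast
    show ?thesis
    proof (cases "Suc i < d")
      case True
      then have "x ^ Suc i \<in> B" unfolding B_def by blast
      then show ?thesis using lin_span_base[OF fin] i by simp
    next
      case False
      then have id: "Suc i = d" using i by simp
      have "x ^ d \<in> lin_span K B"
        unfolding d(3) using d(2) by (intro lin_span_sum lin_span_mult lin_span_base fin) (auto simp: B_def)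
      then show ?thesis using i(2) unfolding id[symmetric] by simp
    qed
  qed
  ultimately show ?thesis unfolding stable_def using fin by (intro exI[of _ B]) auto
qed

lemma stable_imp: "stable x B \<Longrightarrow> x \<in> algebraic_over K"
  unfolding stable_def by (intro algebraic_if_stable) auto

lemma lin_span_set_mult:
  assumes "finite B" "finite C" "x \<in> lin_span K B" "c \<in> C"
  shows "x * c \<in> lin_span K (set_mult B C)"
proof -
  obtain k where k: "\<forall>b\<in>B. k b \<in> K" "x = (\<Sum>b\<in>B. k b * b)"
    using assms unfolding lin_span_def by blast
  have "x * c = (\<Sum>b\<in>B. k b * (b * c))" unfolding k by (simp add: sum_distrib_right mult.assoc)
  also have "\<dots> \<in> lin_span K (set_mult B C)"
    using assms k by (intro lin_span_sum lin_span_mult lin_span_base) (auto simp: set_mult_def)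
  finally show ?thesis .
qed

lemma set_mult_commute: "set_mult B C = set_mult C B"
  unfolding set_mult_def by (auto simp: image_iff mult.commute) (metis mult.commute)+

lemma stable_set_mult1:
  assumes "stable x B" "finite C" "\<exists>c\<in>C. c \<noteq> 0" shows "stable x (set_mult B C)"
proof -
  have f: "finite B" and s: "\<And>b. b \<in> B \<Longrightarrow> x * b \<in> lin_span K B" using assms(1) by (auto simp: stable_def)
  obtain b c where "b \<in> B" "b \<noteq> 0" "c \<in> C" "c \<noteq> 0" using assms by (auto simp: stable_def)
  then have nz: "b * c \<in> set_mult B C" "b * c \<noteq> 0" by (auto simp: set_mult_def)
  have "x * y \<in> lin_span K (set_mult B C)" if y: "y \<in> set_mult B C" for y
  proof -
    obtain b c where bc: "b \<in> B" "c \<in> C" "y = b * c" using y by (auto simp: set_mult_def)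
    then show ?thesis using lin_span_set_mult[OF f assms(2) s[OF bc(1)] bc(2)] by (simp add: mult_ac)
  qed
  moreover have "finite (set_mult B C)" using f assms(2) by (simp add: set_mult_def)
  moreover have "\<exists>b\<in>set_mult B C. b \<noteq> 0" by (rule bexI[of _ "b * c"]) (use nz in auto)
  ultimately show ?thesis unfolding stable_def by (intro conjI ballI)
qed

lemma stable_set_mult2:
  assumes "stable x B" "finite C" "\<exists>c\<in>C. c \<noteq> 0" shows "stable x (set_mult C B)"
  using stable_set_mult1[OF assms] set_mult_commute by simp

lemma stable_add: "stable x B \<Longrightarrow> stable y B \<Longrightarrow> stable (x + y) B"
  unfolding stable_def by (auto simp: ring_distribs intro: lin_span_add)

lemma stable_mult: "stable x B \<Longrightarrow> stable y B \<Longrightarrow> stable (x * y) B"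
  unfolding stable_def using lin_span_image[of B x] by (auto simp: mult.assoc)

text \<open>Pairwise products of generators span a module stable under both numbers, hence under
  their sum and product.\<close>

lemma alg_pair:
  assumes "x \<in> algebraic_over K" "y \<in> algebraic_over K"
  obtains B where "stable x B" "stable y B"
proof -
  obtain B C where "stable x B" "stable y C" using assms stable_exists by blast
  then show ?thesis
    using that stable_set_mult1[of x B C] stable_set_mult2[of y C B] by (auto simp: stable_def)
qed

lemma alg_add: "x \<in> algebraic_over K \<Longrightarrow> y \<in> algebraic_over K \<Longrightarrow> x + y \<in> algebraic_over K"
  by (meson alg_pair stable_add stable_imp)

lemma alg_mult: "x \<in> algebraic_over K \<Longrightarrow> y \<in> algebraic_over K \<Longrightarrow> x * y \<in> algebraic_over K"
  by (meson alg_pair stable_mult stable_imp)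

lemma alg_base: "x \<in> K \<Longrightarrow> x \<in> algebraic_over K"
  unfolding algebraic_over_def
  by (intro CollectI exI[of _ "[:-x, 1:]"]) (auto simp: coeff_pCons uminus one zero split: nat.split)

text \<open>The inverse of a nonzero root of \<open>p\<close> is a root of the reversed
  polynomial.\<close>

lemma alg_inverse:
  assumes "x \<in> algebraic_over K" shows "inverse x \<in> algebraic_over K"
proof (cases "x = 0")
  case False
  obtain p where p: "p \<noteq> 0" "\<forall>i. poly.coeff p i \<in> K" "poly p x = 0"
    using assms unfolding algebraic_over_def by blast
  have "poly (reflect_poly p) (inverse x) = 0"
    using poly_reflect_poly_nz[of "inverse x" p] False p(3) by simp
  moreover have "reflect_poly p \<noteq> 0" using p(1) by simp
  moreover have "\<forall>i. poly.coeff (reflect_poly p) i \<in> K"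
    using p(2) zero by (auto simp: coeff_reflect_poly)
  ultimately show ?thesis unfolding algebraic_over_def by blast
qed (use assms in simp)

lemma algebraic_subfield: "subfield_of_complex (algebraic_over K)"
  unfolding subfield_of_complex_def
  using alg_base[OF one] alg_add alg_mult alg_inverse alg_mult[OF alg_base[OF uminus[OF one]]] by auto

lemma stable_finite:
  assumes "finite X" "X \<subseteq> algebraic_over K"
  shows "\<exists>B. finite B \<and> (\<exists>b\<in>B. b \<noteq> 0) \<and> (\<forall>x\<in>X. stable x B)"
  using assms
proof (induction X rule: finite_induct)
  case empty
  then show ?case by (intro exI[of _ "{1}"]) auto
next
  case (insert x X)
  then obtain B where B: "finite B" "\<exists>b\<in>B. b \<noteq> 0" "\<forall>x\<in>X. stable x B" by auto
  obtain C where C: "stable x C" using stable_exists[of x] insert.prems by auto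
  have C': "finite C" "\<exists>b\<in>C. b \<noteq> 0" using C by (auto simp: stable_def)
  have "\<forall>y\<in>insert x X. stable y (set_mult B C)"
    using B C C' stable_set_mult1 stable_set_mult2 by auto
  moreover from this have "finite (set_mult B C)" "\<exists>b\<in>set_mult B C. b \<noteq> 0" by (auto simp: stable_def)
  ultimately show ?case by blast
qed

text \<open>Transitivity of algebraicity. The coefficients of a monic relation for \<open>x\<close>
  stabilise a common \<open>B\<close>; the products of \<open>B\<close> with the powers of
  \<open>x\<close> below \<open>d\<close> are then stable under \<open>x\<close>, because the
  coefficients brought in by rewriting \<open>x ^ d\<close> are absorbed by
  \<open>B\<close>.\<close>

lemma algebraic_closed:
  assumes p: "p \<noteq> 0" "\<And>i. poly.coeff p i \<in> algebraic_over K" "poly p x = 0"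
  shows "x \<in> algebraic_over K"
proof -
  interpret A: complex_subfield "algebraic_over K" by unfold_locales (rule algebraic_subfield)
  obtain d c where d0: "d > (0::nat)" and c: "\<And>i. c i \<in> algebraic_over K" and xd: "x ^ d = (\<Sum>i<d. c i * x ^ i)"
    using A.monic_relation[OF p(1) _ p(3)] p(2) by blast
  obtain B where B: "finite B" "\<exists>b\<in>B. b \<noteq> 0" "\<And>i. i < d \<Longrightarrow> stable (c i) B"
    using stable_finite[of "c ` {..<d}"] c by auto
  define P where "P = (\<lambda>i. x ^ i) ` {..<d}"
  have P: "finite P" "1 \<in> P" using d0 unfolding P_def by (auto intro: image_eqI[of _ _ 0])
  have fin: "finite (set_mult B P)" using B P by (simp add: set_mult_def)
  have "x * y \<in> lin_span K (set_mult B P)" if yB: "y \<in> set_mult B P" for y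
  proof -
    obtain b i where y: "b \<in> B" "i < d" "y = b * x ^ i" using yB by (auto simp: set_mult_def P_def)
    show ?thesis
    proof (cases "Suc i < d")
      case True
      then have "x ^ Suc i \<in> P" unfolding P_def by blast
      then have "b * x ^ Suc i \<in> set_mult B P" using y unfolding set_mult_def by blast
      moreover have "x * y = b * x ^ Suc i" using y by simp
      ultimately show ?thesis using lin_span_base[OF fin] by metis
    next
      case False
      then have "x * y = b * x ^ d" using y by (metis Suc_lessI mult.left_commute power_Suc)
      also have "\<dots> = (\<Sum>i<d. c i * b * x ^ i)" unfolding xd by (simp add: sum_distrib_left mult_ac)
      also have "\<dots> \<in> lin_span K (set_mult B P)"
        using B y(1) by (intro lin_span_sum lin_span_set_mult P) (auto simp: stable_def P_def)
      finally show ?thesis .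
    qed
  qed
  moreover have "\<exists>b\<in>set_mult B P. b \<noteq> 0"
    using B(2) P(2) unfolding set_mult_def by (force intro: rev_bexI)
  ultimately show ?thesis using algebraic_if_stable[OF fin] by blast
qed

end

section \<open>Theta series\<close>

text \<open>Weierstrass M-test with a majorant that may depend on the point: near each point the
  finite partial sums converge uniformly along the filter of finite subsets.\<close>

lemma infsum_holomorphic:
  fixes f :: "'a \<Rightarrow> complex \<Rightarrow> complex"
  assumes holo: "\<And>x. x \<in> I \<Longrightarrow> f x holomorphic_on A"
    and bound: "\<And>z. z \<in> A \<Longrightarrow> \<exists>r>0. \<exists>M. cball z r \<subseteq> A \<and> M summable_on I \<and>
                  (\<forall>x\<in>I. \<forall>w\<in>cball z r. norm (f x w) \<le> M x)"
  shows "(\<lambda>z. \<Sum>\<^sub>\<infinity>x\<in>I. f x z) holomorphic_on A"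
proof -
  have "\<exists>r>0. (\<lambda>z. \<Sum>\<^sub>\<infinity>x\<in>I. f x z) holomorphic_on ball z r \<and> ball z r \<subseteq> A" if z: "z \<in> A" for z
  proof -
    obtain r M where r: "r > 0" "cball z r \<subseteq> A" "M summable_on I"
      and le: "\<And>x w. x \<in> I \<Longrightarrow> w \<in> cball z r \<Longrightarrow> norm (f x w) \<le> M x"
      using bound[OF z] by blast
    have lim: "uniform_limit (cball z r) (\<lambda>X y. \<Sum>x\<in>X. f x y) (\<lambda>y. \<Sum>\<^sub>\<infinity>x\<in>I. f x y) (finite_subsets_at_top I)"
      by (rule Weierstrass_m_test_general[OF le r(3)]) 
    have ev: "\<forall>\<^sub>F X in finite_subsets_at_top I. continuous_on (cball z r) (\<lambda>y. \<Sum>x\<in>X. f x y) \<and>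
                (\<lambda>y. \<Sum>x\<in>X. f x y) holomorphic_on ball z r"
    proof (rule eventually_finite_subsets_at_top_weakI)
      fix X assume X: "finite X" "X \<subseteq> I"
      have "(\<lambda>y. \<Sum>x\<in>X. f x y) holomorphic_on cball z r"
        using X r(2) by (intro holomorphic_intros holomorphic_on_subset[OF holo]) auto
      then show "continuous_on (cball z r) (\<lambda>y. \<Sum>x\<in>X. f x y) \<and>
                (\<lambda>y. \<Sum>x\<in>X. f x y) holomorphic_on ball z r"
        using holomorphic_on_imp_continuous_on holomorphic_on_subset ball_subset_cball by blast
    qed
    have "(\<lambda>y. \<Sum>\<^sub>\<infinity>x\<in>I. f x y) holomorphic_on ball z r"
      using holomorphic_uniform_limit[OF ev lim] by (simp add: finite_subsets_at_top_neq_bot)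
    then show ?thesis using r ball_subset_cball by blast
  qed
  then show ?thesis
    by (metis (no_types, lifting) analytic_on_def analytic_imp_holomorphic)
qed

text \<open>Uniform limits of holomorphic functions may be differentiated repeatedly; this yields
  the Taylor coefficients of the lattice sum in \<open>cube_rest_deriv\<close>.\<close>

lemma higher_deriv_infsum:
  fixes f :: "'a \<Rightarrow> complex \<Rightarrow> complex"
  assumes holo: "\<And>x. x \<in> I \<Longrightarrow> f x holomorphic_on A" and A: "open A" "z \<in> A"
    and M: "M summable_on I" "\<And>x w. x \<in> I \<Longrightarrow> w \<in> A \<Longrightarrow> norm (f x w) \<le> M x"
  shows "((\<lambda>x. (deriv ^^ k) (f x) z) has_sum (deriv ^^ k) (\<lambda>z. \<Sum>\<^sub>\<infinity>x\<in>I. f x z) z) I"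
proof -
  have lim: "uniform_limit A (\<lambda>X y. \<Sum>x\<in>X. f x y) (\<lambda>y. \<Sum>\<^sub>\<infinity>x\<in>I. f x y) (finite_subsets_at_top I)"
    by (rule Weierstrass_m_test_general[OF M(2) M(1)])
  have "((\<lambda>X. (deriv ^^ k) (\<lambda>y. \<Sum>x\<in>X. f x y) z) \<longlongrightarrow> (deriv ^^ k) (\<lambda>z. \<Sum>\<^sub>\<infinity>x\<in>I. f x z) z)
          (finite_subsets_at_top I)"
  proof (rule higher_deriv_complex_uniform_limit[OF lim _ _ A])
    show "\<forall>\<^sub>F X in finite_subsets_at_top I. (\<lambda>y. \<Sum>x\<in>X. f x y) holomorphic_on A"
      by (rule eventually_finite_subsets_at_top_weakI) (auto intro!: holomorphic_intros holo)
  qed (simp add: finite_subsets_at_top_neq_bot)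
  moreover have "\<forall>\<^sub>F X in finite_subsets_at_top I. (deriv ^^ k) (\<lambda>y. \<Sum>x\<in>X. f x y) z = (\<Sum>x\<in>X. (deriv ^^ k) (f x) z)"
  proof (rule eventually_finite_subsets_at_top_weakI)
    fix X assume X: "finite X" "X \<subseteq> I"
    then show "(deriv ^^ k) (\<lambda>y. \<Sum>x\<in>X. f x y) z = (\<Sum>x\<in>X. (deriv ^^ k) (f x) z)"
    proof (induction X rule: finite_induct)
      case empty
      then show ?case by (induction k) (simp_all del: funpow.simps add: funpow_Suc_right)
    next
      case (insert x X)
      have "(deriv ^^ k) (\<lambda>w. f x w + (\<Sum>x\<in>X. f x w)) z
          = (deriv ^^ k) (f x) z + (deriv ^^ k) (\<lambda>w. \<Sum>x\<in>X. f x w) z"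
        by (rule higher_deriv_add[OF _ _ A]) (use insert holo in \<open>auto intro!: holomorphic_intros\<close>)
      then show ?case using insert by simp
    qed
  qed
  ultimately show ?thesis
    unfolding has_sum_def using tendsto_cong by fastforce
qed

lemma summable_on_int_abs:
  fixes g :: "nat \<Rightarrow> real"
  assumes "g summable_on UNIV"
  shows "(\<lambda>m::int. g (nat \<bar>m\<bar>)) summable_on UNIV"
proof -
  have 1: "(\<lambda>m::int. g (nat \<bar>m\<bar>)) summable_on {0..}"
    using summable_on_reindex_bij_witness[of "{0..}" int nat UNIV g "\<lambda>m::int. g (nat \<bar>m\<bar>)"] assms by auto
  have 2: "(\<lambda>m::int. g (nat \<bar>m\<bar>)) summable_on {..0}"
    using summable_on_reindex_bij_witness[of "{..0}" "\<lambda>n. - int n" "\<lambda>m. nat (- m)" UNIV g "\<lambda>m::int. g (nat \<bar>m\<bar>)"] assms by auto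
  have "UNIV = {0..} \<union> {..0::int}" by auto
  then show ?thesis using summable_on_union[OF 1 2] by simp
qed

text \<open>A single exponential, so that every symmetry becomes a comparison of exponents after a
  change of index.\<close>

definition th_term :: "complex \<Rightarrow> complex \<Rightarrow> int \<Rightarrow> complex" where
  "th_term v \<tau> m = exp (2 * of_real pi * \<i> * (of_int m)\<^sup>2 * \<tau> + 2 * of_int m * \<i> * v)"

lemma theta3_eq: "theta3 v \<tau> = (\<Sum>\<^sub>\<infinity>m. th_term v \<tau> m)"
  unfolding theta3_def th_term_def q_pow_def by (simp add: exp_add)

text \<open>Completing the square in the exponent. Zeros, holomorphy and quasi-periods of
  \<open>theta2\<close> are inherited from \<open>theta3\<close> through this translation.\<close>

lemma theta2_eq:
  fixes v \<tau> :: complex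
  shows "theta2 v \<tau> = exp (\<i> * pi * \<tau> / 2 + \<i> * v) * theta3 (v + pi * \<tau>) \<tau>"
proof -
  have "theta2 v \<tau> = (\<Sum>\<^sub>\<infinity>m. exp (\<i> * pi * \<tau> / 2 + \<i> * v) * th_term (v + pi * \<tau>) \<tau> m)"
    unfolding theta2_def th_term_def q_pow_def exp_add[symmetric]
    by (intro infsum_cong arg_cong[of _ _ exp]) (simp add: field_simps power2_eq_square)
  then show ?thesis
    by (simp add: theta3_eq infsum_cmult_right')
qed

text \<open>The exponent \<open>(2*M+1)\<^sup>2 / (8*pi*\<delta>)\<close> is the maximum of
  \<open>(2*M+1) * x - 2*pi*\<delta> * x\<^sup>2\<close> over real \<open>x\<close>; the 1 in
  \<open>2*M+1\<close> pays for the geometric factor.\<close>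

lemma norm_th_term_le:
  assumes "Im \<tau> \<ge> \<delta>" "\<delta> > 0" "\<bar>Im v\<bar> \<le> M"
  shows "norm (th_term v \<tau> m) \<le> exp ((2*M+1)\<^sup>2 / (8*pi*\<delta>)) * exp (-1) ^ nat \<bar>m\<bar>"
proof -
  define x where "x = \<bar>real_of_int m\<bar>"
  have x: "x \<ge> 0" by (simp add: x_def)
  have "norm (th_term v \<tau> m) = exp (- 2 * pi * x\<^sup>2 * Im \<tau> - 2 * of_int m * Im v)"
    unfolding th_term_def norm_exp_eq_Re
    by (simp add: x_def power2_eq_square)
  also have "\<dots> \<le> exp ((2*M+1)\<^sup>2 / (8*pi*\<delta>) - x)"
  proof -
    have 1: "2 * pi * x\<^sup>2 * \<delta> \<le> 2 * pi * x\<^sup>2 * Im \<tau>" using assms by (intro mult_left_mono) auto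
    have 2: "- (2 * of_int m * Im v) \<le> 2 * (x * M)"
    proof -
      have "- (of_int m * Im v) \<le> \<bar>of_int m * Im v\<bar>" by simp
      also have "\<dots> \<le> x * M" unfolding abs_mult x_def using assms by (intro mult_left_mono) auto
      finally show ?thesis by (simp add: mult_ac)
    qed
    have "0 \<le> (4 * pi * \<delta> * x - (2*M+1))\<^sup>2 / (8*pi*\<delta>)" using assms by simp
    also have "\<dots> = 2 * pi * \<delta> * x\<^sup>2 - (2*M+1) * x + (2*M+1)\<^sup>2 / (8*pi*\<delta>)"
      using assms by (simp add: field_simps power2_eq_square)
    finally have "2 * (x * M) + x - 2 * pi * x\<^sup>2 * \<delta> \<le> (2*M+1)\<^sup>2 / (8*pi*\<delta>)"
      by (simp add: algebra_simps)
    then have "- 2 * pi * x\<^sup>2 * Im \<tau> - 2 * of_int m * Im v \<le> (2*M+1)\<^sup>2 / (8*pi*\<delta>) - x"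
      using 1 2 by linarith
    then show ?thesis by simp
  qed
  also have "\<dots> = exp ((2*M+1)\<^sup>2 / (8*pi*\<delta>)) * exp (-1) ^ nat \<bar>m\<bar>"
  proof -
    have "exp (- 1) ^ nat \<bar>m\<bar> = exp (- x)"
      unfolding exp_of_nat_mult[symmetric] by (simp add: x_def)
    then show ?thesis by (simp add: mult_exp_exp)
  qed
  finally show ?thesis .
qed

lemma summable_exp_abs: "(\<lambda>m::int. C * exp (-1) ^ nat \<bar>m\<bar> :: real) summable_on UNIV"
proof (rule summable_on_cmult_right, rule summable_on_int_abs)
  have "summable (\<lambda>n. exp (-1::real) ^ n)" by (rule summable_geometric) simp
  then show "(\<lambda>n. exp (-1::real) ^ n) summable_on UNIV"
    by (intro summable_nonneg_imp_summable_on) auto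
qed

lemma th_term_summable: 
  assumes "Im \<tau> > 0"
  shows "th_term v \<tau> summable_on UNIV"
proof -
  have "(\<lambda>m. norm (th_term v \<tau> m)) summable_on UNIV"
    by (rule Infinite_Sum.abs_summable_on_comparison_test'[OF summable_exp_abs norm_th_term_le[OF order_refl assms order_refl]])
  then show ?thesis by (rule abs_summable_summable)
qed

text \<open>Both arguments vary, which covers holomorphy in \<open>v\<close> as well as in
  \<open>\<tau>\<close>. On a closed ball the least \<open>Im (a z)\<close> and the greatest
  absolute value of \<open>Im (b z)\<close> give one majorant.\<close>

lemma theta3_holomorphic:
  assumes a: "a holomorphic_on A" "b holomorphic_on A" "open A" "\<And>z. z \<in> A \<Longrightarrow> Im (a z) > 0"
  shows "(\<lambda>z. theta3 (b z) (a z)) holomorphic_on A"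
  unfolding theta3_eq
proof (rule infsum_holomorphic)
  show "(\<lambda>z. th_term (b z) (a z) m) holomorphic_on A" for m
    unfolding th_term_def using a by (intro holomorphic_intros)
next
  fix z assume z: "z \<in> A"
  obtain r0 where r0: "r0 > 0" "cball z r0 \<subseteq> A" using z \<open>open A\<close> open_contains_cball by blast
  have c: "continuous_on (cball z r0) a" "continuous_on (cball z r0) b"
    using a r0 holomorphic_on_imp_continuous_on continuous_on_subset by blast+
  have "\<exists>w\<in>cball z r0. \<forall>y\<in>cball z r0. Im (a w) \<le> Im (a y)"
    using r0 c by (intro continuous_attains_inf continuous_intros) auto
  then obtain w0 where w0: "w0 \<in> cball z r0" "\<And>y. y \<in> cball z r0 \<Longrightarrow> Im (a w0) \<le> Im (a y)" by blast
  have "\<exists>w\<in>cball z r0. \<forall>y\<in>cball z r0. \<bar>Im (b y)\<bar> \<le> \<bar>Im (b w)\<bar>"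
    using r0 c by (intro continuous_attains_sup continuous_intros) auto
  then obtain w1 where w1: "\<And>y. y \<in> cball z r0 \<Longrightarrow> \<bar>Im (b y)\<bar> \<le> \<bar>Im (b w1)\<bar>" by blast
  show "\<exists>r>0. \<exists>M. cball z r \<subseteq> A \<and> M summable_on UNIV \<and>
          (\<forall>x\<in>UNIV. \<forall>w\<in>cball z r. norm (th_term (b w) (a w) x) \<le> M x)"
    using r0 w0 w1 a(4) summable_exp_abs norm_th_term_le
    by (intro exI[of _ r0] conjI exI[of _ "\<lambda>m. exp ((2*\<bar>Im (b w1)\<bar>+1)\<^sup>2 / (8*pi*Im (a w0))) * exp (-1) ^ nat \<bar>m\<bar>"] ballI)
       (auto)
qed

lemma theta2_holomorphic:
  assumes a: "a holomorphic_on A" "b holomorphic_on A" "open A" "\<And>z. z \<in> A \<Longrightarrow> Im (a z) > 0"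
  shows "(\<lambda>z. theta2 (b z) (a z)) holomorphic_on A"
proof -
  have "(\<lambda>z. theta3 (b z + of_real pi * a z) (a z)) holomorphic_on A"
    using assms by (intro theta3_holomorphic holomorphic_intros) auto
  then show ?thesis
    unfolding theta2_eq using assms by (intro holomorphic_intros) auto
qed

lemma theta3_minus: "theta3 (-v) \<tau> = theta3 v \<tau>"
  unfolding theta3_eq
  by (rule infsum_reindex_bij_witness[of _ uminus uminus]) (auto simp: th_term_def)

lemma theta2_minus: "theta2 (-v) \<tau> = theta2 v \<tau>"
  unfolding theta2_def
  by (rule infsum_reindex_bij_witness[of _ "\<lambda>m. -m-1" "\<lambda>m. -m-1"])
     (auto simp: power2_eq_square algebra_simps)

lemma theta3_plus_pi:
  fixes v \<tau> :: complex
  shows "theta3 (v + pi) \<tau> = theta3 v \<tau>"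
  unfolding theta3_eq
proof (rule infsum_cong)
  fix m :: int
  have "exp (2 * of_int m * \<i> * of_real pi) = 1"
    using exp_integer_2pi[of "of_int m"] by (simp add: mult_ac)
  then show "th_term (v + pi) \<tau> m = th_term v \<tau> m"
    by (simp add: th_term_def exp_add ring_distribs)
qed

lemma theta2_plus_pi:
  fixes v \<tau> :: complex
  shows "theta2 (v + pi) \<tau> = - theta2 v \<tau>"
proof -
  have "theta3 (v + of_real pi + of_real pi * \<tau>) \<tau> = theta3 (v + of_real pi * \<tau>) \<tau>"
    using theta3_plus_pi[of "v + of_real pi * \<tau>"] by (simp add: add_ac)
  then show ?thesis unfolding theta2_eq by (simp add: exp_add ring_distribs)
qed

text \<open>With the nome \<open>exp (2 pi i \<tau>)\<close> the quasi-period is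
  \<open>2 * pi * \<tau>\<close>; half of it exchanges the two theta functions up to an exponential
  factor.\<close>

lemma theta3_plus_pi_tau:
  fixes v \<tau> :: complex
  shows "theta3 (v + pi * \<tau>) \<tau> = exp (- \<i> * pi * \<tau> / 2 - \<i> * v) * theta2 v \<tau>"
proof -
  have "exp (- \<i> * pi * \<tau> / 2 - \<i> * v) * exp (\<i> * pi * \<tau> / 2 + \<i> * v) = 1"
    by (simp flip: exp_add)
  then show ?thesis unfolding theta2_eq by (simp flip: mult.assoc)
qed

lemma theta3_plus_2pi_tau:
  fixes v \<tau> :: complex
  shows "theta3 (v + 2 * of_real pi * \<tau>) \<tau> = exp (- 2 * \<i> * pi * \<tau> - 2 * \<i> * v) * theta3 v \<tau>"
proof -
  have "theta3 (v + 2 * of_real pi * \<tau>) \<tau> = (\<Sum>\<^sub>\<infinity>m. exp (- 2 * \<i> * pi * \<tau> - 2 * \<i> * v) * th_term v \<tau> m)"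
    unfolding theta3_eq th_term_def exp_add[symmetric]
    by (rule infsum_reindex_bij_witness[of _ "\<lambda>m. m-1" "\<lambda>m. m+1"])
       (auto simp: field_simps power2_eq_square)
  then show ?thesis by (simp add: theta3_eq infsum_cmult_right')
qed

lemma theta2_plus_pi_tau:
  fixes v \<tau> :: complex
  shows "theta2 (v + pi * \<tau>) \<tau> = exp (- \<i> * pi * \<tau> / 2 - \<i> * v) * theta3 v \<tau>"
proof -
  have "theta2 (v + pi * \<tau>) \<tau> = exp (\<i> * pi * \<tau> / 2 + \<i> * (v + pi * \<tau>)) * theta3 (v + 2 * of_real pi * \<tau>) \<tau>"
    unfolding theta2_eq by (simp add: algebra_simps)
  also have "\<dots> = exp (\<i> * pi * \<tau> / 2 + \<i> * (v + pi * \<tau>)) * exp (- 2 * \<i> * pi * \<tau> - 2 * \<i> * v) * theta3 v \<tau>"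
    unfolding theta3_plus_2pi_tau by (simp add: mult.assoc)
  also have "exp (\<i> * pi * \<tau> / 2 + \<i> * (v + pi * \<tau>)) * exp (- 2 * \<i> * pi * \<tau> - 2 * \<i> * v)
      = exp (- \<i> * pi * \<tau> / 2 - \<i> * v)"
    unfolding exp_add[symmetric] by (rule arg_cong[of _ _ exp]) (simp add: field_simps)
  finally show ?thesis .
qed

text \<open>Between \<open>-pi/2\<close> and \<open>pi/2\<close> antiperiodicity changes the sign
  and evenness keeps it.\<close>

lemma theta2_half_pi: "theta2 (of_real pi/2) \<tau> = 0"
  using theta2_plus_pi[of "-of_real pi/2" \<tau>] theta2_minus[of "of_real pi/2" \<tau>] by (simp add: field_simps)

text \<open>Even and odd indices of the series at \<open>\<tau>/4\<close>. Positivity of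
  \<open>theta3\<close> at \<open>\<tau>/4\<close> will thereby bound \<open>theta2\<close> by
  \<open>theta3\<close> on the real line.\<close>

lemma theta3_add_theta2: 
  assumes "Im \<tau> > 0"
  shows "theta3 v \<tau> + theta2 v \<tau> = theta3 (v/2) (\<tau>/4)"
proof -
  have s: "th_term (v/2) (\<tau>/4) summable_on UNIV" using assms by (intro th_term_summable) auto
  have 3: "theta3 v \<tau> = (\<Sum>\<^sub>\<infinity>m\<in>{m. even m}. th_term (v/2) (\<tau>/4) m)"
    unfolding theta3_eq
    by (rule infsum_reindex_bij_witness[of _ "\<lambda>m. m div 2" "\<lambda>m. 2*m"])
       (auto simp: th_term_def power2_eq_square mult_ac elim!: evenE)
  have 2: "theta2 v \<tau> = (\<Sum>\<^sub>\<infinity>m\<in>{m. odd m}. th_term (v/2) (\<tau>/4) m)"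
    unfolding theta2_def
  proof (rule infsum_reindex_bij_witness[of _ "\<lambda>m. m div 2" "\<lambda>m. 2*m+1"])
    show "th_term (v/2) (\<tau>/4) (2*m+1) = q_pow \<tau> ((of_int m + 1/2)\<^sup>2) * exp ((2 * of_int m + 1) * \<i> * v)" for m
      unfolding th_term_def q_pow_def exp_add[symmetric]
      by (rule arg_cong[of _ _ exp]) (simp add: field_simps power2_eq_square)
  qed (auto elim!: oddE)
  have "UNIV = {m::int. even m} \<union> {m. odd m}" by auto
  then have "theta3 (v/2) (\<tau>/4) = (\<Sum>\<^sub>\<infinity>m\<in>{m. even m} \<union> {m. odd m}. th_term (v/2) (\<tau>/4) m)"
    by (simp add: theta3_eq)
  also have "\<dots> = theta3 v \<tau> + theta2 v \<tau>"
    unfolding 2 3 by (rule infsum_Un_disjoint) (auto intro: summable_on_subset_banach[OF s])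
  finally show ?thesis by simp
qed

text \<open>For imaginary \<open>\<tau>\<close> one has \<open>- cnj \<tau> = \<tau>\<close>, so
  \<open>theta3\<close> is then real on the real line.\<close>

lemma theta3_cnj: "cnj (theta3 v \<tau>) = theta3 (cnj v) (- cnj \<tau>)"
  unfolding theta3_eq infsum_cnj[symmetric]
  by (rule infsum_reindex_bij_witness[of _ "uminus" "uminus"]) (auto simp: th_term_def exp_cnj algebra_simps)

section \<open>Doubly periodic functions and the Euler product\<close>

text \<open>Zeros of \<open>g\<close> are simple, so l'Hopital's rule gives \<open>f / g\<close> a
  finite limit there and the singularities are removable.\<close>

lemma entire_quotient:
  fixes f g :: "complex \<Rightarrow> complex"
  assumes f: "f holomorphic_on UNIV" and g: "g holomorphic_on UNIV"
    and zeros: "\<And>z. g z = 0 \<Longrightarrow> f z = 0 \<and> deriv g z \<noteq> 0"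
  obtains h where "h holomorphic_on UNIV" "\<And>z. f z = h z * g z"
proof
  let ?q = "\<lambda>z. f z / g z"
  have an: "?q analytic_on {z}" if "g z \<noteq> 0" for z
    using that f g by (intro analytic_on_divide) (auto simp: analytic_at open_UNIV)
  have "remove_sings ?q analytic_on {z}" for z
  proof (cases "g z = 0")
    case True
    have "?q meromorphic_on {z}"
      using f g by (intro meromorphic_on_divide analytic_on_imp_meromorphic_on) (auto simp: analytic_at open_UNIV)
    then have "isolated_singularity_at ?q z"
      by (simp add: meromorphic_at_iff)
    moreover have "?q \<midarrow>z\<rightarrow> deriv f z / deriv g z"
      using True zeros[OF True] f g
      by (intro lhopital_complex_simple[where f' = "deriv f z" and g' = "deriv g z"])
         (auto intro: holomorphic_derivI[of _ UNIV])
    ultimately show ?thesis by (rule remove_sings_analytic_at)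
  qed (auto intro!: remove_sings_analytic_on an)
  then show "remove_sings ?q holomorphic_on UNIV"
    by (metis analytic_imp_holomorphic analytic_on_analytic_at)
  show "f z = remove_sings ?q z * g z" for z
    using zeros[of z] an[of z] by (cases "g z = 0") auto
qed

text \<open>Where \<open>g\<close> vanishes, the derivative of the zero product is
  \<open>f z * deriv g z\<close>, and \<open>deriv g z\<close> is nonzero.\<close>

lemma mult_cancel_entire:
  fixes f g :: "complex \<Rightarrow> complex"
  assumes f: "f holomorphic_on UNIV" and g: "g holomorphic_on UNIV"
    and zeros: "\<And>z. g z = 0 \<Longrightarrow> deriv g z \<noteq> 0"
    and eq: "\<And>z. f z * g z = 0"
  shows "f z = 0"
proof (cases "g z = 0")
  case True
  have "((\<lambda>z. f z * g z) has_field_derivative deriv f z * g z + f z * deriv g z) (at z)"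
    using f g by (auto intro!: derivative_eq_intros holomorphic_derivI[of _ UNIV])
  moreover have "((\<lambda>z. f z * g z) has_field_derivative 0) (at z)" unfolding eq by simp
  ultimately have "deriv f z * g z + f z * deriv g z = 0" by (rule DERIV_unique)
  then show ?thesis using zeros[OF True] True by simp
qed (use eq in auto)

text \<open>The codomain is arbitrary because truth values are used too: the predicate of being a
  zero is periodic even when the function only gains a nonvanishing factor.\<close>

lemma periodic_int:
  fixes f :: "complex \<Rightarrow> 'a"
  assumes "\<And>z. f (z + b) = f z"
  shows "f (z + of_int k * b) = f z"
proof -
  have nat: "f (z + of_nat m * b) = f z" for m z
    by (induction m) (auto simp: ring_distribs add.assoc[symmetric] add.commute[of b] assms)
  show ?thesis
  proof (cases "k \<ge> 0")
    case True
    then show ?thesis using nat[of z "nat k"] by simp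
  next
    case False
    then show ?thesis using nat[of "z + of_int k * b" "nat (-k)"] by simp
  qed
qed

text \<open>Multiples of \<open>b\<close> first fix the imaginary part; the real period then adjusts
  the real part without disturbing it.\<close>

lemma period_reduction:
  fixes r :: real and b :: complex
  assumes r: "r > 0" and b: "Im b > 0"
  obtains k l :: int where "\<bar>Re (z + of_int k * b + of_int l * of_real r)\<bar> \<le> r"
    "\<bar>Im (z + of_int k * b + of_int l * of_real r)\<bar> \<le> Im b"
proof -
  define k where "k = - \<lfloor>Im z / Im b\<rfloor>"
  define w where "w = z + of_int k * b"
  define l where "l = - \<lfloor>Re w / r\<rfloor>"
  have "of_int \<lfloor>Im z / Im b\<rfloor> * Im b \<le> Im z" "Im z \<le> (of_int \<lfloor>Im z / Im b\<rfloor> + 1) * Im b"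
    using b by (simp_all flip: pos_le_divide_eq pos_divide_le_eq)
  then have 1: "\<bar>Im w\<bar> \<le> Im b" by (simp add: w_def k_def algebra_simps)
  have "of_int \<lfloor>Re w / r\<rfloor> * r \<le> Re w" "Re w \<le> (of_int \<lfloor>Re w / r\<rfloor> + 1) * r"
    using r by (simp_all flip: pos_le_divide_eq pos_divide_le_eq)
  then have "\<bar>Re (w + of_int l * of_real r)\<bar> \<le> r" by (simp add: l_def algebra_simps)
  moreover have "\<bar>Im (w + of_int l * of_real r)\<bar> \<le> Im b" using 1 by simp
  ultimately show ?thesis using that by (simp add: w_def)
qed

lemma entire_doubly_periodic_constant:
  fixes h :: "complex \<Rightarrow> complex" and r :: real
  assumes h: "h holomorphic_on UNIV" and r: "r > 0" and b: "Im b > 0"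
    and per: "\<And>z. h (z + of_real r) = h z" "\<And>z. h (z + b) = h z"
  obtains c where "\<And>z. h z = c"
proof -
  define K where "K = cbox (Complex (-r) (-Im b)) (Complex r (Im b))"
  have "compact (h ` K)"
    unfolding K_def using h
    by (intro compact_continuous_image holomorphic_on_imp_continuous_on[OF holomorphic_on_subset[OF h]]) auto
  then have bd: "bounded (h ` K)" by (rule compact_imp_bounded)
  have "range h \<subseteq> h ` K"
  proof safe
    fix z
    obtain k l where kl: "\<bar>Re (z + of_int k * b + of_int l * of_real r)\<bar> \<le> r"
      "\<bar>Im (z + of_int k * b + of_int l * of_real r)\<bar> \<le> Im b"
      using period_reduction[OF r b] by blast
    then have "z + of_int k * b + of_int l * of_real r \<in> K"
      unfolding K_def by (auto simp: in_cbox_complex_iff abs_le_iff)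
    moreover have "h (z + of_int k * b + of_int l * of_real r) = h z"
      using periodic_int[of h "of_real r", OF per(1)] periodic_int[of h b, OF per(2)] by simp
    ultimately show "h z \<in> h ` K" by (metis imageI)
  qed
  then have "bounded (range h)" using bd bounded_subset by blast
  then show ?thesis using Liouville_theorem[OF h] that unfolding constant_on_def by auto
qed

text \<open>Equal multipliers make the entire quotient of \<open>f\<close> by \<open>g\<close>
  doubly periodic, hence constant. This serves both for \<open>theta3\<close> against its product
  and for the numerator of the Blaschke formula against \<open>theta2\<close> at
  \<open>n * \<tau>\<close>.\<close>

lemma theta_quotient_constant:
  fixes f g M :: "complex \<Rightarrow> complex" and r :: real
  assumes f: "f holomorphic_on UNIV" and g: "g holomorphic_on UNIV"
    and zeros: "\<And>z. g z = 0 \<Longrightarrow> f z = 0 \<and> deriv g z \<noteq> 0"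
    and r: "r > 0" and b: "Im b > 0"
    and per1: "\<And>z. f (z + of_real r) = \<mu> * f z" "\<And>z. g (z + of_real r) = \<mu> * g z" "\<mu> \<noteq> 0"
    and per2: "\<And>z. f (z + b) = M z * f z" "\<And>z. g (z + b) = M z * g z" "\<And>z. M z \<noteq> 0"
  obtains c where "\<And>z. f z = c * g z"
proof -
  obtain h where h: "h holomorphic_on UNIV" "\<And>z. f z = h z * g z"
    using entire_quotient[OF f g zeros] by blast
  have hc: "(\<lambda>z. h (z + c) - h z) holomorphic_on UNIV" for c
  proof -
    have "(h \<circ> (\<lambda>z. z + c)) holomorphic_on UNIV"
      by (intro holomorphic_on_compose holomorphic_on_subset[OF h(1)] holomorphic_intros) auto
    then show ?thesis by (auto simp: o_def intro!: holomorphic_intros h(1))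
  qed
  have e1: "(h (z + of_real r) - h z) * g z = 0" for z
    using h(2)[of "z + of_real r"] h(2)[of z] per1 by auto
  have 1: "h (z + of_real r) - h z = 0" for z
    by (rule mult_cancel_entire[OF hc g _ e1]) (use zeros in auto)
  have e2: "(h (z + b) - h z) * g z = 0" for z
    using h(2)[of "z + b"] h(2)[of z] per2(1,2)[of z] per2(3)[of z] by (simp add: algebra_simps)
  have 2: "h (z + b) - h z = 0" for z
    by (rule mult_cancel_entire[OF hc g _ e2]) (use zeros in auto)
  obtain c where "\<And>z. h z = c"
    using entire_doubly_periodic_constant[OF h(1) r b] 1 2 by auto
  then show ?thesis using that h(2) by auto
qed

text \<open>Euler: the power series with these coefficients is \<open>\<Prod>m. 1 + q\<^bsup>2m+1\<^esup> x\<close>.\<close>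
definition euler_coeff :: "complex \<Rightarrow> nat \<Rightarrow> complex" where
  "euler_coeff q n = (\<Prod>k<n. q ^ (2*k+1) / (1 - q ^ (2*k+2)))"

definition euler_prod :: "complex \<Rightarrow> complex \<Rightarrow> complex" where
  "euler_prod q x = eval_fps (Abs_fps (euler_coeff q)) x"

section \<open>Euler's product: convergence, functional equation and simple zeros\<close>

context
  fixes q :: complex
  assumes q: "norm q < 1" "q \<noteq> 0"
begin

lemma one_minus_q_power: "1 - q ^ (2*k+2) \<noteq> 0"
proof
  assume "1 - q ^ (2*k+2) = 0"
  then have "norm (q ^ (2*k+2)) = 1" by (metis eq_iff_diff_eq_0 norm_one)
  moreover have "norm q ^ (2*k+2) < 1" using q power_Suc_less_one[of "norm q" "2*k+1"] by simp
  ultimately show False by (simp add: norm_power norm_mult)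
qed

lemma euler_coeff_Suc: "euler_coeff q (Suc n) = euler_coeff q n * (q ^ (2*n+1) / (1 - q ^ (2*n+2)))"
  by (simp add: euler_coeff_def)

lemma euler_coeff_nonzero: "euler_coeff q n \<noteq> 0"
  unfolding euler_coeff_def using one_minus_q_power q by simp

text \<open>Ratio test: the quotient of consecutive coefficients tends to 0.\<close>

lemma euler_conv_radius: "fps_conv_radius (Abs_fps (euler_coeff q)) = \<infinity>"
proof -
  have "(\<lambda>n. norm (q ^ n)) \<longlonglongrightarrow> 0"
    using q by (simp add: norm_power LIMSEQ_power_zero)
  then have p: "(\<lambda>n. q ^ n) \<longlonglongrightarrow> 0" by (rule tendsto_norm_zero_cancel)
  have s1: "strict_mono (\<lambda>n::nat. 2*n+1)" "strict_mono (\<lambda>n::nat. 2*n+2)" by (auto simp: strict_mono_def)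
  have "(\<lambda>n. q ^ (2*n+1) / (1 - q ^ (2*n+2))) \<longlonglongrightarrow> 0 / (1 - 0)"
    using LIMSEQ_subseq_LIMSEQ[OF p s1(1)] LIMSEQ_subseq_LIMSEQ[OF p s1(2)]
    by (intro tendsto_intros) (simp_all add: o_def)
  then have lim: "(\<lambda>n. norm (euler_coeff q (Suc n) / euler_coeff q n)) \<longlonglongrightarrow> 0"
    using euler_coeff_nonzero by (simp add: euler_coeff_Suc tendsto_norm_zero_iff)
  have "summable (\<lambda>n. euler_coeff q n * x ^ n)" for x
  proof -
    have "(\<lambda>n. norm (euler_coeff q (Suc n) / euler_coeff q n) * norm x) \<longlonglongrightarrow> 0 * norm x"
      by (intro tendsto_intros lim)
    then have "\<forall>\<^sub>F n in sequentially. norm (euler_coeff q (Suc n) / euler_coeff q n) * norm x < 1/2"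
      by (intro order_tendstoD(2)[where y = 0]) auto
    then obtain N where N: "\<And>n. n \<ge> N \<Longrightarrow> norm (euler_coeff q (Suc n) / euler_coeff q n) * norm x < 1/2"
      by (auto simp: eventually_sequentially)
    show ?thesis
    proof (rule summable_ratio_test[of "1/2" N])
      fix n assume "n \<ge> N"
      have "norm (euler_coeff q (Suc n) * x ^ Suc n)
          = norm (euler_coeff q (Suc n) / euler_coeff q n) * norm x * norm (euler_coeff q n * x ^ n)"
        using euler_coeff_nonzero[of n] by (simp add: norm_mult norm_divide norm_power)
      also have "\<dots> \<le> 1/2 * norm (euler_coeff q n * x ^ n)"
        using N[OF \<open>n \<ge> N\<close>] by (intro mult_right_mono) auto
      finally show "norm (euler_coeff q (Suc n) * x ^ Suc n) \<le> 1/2 * norm (euler_coeff q n * x ^ n)" .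
    qed simp
  qed
  then show ?thesis
    unfolding fps_conv_radius_def by (intro conv_radius_inftyI'') (simp add: Abs_fps_inverse)
qed

lemma euler_prod_sums: "(\<lambda>n. euler_coeff q n * x ^ n) sums euler_prod q x"
  using sums_eval_fps[of x "Abs_fps (euler_coeff q)"] by (simp add: euler_prod_def euler_conv_radius)

lemma euler_prod_holomorphic: "f holomorphic_on A \<Longrightarrow> (\<lambda>z. euler_prod q (f z)) holomorphic_on A"
  unfolding euler_prod_def
proof -
  assume f: "f holomorphic_on A"
  have "eval_fps (Abs_fps (euler_coeff q)) holomorphic_on UNIV"
    by (rule holomorphic_on_eval_fps) (auto simp: euler_conv_radius eball_def)
  then show "(\<lambda>z. eval_fps (Abs_fps (euler_coeff q)) (f z)) holomorphic_on A"
    using holomorphic_on_compose_gen[OF f] by (auto simp: o_def)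
qed

lemma euler_prod_0: "euler_prod q 0 = 1"
  by (simp add: euler_prod_def eval_fps_at_0 euler_coeff_def)

text \<open>Clearing the denominator in \<open>euler_coeff_Suc\<close> gives this identity
  coefficient by coefficient; it splits off the first factor of the product.\<close>

lemma euler_prod_step: "euler_prod q x = (1 + q * x) * euler_prod q (q\<^sup>2 * x)"
proof -
  have 1: "(\<lambda>n. euler_coeff q n * (q\<^sup>2 * x) ^ n) sums euler_prod q (q\<^sup>2 * x)"
    by (rule euler_prod_sums)
  have "(\<lambda>n. (q * x) * (euler_coeff q n * (q\<^sup>2 * x) ^ n)) sums (q * x * euler_prod q (q\<^sup>2 * x))"
    by (rule sums_mult[OF 1])
  \<comment> \<open>Multiplication by \<open>q * x\<close> shifts the index by one, which leaves 0
    as the term at index 0.\<close>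
  then have 2: "(\<lambda>n. if n = 0 then 0 else (q * x) * (euler_coeff q (n-1) * (q\<^sup>2 * x) ^ (n-1)))
      sums (q * x * euler_prod q (q\<^sup>2 * x))"
    using sums_Suc_iff[of "\<lambda>n. if n = 0 then 0 else (q * x) * (euler_coeff q (n-1) * (q\<^sup>2 * x) ^ (n-1))"]
    by simp
  have "euler_coeff q n * (q\<^sup>2 * x) ^ n + (if n = 0 then 0 else (q * x) * (euler_coeff q (n-1) * (q\<^sup>2 * x) ^ (n-1)))
      = euler_coeff q n * x ^ n" for n
  proof (cases n)
    case (Suc m)
    have "euler_coeff q (Suc m) * q ^ (2*m+2) + euler_coeff q m * q ^ (2*m+1) = euler_coeff q (Suc m)"
      using one_minus_q_power[of m] unfolding euler_coeff_Suc by (simp add: field_simps)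
    then have a: "(euler_coeff q (Suc m) * q ^ (2*m+2) + euler_coeff q m * q ^ (2*m+1)) * x ^ Suc m = euler_coeff q (Suc m) * x ^ Suc m"
      by simp
    have b: "(q\<^sup>2 * x) ^ n = q ^ (2*m+2) * x ^ Suc m"
      unfolding Suc power_mult_distrib power_mult[symmetric] by (simp add: mult_ac)
    have c: "q * x * (euler_coeff q m * (q\<^sup>2 * x) ^ m) = euler_coeff q m * q ^ (2*m+1) * x ^ Suc m"
      unfolding power_mult_distrib power_mult[symmetric] by (simp add: mult_ac)
    have "euler_coeff q n * (q\<^sup>2 * x) ^ n + (if n = 0 then 0 else (q * x) * (euler_coeff q (n-1) * (q\<^sup>2 * x) ^ (n-1)))
        = euler_coeff q (Suc m) * (q\<^sup>2 * x) ^ n + q * x * (euler_coeff q m * (q\<^sup>2 * x) ^ m)"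
      by (simp add: Suc)
    also have "\<dots> = euler_coeff q (Suc m) * x ^ Suc m"
      unfolding b c a[symmetric] by (simp only: ring_distribs mult.assoc)
    finally show ?thesis by (simp only: Suc)
  qed simp
  then have "(\<lambda>n. euler_coeff q n * x ^ n) sums (euler_prod q (q\<^sup>2 * x) + q * x * euler_prod q (q\<^sup>2 * x))"
    using sums_add[OF 1 2] by simp
  then show ?thesis
    using sums_unique2[OF euler_prod_sums[of x]] by (simp add: ring_distribs)
qed

lemma euler_prod_expand: "euler_prod q x = (\<Prod>m<N. 1 + q ^ (2*m+1) * x) * euler_prod q (q ^ (2*N) * x)"
proof (induction N)
  case (Suc N)
  have "euler_prod q (q ^ (2*N) * x) = (1 + q ^ (2*N+1) * x) * euler_prod q (q ^ (2 * Suc N) * x)"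
    using euler_prod_step[of "q ^ (2*N) * x"] by (simp add: mult.assoc power2_eq_square)
  then show ?case using Suc by (simp only: prod.lessThan_Suc mult.assoc)
qed simp

text \<open>The tail tends to \<open>euler_prod q 0 = 1\<close>. The bound \<open>K\<close> ensures
  that a prescribed factor is among those split off.\<close>

lemma euler_prod_tail: "\<exists>N\<ge>K. euler_prod q (q ^ (2*N) * x) \<noteq> 0"
proof -
  have "(\<lambda>n. norm (q ^ n)) \<longlonglongrightarrow> 0"
    using q by (simp add: norm_power LIMSEQ_power_zero)
  then have p: "(\<lambda>n. q ^ n) \<longlonglongrightarrow> 0" by (rule tendsto_norm_zero_cancel)
  have "(\<lambda>N. q ^ (2*N) * x) \<longlonglongrightarrow> 0 * x"
    using LIMSEQ_subseq_LIMSEQ[OF p, of "\<lambda>n. 2*n"] by (intro tendsto_intros) (auto simp: o_def strict_mono_def)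
  moreover have "isCont (euler_prod q) 0"
    using holomorphic_on_imp_continuous_on[OF euler_prod_holomorphic[of "\<lambda>x. x" UNIV]]
    by (simp add: continuous_on_eq_continuous_at)
  ultimately have "(\<lambda>N. euler_prod q (q ^ (2*N) * x)) \<longlonglongrightarrow> 1"
    using isCont_tendsto_compose[of 0 "euler_prod q" "\<lambda>N. q ^ (2*N) * x"] by (simp add: euler_prod_0)
  then have "\<forall>\<^sub>F N in sequentially. euler_prod q (q ^ (2*N) * x) \<noteq> 0"
    by (rule tendsto_imp_eventually_ne) simp
  then obtain N where "\<And>n. n \<ge> N \<Longrightarrow> euler_prod q (q ^ (2*n) * x) \<noteq> 0"
    by (auto simp: eventually_sequentially)
  then have "euler_prod q (q ^ (2 * max K N) * x) \<noteq> 0" by simp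
  then show ?thesis by (meson max.cobounded1)
qed

lemma euler_prod_eq_0_iff: "euler_prod q x = 0 \<longleftrightarrow> (\<exists>m. q ^ (2*m+1) * x = -1)"
proof
  assume 0: "euler_prod q x = 0"
  obtain N where "euler_prod q (q ^ (2*N) * x) \<noteq> 0" using euler_prod_tail[of 0 x] by blast
  then have "(\<Prod>m<N. 1 + q ^ (2*m+1) * x) = 0" using 0 euler_prod_expand[of x N] by simp
  then show "\<exists>m. q ^ (2*m+1) * x = -1" 
    by (auto simp: add_eq_0_iff)
next
  assume "\<exists>m. q ^ (2*m+1) * x = -1"
  then obtain m where "1 + q ^ (2*m+1) * x = 0" by (metis add.right_inverse)
  then show "euler_prod q x = 0"
    unfolding euler_prod_expand[of x "Suc m"] by simp
qed

text \<open>Only one factor vanishes at \<open>x\<close>, since distinct powers of \<open>q\<close>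
  have distinct norms; the rest of the product, \<open>H\<close>, is nonzero there.\<close>

lemma euler_prod_simple_zero:
  assumes "euler_prod q x = 0"
  shows "deriv (euler_prod q) x \<noteq> 0"
proof -
  obtain m where m: "q ^ (2*m+1) * x = -1" using assms unfolding euler_prod_eq_0_iff by blast
  obtain N where N: "N \<ge> Suc m" "euler_prod q (q ^ (2*N) * x) \<noteq> 0" using euler_prod_tail by blast
  define H where "H y = (\<Prod>k\<in>{..<N}-{m}. 1 + q ^ (2*k+1) * y) * euler_prod q (q ^ (2*N) * y)" for y
  have eq: "euler_prod q y = (1 + q ^ (2*m+1) * y) * H y" for y
    unfolding H_def by (subst euler_prod_expand[of y N], subst prod.remove[of _ m]) (use N in auto)
  have "1 + q ^ (2*k+1) * x \<noteq> 0" if "k \<noteq> m" for k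
  proof
    assume "1 + q ^ (2*k+1) * x = 0"
    then have "q ^ (2*k+1) * x = q ^ (2*m+1) * x" using m by (simp add: add_eq_0_iff)
    moreover have "x \<noteq> 0" using m by auto
    ultimately have "q ^ (2*k+1) = q ^ (2*m+1)" by simp
    then have "norm q ^ (2*k+1) = norm q ^ (2*m+1)" by (metis norm_power)
    moreover have "norm q \<noteq> 0" "norm q \<noteq> 1" using q by auto
    ultimately show False using that power_inject_exp'[of "norm q" "2*k+1" "2*m+1"] by simp
  qed
  then have Hx: "H x \<noteq> 0" unfolding H_def using N by simp
  have "H holomorphic_on UNIV"
    unfolding H_def by (intro holomorphic_intros euler_prod_holomorphic)
  then have "((\<lambda>y. (1 + q ^ (2*m+1) * y) * H y) has_field_derivative
               q ^ (2*m+1) * H x + (1 + q ^ (2*m+1) * x) * deriv H x) (at x)"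
    by (auto intro!: derivative_eq_intros holomorphic_derivI[of _ UNIV])
  then have "deriv (euler_prod q) x = q ^ (2*m+1) * H x"
    using m unfolding eq[symmetric] by (simp add: DERIV_imp_deriv)
  then show ?thesis using Hx q by simp
qed

end

section \<open>Zeros of the theta functions\<close>

lemma mult_eq_minus_one_iff:
  fixes a b x :: "'a::idom"
  assumes "a * b = 1"
  shows "a * x = - 1 \<longleftrightarrow> x = - b"
proof
  assume "a * x = - 1"
  then have "(a * b) * x = - b" by (metis mult.assoc mult.commute mult_minus1)
  then show "x = - b" using assms by simp
qed (use assms in auto)

locale imaginary_tau =
  fixes \<tau> :: complex
  assumes Re_tau: "Re \<tau> = 0" and Im_tau: "Im \<tau> > 0"
begin

definition q :: complex where "q = exp (2 * \<i> * of_real pi * \<tau>)"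

lemma tau_eq: "\<tau> = \<i> * of_real (Im \<tau>)"
  using Re_tau by (simp add: complex_eq_iff)

lemma q_eq: "q = of_real (exp (- 2 * pi * Im \<tau>))"
  unfolding q_def by (subst tau_eq) (simp add: exp_of_real[symmetric] mult_ac)

lemma q_norm: "norm q < 1" "q \<noteq> 0"
  using Im_tau by (auto simp: q_eq)

text \<open>The product side of Jacobi's triple product without the factor that is independent of
  \<open>v\<close>.\<close>

definition theta_prod :: "complex \<Rightarrow> complex" where
  "theta_prod v = euler_prod q (exp (2 * \<i> * v)) * euler_prod q (exp (- 2 * \<i> * v))"

lemma euler_prod_exp_deriv:
  fixes c :: complex
  assumes "euler_prod q (exp (c * v)) = 0" "c \<noteq> 0"
  shows "\<exists>d. d \<noteq> 0 \<and> ((\<lambda>v. euler_prod q (exp (c * v))) has_field_derivative d) (at v)"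
proof -
  have "(euler_prod q has_field_derivative deriv (euler_prod q) (exp (c * v))) (at (exp (c * v)))"
    using euler_prod_holomorphic[OF q_norm, of "\<lambda>x. x" UNIV]
    by (intro holomorphic_derivI[of _ UNIV]) (auto simp: holomorphic_on_ident)
  then have "((\<lambda>v. euler_prod q (exp (c * v))) has_field_derivative
      deriv (euler_prod q) (exp (c * v)) * (exp (c * v) * c)) (at v)"
    by (rule DERIV_chain2) (auto intro!: derivative_eq_intros)
  then show ?thesis
    using euler_prod_simple_zero[OF q_norm assms(1)] assms(2)
    by (intro exI[of _ "deriv (euler_prod q) (exp (c * v)) * (exp (c * v) * c)"]) simp
qed

text \<open>The two factors of \<open>theta_prod\<close> have reciprocal arguments, so by this bound
  they never vanish together and the zeros of the product stay simple.\<close>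

lemma euler_prod_zero_norm:
  assumes "euler_prod q x = 0" shows "norm x > 1"
proof -
  obtain m where m: "q ^ (2*m+1) * x = -1"
    using assms unfolding euler_prod_eq_0_iff[OF q_norm] by blast
  then have n: "norm q ^ (2*m+1) * norm x = 1"
    by (metis norm_minus_cancel norm_mult norm_one norm_power)
  have "norm q ^ (2*m+1) < 1" using q_norm power_Suc_less_one[of "norm q" "2*m"] by simp
  with n show ?thesis
    by (smt (verit) mult_left_le norm_ge_zero zero_le_power mult_le_one mult_less_le_imp_less)
qed

lemma theta_prod_holomorphic: "theta_prod holomorphic_on UNIV"
  unfolding theta_prod_def
  by (intro holomorphic_intros euler_prod_holomorphic[OF q_norm])

lemma theta_prod_simple_zero:
  assumes "theta_prod v = 0"
  shows "deriv theta_prod v \<noteq> 0"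
proof -
  let ?f = "\<lambda>v. euler_prod q (exp (2 * \<i> * v))" and ?g = "\<lambda>v. euler_prod q (exp (- 2 * \<i> * v))"
  have hol: "?f holomorphic_on UNIV" "?g holomorphic_on UNIV"
    by (intro holomorphic_intros euler_prod_holomorphic[OF q_norm])+
  have d: "(theta_prod has_field_derivative (deriv ?f v * ?g v + ?f v * deriv ?g v)) (at v)"
    unfolding theta_prod_def
    by (rule derivative_eq_intros holomorphic_derivI[OF hol(1)] holomorphic_derivI[OF hol(2)] | simp)+
  have ne: "?f v \<noteq> 0 \<or> ?g v \<noteq> 0"
    using euler_prod_zero_norm[of "exp (2 * \<i> * v)"] euler_prod_zero_norm[of "exp (- 2 * \<i> * v)"]
    by auto
  show ?thesis
  proof (cases "?f v = 0")
    case True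
    then obtain d' where "d' \<noteq> 0" "(?f has_field_derivative d') (at v)"
      using euler_prod_exp_deriv[of "2 * \<i>" v] by auto
    then have "deriv ?f v \<noteq> 0" using DERIV_imp_deriv by fastforce
    then show ?thesis using True ne DERIV_imp_deriv[OF d] by simp
  next
    case False
    then have g0: "?g v = 0" using assms by (simp add: theta_prod_def)
    then obtain d' where "d' \<noteq> 0" "(?g has_field_derivative d') (at v)"
      using euler_prod_exp_deriv[of "- 2 * \<i>" v] by auto
    then have "deriv ?g v \<noteq> 0" using DERIV_imp_deriv by fastforce
    then show ?thesis using False g0 DERIV_imp_deriv[OF d] by simp
  qed
qed

text \<open>The first factor supplies the negative \<open>k\<close>, in the form
  \<open>- m - 1\<close>, and the second one the \<open>k \<ge> 0\<close>.\<close>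

lemma theta_prod_eq_0_iff:
  "theta_prod v = 0 \<longleftrightarrow> (\<exists>k::int. exp (2 * \<i> * v) = - exp (2 * \<i> * of_real pi * \<tau> * (2 * of_int k + 1)))"
proof -
  let ?E = "\<lambda>k::int. exp (2 * \<i> * of_real pi * \<tau> * (2 * of_int k + 1))"
  have qp: "q ^ (2*m+1) = ?E (int m)" for m
    unfolding q_def exp_of_nat_mult[symmetric] by (simp add: algebra_simps)
  have em: "?E k * ?E (-k-1) = 1" for k unfolding mult_exp_exp by simp (simp add: algebra_simps)
  have ep: "exp (2 * \<i> * v) * exp (- 2 * \<i> * v) = 1" by (simp flip: exp_add)
  have a: "euler_prod q (exp (2 * \<i> * v)) = 0 \<longleftrightarrow> (\<exists>m::nat. exp (2 * \<i> * v) = - ?E (- int m - 1))"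
    unfolding euler_prod_eq_0_iff[OF q_norm] qp
  proof (intro ex_cong1)
    fix m
    show "(?E (int m) * exp (2 * \<i> * v) = - 1) = (exp (2 * \<i> * v) = - ?E (- int m - 1))"
      by (rule mult_eq_minus_one_iff[OF em])
  qed
  have b: "euler_prod q (exp (- 2 * \<i> * v)) = 0 \<longleftrightarrow> (\<exists>m::nat. exp (2 * \<i> * v) = - ?E (int m))"
    unfolding euler_prod_eq_0_iff[OF q_norm] qp
  proof (intro ex_cong1)
    fix m
    show "(?E (int m) * exp (- 2 * \<i> * v) = - 1) = (exp (2 * \<i> * v) = - ?E (int m))"
      using mult_eq_minus_one_iff[of "exp (- 2 * \<i> * v)" "exp (2 * \<i> * v)" "?E (int m)"] ep
      by (auto simp: mult.commute)
  qed
  have "(\<exists>k. P k) \<longleftrightarrow> (\<exists>m::nat. P (- int m - 1)) \<or> (\<exists>m::nat. P (int m))" for P :: "int \<Rightarrow> bool"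
  proof -
    have "k = int (nat k) \<or> k = - int (nat (-k-1)) - 1" for k by auto
    then show ?thesis by metis
  qed
  from this[of "\<lambda>k. exp (2 * \<i> * v) = - ?E k"] show ?thesis
    unfolding theta_prod_def using a b by simp
qed

lemma theta_prod_plus_pi:
  fixes v w :: complex
  shows "theta_prod (v + pi) = theta_prod v"
proof -
  have "exp (2 * \<i> * (v + pi)) = exp (2 * \<i> * v)" "exp (- 2 * \<i> * (v + pi)) = exp (- 2 * \<i> * v)"
    using exp_integer_2pi[of 1] exp_integer_2pi[of "-1"] by (simp_all add: ring_distribs exp_add exp_diff mult_ac)
  then show ?thesis by (simp only: theta_prod_def)
qed

text \<open>The shift replaces \<open>x = exp (2 * \<i> * v)\<close> by
  \<open>q\<^sup>2 * x\<close>. By \<open>euler_prod_step\<close> the first factor loses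
  \<open>1 + q * x\<close>, the second gains \<open>1 + inverse (q * x)\<close>, and the quotient of
  these is the multiplier \<open>inverse (q * x)\<close>.\<close>

lemma theta_prod_plus_2pi_tau:
  fixes v w :: complex
  shows "theta_prod (v + 2 * of_real pi * \<tau>) = exp (- 2 * \<i> * pi * \<tau> - 2 * \<i> * v) * theta_prod v"
proof -
  let ?x = "exp (2 * \<i> * v)" and ?G = "euler_prod q"
  have x: "exp (- 2 * \<i> * v) = inverse ?x" by (simp add: exp_minus)
  have e1: "exp (2 * \<i> * (v + 2 * of_real pi * \<tau>)) = q\<^sup>2 * ?x"
    unfolding q_def exp_of_nat_mult[symmetric] exp_double[symmetric] mult_exp_exp by (simp add: algebra_simps)
  have "theta_prod (v + 2 * of_real pi * \<tau>) = ?G (q\<^sup>2 * ?x) * ?G (inverse (q\<^sup>2 * ?x))"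
    unfolding theta_prod_def e1[symmetric] by (simp add: exp_minus[symmetric])
  also have "?G (inverse (q\<^sup>2 * ?x)) = (1 + inverse (q * ?x)) * ?G (inverse ?x)"
    using q_norm by (subst euler_prod_step[OF q_norm]) (simp add: field_simps power2_eq_square)
  also have "1 + inverse (q * ?x) = inverse (q * ?x) * (1 + q * ?x)"
    using q_norm by (simp add: field_simps)
  also have "?G (q\<^sup>2 * ?x) * (inverse (q * ?x) * (1 + q * ?x) * ?G (inverse ?x))
      = inverse (q * ?x) * (((1 + q * ?x) * ?G (q\<^sup>2 * ?x)) * ?G (inverse ?x))"
    by (simp only: mult_ac)
  also have "\<dots> = inverse (q * ?x) * theta_prod v"
    unfolding theta_prod_def x by (simp flip: euler_prod_step[OF q_norm])
  also have "inverse (q * ?x) = exp (- 2 * \<i> * pi * \<tau> - 2 * \<i> * v)"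
    unfolding q_def mult_exp_exp exp_minus[symmetric] by simp
  finally show ?thesis .
qed

lemma theta3_entire: "(\<lambda>v. theta3 v \<tau>) holomorphic_on UNIV"
  using Im_tau by (intro theta3_holomorphic holomorphic_intros) auto

lemma theta2_entire: "(\<lambda>v. theta2 v \<tau>) holomorphic_on UNIV"
  using Im_tau by (intro theta2_holomorphic holomorphic_intros) auto

lemma theta3_half_period: "theta3 (of_real pi/2 + pi * \<tau>) \<tau> = 0"
  using theta3_plus_pi_tau[of "of_real pi/2" \<tau>] by (simp add: theta2_half_pi)

lemma theta3_zero_int:
  assumes "theta3 v \<tau> = 0"
  shows "theta3 (v + of_int k * of_real pi + of_int l * (2 * of_real pi * \<tau>)) \<tau> = 0"
proof -
  have "(theta3 (v + of_int k * of_real pi + of_int l * (2 * of_real pi * \<tau>)) \<tau> = 0)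
     = (theta3 (v + of_int k * of_real pi) \<tau> = 0)"
    by (rule periodic_int) (simp add: theta3_plus_2pi_tau)
  then show ?thesis using periodic_int[of "\<lambda>v. theta3 v \<tau>" "of_real pi" v k] assms theta3_plus_pi by simp
qed

lemma exp_eq_iff_shift:
  fixes v w :: complex
  shows "exp (2 * \<i> * v) = - exp (2 * \<i> * w) \<longleftrightarrow> (\<exists>k::int. v = w + of_real pi/2 + of_int k * pi)"
proof -
  have "- exp (2 * \<i> * w) = exp (2 * \<i> * w + \<i> * pi)" by (simp add: exp_add)
  then have "exp (2 * \<i> * v) = - exp (2 * \<i> * w) \<longleftrightarrow>
      (\<exists>n::int. 2 * \<i> * v = 2 * \<i> * w + \<i> * pi + (of_int (2 * n) * pi) * \<i>)"
    by (simp add: exp_eq)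
  also have "\<dots> \<longleftrightarrow> (\<exists>k::int. v = w + of_real pi/2 + of_int k * pi)"
  proof (rule ex_cong1)
    fix n :: int
    have "2 * \<i> * v = 2 * \<i> * w + \<i> * pi + (of_int (2 * n) * pi) * \<i> \<longleftrightarrow>
       2 * \<i> * v = 2 * \<i> * (w + of_real pi/2 + of_int n * pi)" by (simp add: algebra_simps)
    then show "(2 * \<i> * v = 2 * \<i> * w + \<i> * pi + (of_int (2 * n) * pi) * \<i>) = (v = w + of_real pi/2 + of_int n * pi)"
      by simp
  qed
  finally show ?thesis .
qed

lemma theta_prod_zero_imp: 
  assumes "theta_prod v = 0" 
  shows "\<exists>k l::int. v = of_real pi/2 + pi * \<tau> + of_int k * of_real pi + of_int l * (2 * of_real pi * \<tau>)"
proof -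
  obtain l :: int where "exp (2 * \<i> * v) = - exp (2 * \<i> * (of_real pi * \<tau> * (2 * of_int l + 1)))"
    using assms unfolding theta_prod_eq_0_iff by (auto simp: mult_ac)
  then obtain k :: int where "v = of_real pi * \<tau> * (2 * of_int l + 1) + of_real pi/2 + of_int k * pi"
    using exp_eq_iff_shift by blast
  then have "v = of_real pi/2 + pi * \<tau> + of_int k * of_real pi + of_int l * (2 * of_real pi * \<tau>)"
    by (simp add: algebra_simps)
  then show ?thesis by blast
qed

text \<open>All terms are positive, and the one at index 0 is 1.\<close>

lemma theta3_0_pos: "Re (theta3 0 \<tau>) > 0"
proof -
  have t: "th_term 0 \<tau> m = of_real (exp (- 2 * pi * (of_int m)\<^sup>2 * Im \<tau>))" for m
    unfolding th_term_def by (subst tau_eq) (simp add: exp_of_real[symmetric] mult_ac)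
  have s: "(\<lambda>m. Re (th_term 0 \<tau> m)) summable_on UNIV"
    by (rule summable_on_Re[OF th_term_summable[OF Im_tau]])
  have "(\<Sum>\<^sub>\<infinity>m\<in>{0}. Re (th_term 0 \<tau> m)) \<le> (\<Sum>\<^sub>\<infinity>m. Re (th_term 0 \<tau> m))"
    by (rule infsum_mono2[OF _ s]) (auto simp: t)
  then have "1 \<le> Re (theta3 0 \<tau>)"
    unfolding theta3_eq infsum_Re[OF th_term_summable[OF Im_tau], symmetric] by (simp add: t)
  then show ?thesis by simp
qed

text \<open>Jacobi's triple product up to a constant, which transfers location and simplicity of the
  zeros to \<open>theta3\<close>. The constant is nonzero because \<open>theta3 0 \<tau>\<close>
  is.\<close>

lemma theta3_product:
  obtains c where "c \<noteq> 0" "\<And>v. theta3 v \<tau> = c * theta_prod v"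
proof -
  have "\<exists>c. \<forall>v. theta3 v \<tau> = c * theta_prod v"
  proof (rule theta_quotient_constant[OF theta3_entire theta_prod_holomorphic,
        where r = pi and b = "2 * of_real pi * \<tau>" and \<mu> = 1 and M = "\<lambda>v. exp (- 2 * \<i> * pi * \<tau> - 2 * \<i> * v)"])
    fix z assume z: "theta_prod z = 0"
    then show "theta3 z \<tau> = 0 \<and> deriv theta_prod z \<noteq> 0"
      using theta_prod_zero_imp[OF z] theta3_zero_int[OF theta3_half_period] theta_prod_simple_zero by auto
  qed (use Im_tau in \<open>auto simp: theta3_plus_pi theta_prod_plus_pi theta3_plus_2pi_tau theta_prod_plus_2pi_tau\<close>)
  then obtain c where c: "\<And>v. theta3 v \<tau> = c * theta_prod v" by blast
  moreover have "c \<noteq> 0" using c[of 0] theta3_0_pos by auto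
  ultimately show ?thesis using that by blast
qed

lemma theta3_eq_0_iff:
  "theta3 v \<tau> = 0 \<longleftrightarrow> (\<exists>k l::int. v = of_real pi/2 + pi * \<tau> + of_int k * of_real pi + of_int l * (2 * of_real pi * \<tau>))"
proof
  show "theta3 v \<tau> = 0 \<Longrightarrow> \<exists>k l::int. v = of_real pi/2 + pi * \<tau> + of_int k * of_real pi + of_int l * (2 * of_real pi * \<tau>)"
    using theta3_product theta_prod_zero_imp by (metis mult_eq_0_iff)
qed (use theta3_zero_int[OF theta3_half_period] in auto)

lemma theta3_simple_zero:
  assumes "theta3 v \<tau> = 0"
  shows "deriv (\<lambda>v. theta3 v \<tau>) v \<noteq> 0"
proof -
  obtain c where c: "c \<noteq> 0" "\<And>v. theta3 v \<tau> = c * theta_prod v" using theta3_product by blast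
  have "theta_prod field_differentiable at v"
    using theta_prod_holomorphic by (auto simp: holomorphic_on_def)
  then have "deriv (\<lambda>v. theta3 v \<tau>) v = c * deriv theta_prod v" unfolding c by (rule deriv_cmult)
  then show ?thesis using c assms theta_prod_simple_zero by auto
qed

lemma theta2_eq_0_iff:
  "theta2 v \<tau> = 0 \<longleftrightarrow> (\<exists>k l::int. v = of_real pi/2 + of_int k * of_real pi + of_int l * (2 * of_real pi * \<tau>))"
proof -
  have "theta2 v \<tau> = 0 \<longleftrightarrow> theta3 (v + pi * \<tau>) \<tau> = 0" unfolding theta2_eq by simp
  also have "\<dots> \<longleftrightarrow> (\<exists>k l::int. v = of_real pi/2 + of_int k * of_real pi + of_int l * (2 * of_real pi * \<tau>))"
    unfolding theta3_eq_0_iff by (intro ex_cong1) (auto simp: algebra_simps)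
  finally show ?thesis .
qed

lemma theta2_simple_zero:
  assumes "theta2 v \<tau> = 0"
  shows "deriv (\<lambda>v. theta2 v \<tau>) v \<noteq> 0"
proof -
  let ?f = "\<lambda>v. exp (\<i> * pi * \<tau> / 2 + \<i> * v)" and ?g = "\<lambda>v. theta3 (v + pi * \<tau>) \<tau>"
  have g0: "?g v = 0" using assms unfolding theta2_eq by simp
  have "((\<lambda>v. theta3 v \<tau>) has_field_derivative deriv (\<lambda>v. theta3 v \<tau>) (v + pi * \<tau>)) (at (v + pi * \<tau>))"
    by (rule holomorphic_derivI[OF theta3_entire]) auto
  then have "(?g has_field_derivative deriv (\<lambda>v. theta3 v \<tau>) (v + pi * \<tau>)) (at v)"
    by (subst (asm) DERIV_shift)
  then have "((\<lambda>v. ?f v * ?g v) has_field_derivative ?f v * deriv (\<lambda>v. theta3 v \<tau>) (v + pi * \<tau>)) (at v)"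
    using g0 by (auto intro!: derivative_eq_intros)
  then have "deriv (\<lambda>v. theta2 v \<tau>) v = ?f v * deriv (\<lambda>v. theta3 v \<tau>) (v + pi * \<tau>)"
    unfolding theta2_eq by (rule DERIV_imp_deriv)
  then show ?thesis using theta3_simple_zero[OF g0] by simp
qed

text \<open>On the real line \<open>theta3\<close> is real, continuous and without zeros, so it
  keeps the sign it has at 0.\<close>

lemma theta3_real_pos: "Im (theta3 (of_real x) \<tau>) = 0 \<and> Re (theta3 (of_real x) \<tau>) > 0"
proof -
  have real: "theta3 (of_real x) \<tau> \<in> \<real>" for x
  proof -
    have "- cnj \<tau> = \<tau>" using Re_tau by (simp add: complex_eq_iff)
    then show ?thesis using theta3_cnj[of "of_real x" \<tau>] by (simp add: Reals_cnj_iff)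
  qed
  have nz: "theta3 (of_real x) \<tau> \<noteq> 0" for x
  proof
    assume "theta3 (of_real x) \<tau> = 0"
    then obtain k l :: int where "of_real x = of_real pi/2 + pi * \<tau> + of_int k * of_real pi + of_int l * (2 * of_real pi * \<tau>)"
      using theta3_eq_0_iff by blast
    then have "Im (of_real x) = Im (of_real pi/2 + pi * \<tau> + of_int k * of_real pi + of_int l * (2 * of_real pi * \<tau>))" by simp
    then have "(2 * of_int l + 1) * (pi * Im \<tau>) = 0" by (simp add: algebra_simps)
    then have "2 * l + 1 = 0" using Im_tau by (metis mult_eq_0_iff of_int_1 of_int_add of_int_eq_0_iff of_int_mult of_int_numeral pi_neq_zero less_irrefl)
    then show False by presburger
  qed
  have cont: "continuous_on A (\<lambda>x. Re (theta3 (of_real x) \<tau>))" for A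
    by (intro continuous_intros continuous_on_compose2[OF holomorphic_on_imp_continuous_on[OF theta3_entire]]) auto
  have R: "Re (theta3 (of_real x) \<tau>) \<noteq> 0" for x
    using nz[of x] real[of x] by (auto simp: complex_eq_iff complex_is_Real_iff)
  have "Re (theta3 (of_real x) \<tau>) > 0"
  proof (rule ccontr)
    assume "\<not> Re (theta3 (of_real x) \<tau>) > 0"
    then have neg: "Re (theta3 (of_real x) \<tau>) < 0" using R[of x] by linarith
    have "connected ((\<lambda>x. Re (theta3 (of_real x) \<tau>)) ` UNIV)"
      by (intro connected_continuous_image cont) auto
    then have "0 \<in> (\<lambda>x. Re (theta3 (of_real x) \<tau>)) ` UNIV"
    proof (rule connectedD_interval)
      show "Re (theta3 (of_real x) \<tau>) \<in> (\<lambda>x. Re (theta3 (of_real x) \<tau>)) ` UNIV" by blast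
      show "Re (theta3 (of_real 0) \<tau>) \<in> (\<lambda>x. Re (theta3 (of_real x) \<tau>)) ` UNIV" by blast
    qed (use neg theta3_0_pos in auto)
    then show False using R by auto
  qed
  then show ?thesis using real[of x] by (auto simp: complex_is_Real_iff)
qed

end

section \<open>The explicit form of the Chebyshev--Blaschke product\<close>

text \<open>Vieta in homogeneous form: \<open>X = z\<^sup>2\<close>, \<open>Y = 1\<close> gives the
  numerator of the Blaschke product, \<open>X = 1\<close>, \<open>Y = z\<^sup>2\<close> the
  denominator.\<close>

lemma prod_diff_expand:
  fixes B :: "nat \<Rightarrow> 'a::comm_ring_1"
  shows "(\<Prod>i\<in>{1..m}. X - B i * Y)
       = (\<Sum>j\<le>m. (-1) ^ j * (\<Sum>I | I \<subseteq> {1..m} \<and> card I = j. \<Prod>i\<in>I. B i) * X ^ (m - j) * Y ^ j)"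
proof -
  have "(\<Prod>i\<in>{1..m}. X - B i * Y) = (\<Prod>i\<in>{1..m}. (- 1) * Y * B i + X)"
    by (intro prod.cong) (auto simp: algebra_simps)
  also have "\<dots> = (\<Sum>I\<in>Pow {1..m}. (\<Prod>i\<in>I. (- 1) * Y * B i) * (\<Prod>i\<in>{1..m} - I. X))"
    by (rule prod_add) simp
  also have "\<dots> = (\<Sum>I\<in>Pow {1..m}. (-1) ^ card I * (\<Prod>i\<in>I. B i) * X ^ (m - card I) * Y ^ card I)"
  proof (rule sum.cong)
    fix I assume "I \<in> Pow {1..m}"
    then have I: "I \<subseteq> {1..m}" by simp
    then have "finite I" by (rule finite_subset) simp
    then show "(\<Prod>i\<in>I. (- 1) * Y * B i) * (\<Prod>i\<in>{1..m} - I. X) = (-1) ^ card I * (\<Prod>i\<in>I. B i) * X ^ (m - card I) * Y ^ card I"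
      using I unfolding prod.distrib prod_constant by (simp add: card_Diff_subset mult_ac)
  qed simp
  also have "\<dots> = (\<Sum>j\<le>m. \<Sum>I | I \<in> Pow {1..m} \<and> card I = j. (-1) ^ card I * (\<Prod>i\<in>I. B i) * X ^ (m - card I) * Y ^ card I)"
    by (rule sum.group[symmetric]) (auto intro: card_mono[of "{1..m}", simplified])
  also have "\<dots> = (\<Sum>j\<le>m. (-1) ^ j * (\<Sum>I | I \<subseteq> {1..m} \<and> card I = j. \<Prod>i\<in>I. B i) * X ^ (m - j) * Y ^ j)"
    by (intro sum.cong) (auto simp: sum_distrib_left sum_distrib_right)
  finally show ?thesis .
qed

lemma cb_S_0: "cb_S n 0 \<tau> = 1"
proof -
  have "{I. I \<subseteq> {1..n div 2} \<and> card I = 0} = {{}}"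
    using finite_subset[of _ "{1..n div 2}"] by auto
  then show ?thesis by (simp add: cb_S_def)
qed

lemma cb_prod_numerator:
  "(\<Prod>i\<in>{1..n div 2}. z\<^sup>2 - cb_b n i \<tau>)
     = z ^ (2 * (n div 2)) + (\<Sum>j = 1..n div 2. (-1) ^ j * cb_S n j \<tau> * z ^ (2 * (n div 2) - 2 * j))"
proof -
  have "(\<Prod>i\<in>{1..n div 2}. z\<^sup>2 - cb_b n i \<tau>) = (\<Sum>j\<le>n div 2. (-1) ^ j * cb_S n j \<tau> * z ^ (2 * (n div 2) - 2 * j))"
    using prod_diff_expand[of "z\<^sup>2" "\<lambda>i. cb_b n i \<tau>" 1 "n div 2"]
    by (simp add: cb_S_def diff_mult_distrib2 flip: power_mult)
  also have "{..n div 2} = insert 0 {1..n div 2}" by auto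
  finally show ?thesis by (simp add: cb_S_0)
qed

lemma cb_prod_denominator:
  "(\<Prod>i\<in>{1..n div 2}. 1 - cb_b n i \<tau> * z\<^sup>2) = 1 + (\<Sum>j = 1..n div 2. (-1) ^ j * cb_S n j \<tau> * z ^ (2 * j))"
proof -
  have "(\<Prod>i\<in>{1..n div 2}. 1 - cb_b n i \<tau> * z\<^sup>2) = (\<Sum>j\<le>n div 2. (-1) ^ j * cb_S n j \<tau> * z ^ (2 * j))"
    using prod_diff_expand[of 1 "\<lambda>i. cb_b n i \<tau>" "z\<^sup>2" "n div 2"]
    by (simp add: cb_S_def flip: power_mult)
  also have "{..n div 2} = insert 0 {1..n div 2}" by auto
  finally show ?thesis by (simp add: cb_S_0)
qed

text \<open>Holomorphy lets the identity theorem spread the formula from a curve of theta quotients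
  to the whole disk.\<close>

lemma finite_blaschke_holomorphic:
  assumes "finite_blaschke_product f"
  shows "f holomorphic_on ball 0 1"
proof -
  obtain c as where as: "\<forall>a\<in>set as. cmod a < 1"
    "\<And>z. z \<in> ball 0 1 \<Longrightarrow> f z = c * (\<Prod>a\<leftarrow>as. (z - a) / (1 - cnj a * z))"
    using assms unfolding finite_blaschke_product_def by blast
  have ne: "1 - cnj a * z \<noteq> 0" if "a \<in> set as" "z \<in> ball 0 1" for a z
  proof
    assume "1 - cnj a * z = 0"
    then have "cmod (cnj a * z) = 1" by (metis eq_iff_diff_eq_0 norm_one)
    moreover have "cmod a * cmod z < 1 * 1"
      using that as(1) by (intro mult_strict_mono) auto
    ultimately show False by (simp add: norm_mult)
  qed
  have "(\<lambda>z. \<Prod>a\<leftarrow>as. (z - a) / (1 - cnj a * z)) holomorphic_on ball 0 1"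
    using ne
  proof (induction as)
    case (Cons a as)
    then have "(\<lambda>z. \<Prod>a\<leftarrow>as. (z - a) / (1 - cnj a * z)) holomorphic_on ball 0 1" by simp
    with Cons.prems show ?case by (auto intro!: holomorphic_intros)
  qed (simp add: holomorphic_on_const)
  then have "(\<lambda>z. c * (\<Prod>a\<leftarrow>as. (z - a) / (1 - cnj a * z))) holomorphic_on ball 0 1"
    by (intro holomorphic_intros)
  then show ?thesis by (rule holomorphic_transform) (simp add: as(2))
qed

context imaginary_tau
begin

lemma imaginary_tau_scale: "r > 0 \<Longrightarrow> imaginary_tau (of_real r * \<tau>)"
  using Re_tau Im_tau by unfold_locales auto

text \<open>Positivity at \<open>\<tau>/4\<close> makes \<open>theta3 + theta2\<close> positive;
  replacing \<open>x\<close> by \<open>x + pi\<close> changes the sign of \<open>theta2\<close>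
  only.\<close>

lemma theta2_real:
  shows "Im (theta2 (of_real x) \<tau>) = 0" "\<bar>Re (theta2 (of_real x) \<tau>)\<bar> < Re (theta3 (of_real x) \<tau>)"
proof -
  interpret Q: imaginary_tau "\<tau>/4" using imaginary_tau_scale[of "1/4"] by simp
  have pos: "Im (theta3 (of_real x) \<tau> + theta2 (of_real x) \<tau>) = 0" 
     "Re (theta3 (of_real x) \<tau> + theta2 (of_real x) \<tau>) > 0" for x
    using Q.theta3_real_pos[of "x/2"] theta3_add_theta2[OF Im_tau, of "of_real x"] by auto
  show "Im (theta2 (of_real x) \<tau>) = 0" using pos(1)[of x] theta3_real_pos[of x] by simp
  show "\<bar>Re (theta2 (of_real x) \<tau>)\<bar> < Re (theta3 (of_real x) \<tau>)"
    using pos(2)[of x] pos(2)[of "x + pi"] by (simp add: theta2_plus_pi theta3_plus_pi)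
qed

lemma theta3_real_nonzero: "theta3 (of_real x) \<tau> \<noteq> 0"
  using theta3_real_pos[of x] by auto

lemma theta_ratio_real:
  obtains r where "theta2 (of_real x) \<tau> / theta3 (of_real x) \<tau> = of_real r" "\<bar>r\<bar> < 1"
proof
  have *: "z = of_real (Re z)" if "Im z = 0" for z using that by (simp add: complex_eq_iff)
  let ?r = "Re (theta2 (of_real x) \<tau>) / Re (theta3 (of_real x) \<tau>)"
  show "theta2 (of_real x) \<tau> / theta3 (of_real x) \<tau> = of_real ?r"
    using *[OF theta2_real(1)[of x]] *[of "theta3 (of_real x) \<tau>"] theta3_real_pos[of x]
    by (metis of_real_divide)
  show "\<bar>?r\<bar> < 1" using theta2_real(2)[of x] theta3_real_pos[of x] by simp
qed

lemma cb_b_real: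
  obtains r where "cb_b n i \<tau> = of_real r" "0 \<le> r" "r < 1"
proof -
  obtain r where r: "theta2 (of_real ((2 * real i - 1) * pi / (2 * real n))) \<tau> /
     theta3 (of_real ((2 * real i - 1) * pi / (2 * real n))) \<tau> = of_real r" "\<bar>r\<bar> < 1"
    using theta_ratio_real by blast
  have "cb_b n i \<tau> = of_real (r\<^sup>2)"
    unfolding cb_b_def Let_def power_divide[symmetric] r(1) by simp
  then show ?thesis using that[of "r\<^sup>2"] r(2) by (simp add: abs_square_less_1)
qed

lemma theta2_real_nonzero:
  assumes "0 \<le> x" "x < pi" "x \<noteq> pi/2"
  shows "theta2 (of_real x) \<tau> \<noteq> 0"
proof
  assume "theta2 (of_real x) \<tau> = 0"
  then obtain k l :: int where "of_real x = of_real pi/2 + of_int k * of_real pi + of_int l * (2 * of_real pi * \<tau>)"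
    using theta2_eq_0_iff by blast
  then have "Re (of_real x) = Re (of_real pi/2 + of_int k * of_real pi + of_int l * (2 * of_real pi * \<tau>))" by simp
  then have x: "x = (of_int k + 1/2) * pi" using Re_tau by (simp add: algebra_simps)
  have "of_int k + 1/2 < (1::real)" "of_int k + 1/2 \<ge> (0::real)"
    using assms(1,2) pi_gt_zero unfolding x by (simp, metis zero_le_mult_iff not_less)
  then have "k = 0" by linarith
  then show False using x assms(3) by simp
qed

text \<open>The theta constants cancel, so the parametrisation by elliptic functions becomes a plain
  theta quotient.\<close>

lemma sqrt_k_cd:
  "sqrt_k \<tau> * jacobi_cd (omega1 \<tau> * u) \<tau> = theta2 u \<tau> / theta3 u \<tau>"
  using theta3_real_nonzero[of 0] theta2_real_nonzero[of 0]
  by (simp add: sqrt_k_def jacobi_cd_def omega1_def field_simps)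

end

locale chebyshev_theta = imaginary_tau +
  fixes n :: nat
  assumes n: "n \<ge> 1"
begin

sublocale N: imaginary_tau "of_nat n * \<tau>"
  using imaginary_tau_scale[of "real n"] n by simp

abbreviation "b i \<equiv> cb_b n i \<tau>"

text \<open>Numerator and denominator of the product formula at \<open>W = theta2 / theta3\<close>,
  multiplied by \<open>theta3 v \<tau> ^ n\<close> to become entire.\<close>

definition Num where "Num v = theta2 v \<tau> ^ (n mod 2) * (\<Prod>i\<in>{1..n div 2}. (theta2 v \<tau>)\<^sup>2 - b i * (theta3 v \<tau>)\<^sup>2)"
definition Den where "Den v = theta3 v \<tau> ^ (n mod 2) * (\<Prod>i\<in>{1..n div 2}. (theta3 v \<tau>)\<^sup>2 - b i * (theta2 v \<tau>)\<^sup>2)"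

lemma power_parity_split: "x ^ (n mod 2) * (\<Prod>i\<in>{1..n div 2}. x\<^sup>2) = (x::complex) ^ n"
proof -
  have "x ^ (n mod 2) * (x\<^sup>2) ^ (n div 2) = x ^ (n mod 2 + 2 * (n div 2))"
    by (simp only: power_add power_mult)
  then show ?thesis by simp
qed

text \<open>Homogeneity of degree \<open>n\<close>, applied to the exponential multipliers, to -1,
  and to \<open>theta3 u \<tau>\<close> for the return to \<open>W\<close>.\<close>

lemma homogeneous_scale:
  "(e * x) ^ (n mod 2) * (\<Prod>i\<in>{1..n div 2}. (e * x)\<^sup>2 - b i * (e * y)\<^sup>2)
    = e ^ n * (x ^ (n mod 2) * (\<Prod>i\<in>{1..n div 2}. x\<^sup>2 - b i * y\<^sup>2))"
proof -
  have "(\<Prod>i\<in>{1..n div 2}. (e * x)\<^sup>2 - b i * (e * y)\<^sup>2) = (\<Prod>i\<in>{1..n div 2}. e\<^sup>2 * (x\<^sup>2 - b i * y\<^sup>2))"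
    by (intro prod.cong) (auto simp: algebra_simps power_mult_distrib)
  then show ?thesis
    unfolding prod.distrib power_parity_split[of e, symmetric] power_mult_distrib by (simp only: mult_ac)
qed

text \<open>The shift exchanges \<open>theta2\<close> and \<open>theta3\<close>, hence
  \<open>Num\<close> and \<open>Den\<close>; so it is enough to compare \<open>Num\<close> with a
  theta function.\<close>

lemma Num_shift: "Num (v + of_real pi * \<tau>) = exp (- \<i> * of_real pi * \<tau> / 2 - \<i> * v) ^ n * Den v"
  unfolding Num_def Den_def theta2_plus_pi_tau theta3_plus_pi_tau homogeneous_scale ..

lemma Num_plus_pi: "Num (v + of_real pi) = (-1) ^ n * Num v"
  using homogeneous_scale[of "-1" "theta2 v \<tau>" "theta3 v \<tau>"]
  unfolding Num_def theta2_plus_pi theta3_plus_pi by simp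

lemma Num_minus: "Num (- v) = Num v"
  unfolding Num_def theta2_minus theta3_minus ..

lemma theta2_plus_2pi_tau: "theta2 (v + 2 * of_real pi * \<tau>) \<tau> = exp (- 2 * \<i> * of_real pi * \<tau> - 2 * \<i> * v) * theta2 v \<tau>"
proof -
  have "theta2 (v + 2 * of_real pi * \<tau>) \<tau> = theta2 ((v + of_real pi * \<tau>) + of_real pi * \<tau>) \<tau>"
    by (simp add: algebra_simps)
  also have "\<dots> = exp (- \<i> * of_real pi * \<tau> / 2 - \<i> * (v + of_real pi * \<tau>)) * exp (- \<i> * of_real pi * \<tau> / 2 - \<i> * v) * theta2 v \<tau>"
    unfolding theta2_plus_pi_tau theta3_plus_pi_tau by simp
  also have "exp (- \<i> * of_real pi * \<tau> / 2 - \<i> * (v + of_real pi * \<tau>)) * exp (- \<i> * of_real pi * \<tau> / 2 - \<i> * v)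
      = exp (- 2 * \<i> * of_real pi * \<tau> - 2 * \<i> * v)"
    unfolding mult_exp_exp by (rule arg_cong[of _ _ exp]) (simp add: field_simps)
  finally show ?thesis .
qed

lemma Num_plus_2pi_tau: "Num (v + 2 * of_real pi * \<tau>) = exp (- 2 * \<i> * of_real pi * \<tau> - 2 * \<i> * v) ^ n * Num v"
  unfolding Num_def theta2_plus_2pi_tau theta3_plus_2pi_tau homogeneous_scale ..

text \<open>Points left of \<open>pi/2\<close> are those defining the \<open>b i\<close>;
  \<open>pi/2\<close> itself occurs for odd \<open>n\<close> and is a zero of the separate factor
  \<open>theta2\<close>; points to the right follow by the symmetry
  \<open>v \<mapsto> pi - v\<close>.\<close>

lemma Num_real_zero:
  assumes k: "k < n"
  shows "Num (of_real ((2 * real k + 1) * pi / (2 * real n))) = 0"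
proof -
  have zero: "Num (of_real ((2 * real i - 1) * pi / (2 * real n))) = 0" if "i \<in> {1..n div 2}" for i
  proof -
    have "(theta2 (of_real ((2 * real i - 1) * pi / (2 * real n))) \<tau>)\<^sup>2
         - b i * (theta3 (of_real ((2 * real i - 1) * pi / (2 * real n))) \<tau>)\<^sup>2 = 0"
    proof -
      have "y \<noteq> 0 \<Longrightarrow> x\<^sup>2 - x\<^sup>2 / y\<^sup>2 * y\<^sup>2 = 0" for x y :: complex by simp
      then show ?thesis unfolding cb_b_def Let_def using theta3_real_nonzero by blast
    qed
    then have "(\<Prod>j\<in>{1..n div 2}. (theta2 (of_real ((2 * real i - 1) * pi / (2 * real n))) \<tau>)\<^sup>2
         - b j * (theta3 (of_real ((2 * real i - 1) * pi / (2 * real n))) \<tau>)\<^sup>2) = 0"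
      using that by (meson finite_atLeastAtMost prod_zero)
    then show ?thesis unfolding Num_def by simp
  qed
  consider "2 * k + 1 < n" | "2 * k + 1 = n" | "2 * k + 1 > n" by linarith
  then show ?thesis
  proof cases
    case 1
    then have "k + 1 \<in> {1..n div 2}" by auto
    from zero[OF this] show ?thesis by (simp add: algebra_simps)
  next
    case 2
    then have e: "(2 * real k + 1) * pi / (2 * real n) = pi / 2" by (auto simp: field_simps)
    have "n mod 2 = 1" using 2 by presburger
    then show ?thesis unfolding e Num_def by (simp add: theta2_half_pi)
  next
    case 3
    then have "n - k \<in> {1..n div 2}" using k by auto
    from zero[OF this] have z: "Num (of_real ((2 * real (n - k) - 1) * pi / (2 * real n))) = 0" .
    have "(2 * real k + 1) * pi / (2 * real n) = - ((2 * real (n - k) - 1) * pi / (2 * real n)) + pi"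
      using k n by (simp add: of_nat_diff field_simps)
    then show ?thesis using z by (simp only: of_real_add of_real_minus Num_plus_pi Num_minus mult_zero_right)
  qed
qed

lemma Num_zero:
  fixes k l :: int
  shows "Num (of_real ((2 * real_of_int k + 1) * pi / (2 * real n)) + of_int l * (2 * of_real pi * \<tau>)) = 0"
proof -
  \<comment> \<open>Adding \<open>n\<close> to \<open>k\<close> moves the point by
    \<open>pi\<close>, so \<open>k\<close> matters only modulo \<open>n\<close>.\<close>
  define k' where "k' = nat (k mod int n)"
  have k': "k' < n" "k = int n * (k div int n) + int k'" using n by (auto simp: k'_def nat_less_iff)
  have "(Num (z + of_int l * (2 * of_real pi * \<tau>)) = 0) = (Num z = 0)" for z
    by (rule periodic_int[where f = "\<lambda>z. Num z = 0"]) (simp only: Num_plus_2pi_tau, simp)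
  moreover have "(Num (z + of_int (k div int n) * of_real pi) = 0) = (Num z = 0)" for z
    by (rule periodic_int[where f = "\<lambda>z. Num z = 0"]) (simp only: Num_plus_pi, simp)
  moreover have "complex_of_real ((2 * real_of_int k + 1) * pi / (2 * real n)) =
      of_real ((2 * real k' + 1) * pi / (2 * real n)) + of_int (k div int n) * of_real pi"
  proof -
    have "real_of_int k = real n * of_int (k div int n) + real k'" using k'(2) by (metis of_int_add of_int_mult of_int_of_nat_eq)
    then have "(2 * real_of_int k + 1) * pi / (2 * real n) = (2 * real k' + 1) * pi / (2 * real n) + of_int (k div int n) * pi"
      using n by (simp add: field_simps)
    then show ?thesis by (metis of_real_add of_real_mult of_real_of_int_eq)
  qed
  ultimately show ?thesis using Num_real_zero[OF k'(1)] by simp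
qed

lemma theta2_n_zero:
  assumes "theta2 (of_nat n * v) (of_nat n * \<tau>) = 0"
  shows "Num v = 0"
proof -
  obtain k l :: int where "of_nat n * v = of_real pi/2 + of_int k * of_real pi + of_int l * (2 * of_real pi * (of_nat n * \<tau>))"
    using assms N.theta2_eq_0_iff by blast
  then have "v = of_real ((2 * real_of_int k + 1) * pi / (2 * real n)) + of_int l * (2 * of_real pi * \<tau>)"
    using n by (simp add: field_simps)
  then show ?thesis using Num_zero by simp
qed

lemma theta2_n_simple_zero:
  assumes "theta2 (of_nat n * v) (of_nat n * \<tau>) = 0"
  shows "deriv (\<lambda>v. theta2 (of_nat n * v) (of_nat n * \<tau>)) v \<noteq> 0"
proof -
  have "((\<lambda>v. theta2 v (of_nat n * \<tau>)) has_field_derivative deriv (\<lambda>v. theta2 v (of_nat n * \<tau>)) (of_nat n * v)) (at (of_nat n * v))"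
    by (rule holomorphic_derivI[OF N.theta2_entire]) auto
  then have "((\<lambda>v. theta2 (of_nat n * v) (of_nat n * \<tau>)) has_field_derivative
      deriv (\<lambda>v. theta2 v (of_nat n * \<tau>)) (of_nat n * v) * of_nat n) (at v)"
    by (rule DERIV_chain2) (auto intro!: derivative_eq_intros)
  then show ?thesis using N.theta2_simple_zero[OF assms] n DERIV_imp_deriv by fastforce
qed

text \<open>The quotient argument treats \<open>Num\<close>, the half-period shift gives
  \<open>Den\<close> with the same constant, and the constant is nonzero because
  \<open>Den 0\<close> is.\<close>

lemma Num_Den_theta:
  obtains C where "C \<noteq> 0" "\<And>v. Num v = C * theta2 (of_nat n * v) (of_nat n * \<tau>)"
    "\<And>v. Den v = C * theta3 (of_nat n * v) (of_nat n * \<tau>)"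
proof -
  let ?f = "\<lambda>v. theta2 (of_nat n * v) (of_nat n * \<tau>)"
  have "\<exists>c. \<forall>v. Num v = c * ?f v"
  proof (rule theta_quotient_constant[where f = Num and g = ?f and r = pi and b = "2 * of_real pi * \<tau>" and \<mu> = "(-1)^n"
        and M = "\<lambda>v. exp (- 2 * \<i> * of_real pi * \<tau> - 2 * \<i> * v) ^ n"])
    show "Num holomorphic_on UNIV"
      unfolding Num_def by (intro holomorphic_intros theta2_entire theta3_entire)
    show "?f holomorphic_on UNIV"
      using N.Im_tau by (intro theta2_holomorphic holomorphic_intros) auto
    fix z
    show "?f z = 0 \<Longrightarrow> Num z = 0 \<and> deriv ?f z \<noteq> 0"
      using theta2_n_zero theta2_n_simple_zero by blast
    show "?f (z + of_real pi) = (-1) ^ n * ?f z"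
    proof -
      have "theta2 (w + of_nat m * of_real pi) (of_nat n * \<tau>) = (-1) ^ m * theta2 w (of_nat n * \<tau>)" for m w
        by (induction m) (auto simp: ring_distribs theta2_plus_pi add.commute[of "of_real pi"] simp flip: add.assoc)
      then show ?thesis by (simp add: ring_distribs)
    qed
    have "?f (z + 2 * of_real pi * \<tau>) = theta2 (of_nat n * z + 2 * of_real pi * (of_nat n * \<tau>)) (of_nat n * \<tau>)"
      by (simp add: algebra_simps)
    \<comment> \<open>The law was proved for the \<open>\<tau>\<close> of the locale; an instance
      with degree 1 transfers it to \<open>of_nat n * \<tau>\<close>.\<close>
    also have "\<dots> = exp (- 2 * \<i> * of_real pi * (of_nat n * \<tau>) - 2 * \<i> * (of_nat n * z)) * ?f z"
      by (rule chebyshev_theta.theta2_plus_2pi_tau[of _ 1]) (unfold_locales, simp)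
    also have "exp (- 2 * \<i> * of_real pi * (of_nat n * \<tau>) - 2 * \<i> * (of_nat n * z)) =
          exp (- 2 * \<i> * of_real pi * \<tau> - 2 * \<i> * z) ^ n"
      unfolding exp_of_nat_mult[symmetric] by (simp add: algebra_simps)
    finally show "?f (z + 2 * of_real pi * \<tau>) = exp (- 2 * \<i> * of_real pi * \<tau> - 2 * \<i> * z) ^ n * ?f z" .
  qed (use Im_tau in \<open>auto simp: Num_plus_pi intro: Num_plus_2pi_tau[simplified]\<close>)
  then obtain c where c: "\<And>v. Num v = c * ?f v" by blast
  have d: "Den v = c * theta3 (of_nat n * v) (of_nat n * \<tau>)" for v
  proof -
    let ?e = "exp (- \<i> * of_real pi * \<tau> / 2 - \<i> * v) ^ n"
    have "?e * Den v = c * ?f (v + of_real pi * \<tau>)" using Num_shift[of v] c by simp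
    also have "?f (v + of_real pi * \<tau>) = theta2 (of_nat n * v + of_real pi * (of_nat n * \<tau>)) (of_nat n * \<tau>)"
      by (simp add: algebra_simps)
    also have "\<dots> = exp (- \<i> * of_real pi * (of_nat n * \<tau>) / 2 - \<i> * (of_nat n * v)) * theta3 (of_nat n * v) (of_nat n * \<tau>)"
      by (rule theta2_plus_pi_tau)
    also have "exp (- \<i> * of_real pi * (of_nat n * \<tau>) / 2 - \<i> * (of_nat n * v)) = ?e"
      unfolding exp_of_nat_mult[symmetric] by (simp add: algebra_simps)
    finally have "?e * Den v = ?e * (c * theta3 (of_nat n * v) (of_nat n * \<tau>))" by (simp add: mult_ac)
    then show ?thesis by simp
  qed
  have "Den 0 \<noteq> 0"
  proof -
    have "(theta3 0 \<tau>)\<^sup>2 - b i * (theta2 0 \<tau>)\<^sup>2 \<noteq> 0" for i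
    proof -
      obtain r where r: "b i = of_real r" "0 \<le> r" "r < 1" using cb_b_real by blast
      obtain s where s: "theta2 0 \<tau> / theta3 0 \<tau> = of_real s" "\<bar>s\<bar> < 1" using theta_ratio_real[of 0] by auto
      have "r * s\<^sup>2 \<le> 1 * s\<^sup>2" using r by (intro mult_right_mono) auto
      moreover have "s\<^sup>2 < 1" using s by (simp add: abs_square_less_1)
      ultimately have "1 - r * s\<^sup>2 \<noteq> 0" by simp
      then have "1 - b i * (theta2 0 \<tau> / theta3 0 \<tau>)\<^sup>2 \<noteq> 0"
        unfolding s r by (metis of_real_1 of_real_diff of_real_eq_0_iff of_real_mult of_real_power)
      then show ?thesis using theta3_real_nonzero[of 0] by (simp add: field_simps)
    qed
    then show ?thesis unfolding Den_def using theta3_real_nonzero[of 0] by simp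
  qed
  then have "c \<noteq> 0" using d[of 0] by auto
  then show ?thesis using that c d by blast
qed

lemma Den_factor_nonzero:
  assumes "z \<in> ball 0 1" shows "(\<Prod>i\<in>{1..n div 2}. 1 - b i * z\<^sup>2) \<noteq> 0"
proof -
  have "1 - b i * z\<^sup>2 \<noteq> 0" for i
  proof
    assume "1 - b i * z\<^sup>2 = 0"
    then have "cmod (b i * z\<^sup>2) = 1" by (metis eq_iff_diff_eq_0 norm_one)
    moreover obtain r where r: "b i = of_real r" "0 \<le> r" "r < 1" using cb_b_real by blast
    ultimately have "r * (cmod z)\<^sup>2 = 1" by (simp add: norm_mult norm_power)
    moreover have "(cmod z)\<^sup>2 < 1" using assms by (simp add: abs_square_less_1)
    moreover have "r * (cmod z)\<^sup>2 \<le> 1 * (cmod z)\<^sup>2" using r by (intro mult_right_mono) auto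
    ultimately show False by simp
  qed
  then show ?thesis by simp
qed

text \<open>The functional equation gives the formula at the values of \<open>W\<close> in the disk.
  For real arguments these accumulate at \<open>W (pi/2) = 0\<close>, so the identity theorem
  applies.\<close>

lemma chebyshev_blaschke_formula:
  assumes f: "is_chebyshev_blaschke n \<tau> f" and z: "z \<in> ball 0 1"
  shows "f z = z ^ (n mod 2) * ((\<Prod>i\<in>{1..n div 2}. z\<^sup>2 - b i) / (\<Prod>i\<in>{1..n div 2}. 1 - b i * z\<^sup>2))"
proof -
  define P where "P z = z ^ (n mod 2) * (\<Prod>i\<in>{1..n div 2}. z\<^sup>2 - b i)" for z
  define Q where "Q z = (\<Prod>i\<in>{1..n div 2}. 1 - b i * z\<^sup>2)" for z
  obtain C where C: "C \<noteq> 0" "\<And>v. Num v = C * theta2 (of_nat n * v) (of_nat n * \<tau>)"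
    "\<And>v. Den v = C * theta3 (of_nat n * v) (of_nat n * \<tau>)" using Num_Den_theta by blast
  define W where "W u = theta2 u \<tau> / theta3 u \<tau>" for u
  have key: "f (W u) * Q (W u) - P (W u) = 0" if u: "theta3 u \<tau> \<noteq> 0" "W u \<in> ball 0 1" for u
  proof -
    have "f (W u) = sqrt_k (of_nat n * \<tau>) * jacobi_cd (of_nat n * omega1 (of_nat n * \<tau>) * u) (of_nat n * \<tau>)"
      using f u unfolding is_chebyshev_blaschke_def W_def sqrt_k_cd by blast
    also have "\<dots> = theta2 (of_nat n * u) (of_nat n * \<tau>) / theta3 (of_nat n * u) (of_nat n * \<tau>)"
      using N.sqrt_k_cd[of "of_nat n * u"] by (simp add: mult_ac)
    also have "\<dots> = Num u / Den u" using C by simp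
    also have "Num u = theta3 u \<tau> ^ n * P (W u)"
      using homogeneous_scale[of "theta3 u \<tau>" "W u" 1] u unfolding Num_def P_def W_def by simp
    also have "Den u = theta3 u \<tau> ^ n * Q (W u)"
      using homogeneous_scale[of "theta3 u \<tau>" 1 "W u"] u unfolding Den_def Q_def W_def by simp
    finally show ?thesis using u Den_factor_nonzero[OF u(2)] unfolding Q_def by simp
  qed
  have hol: "(\<lambda>z. f z * Q z - P z) holomorphic_on ball 0 1"
    unfolding P_def Q_def using f
    by (intro holomorphic_intros finite_blaschke_holomorphic) (auto simp: is_chebyshev_blaschke_def)
  define U where "U = W ` of_real ` {0..<pi}"
  have inball: "W (of_real x) \<in> ball 0 1" for x
    using theta_ratio_real[of x] unfolding W_def by (metis dist_0_norm mem_ball norm_of_real)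
  have W0: "W (of_real (pi/2)) = 0" by (simp add: W_def theta2_half_pi)
  have lim: "0 islimpt U"
    unfolding islimpt_approachable
  proof (intro allI impI)
    fix e :: real assume e: "e > 0"
    have "continuous_on UNIV (\<lambda>x. W (of_real x))"
      unfolding W_def using theta3_real_nonzero
      by (intro continuous_intros continuous_on_compose2[OF holomorphic_on_imp_continuous_on[OF theta3_entire]]
            continuous_on_compose2[OF holomorphic_on_imp_continuous_on[OF theta2_entire]]) auto
    then obtain d where d: "d > 0" "\<And>x. dist x (pi/2) < d \<Longrightarrow> dist (W (of_real x)) 0 < e"
      using e W0 unfolding continuous_on_iff by (metis UNIV_I)
    \<comment> \<open>The cap 1 keeps \<open>x\<close> below \<open>pi\<close>, and
      \<open>x \<noteq> pi/2\<close> makes \<open>W\<close> nonzero.\<close>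
    define x where "x = pi/2 + min (d/2) 1"
    have x: "x \<in> {0..<pi}" "x \<noteq> pi/2" "dist x (pi/2) < d"
      using d(1) pi_gt3 by (auto simp: x_def dist_real_def min_def)
    then have "W (of_real x) \<noteq> 0"
      using theta2_real_nonzero[of x] theta3_real_nonzero[of x] by (simp add: W_def)
    then show "\<exists>x'\<in>U. x' \<noteq> 0 \<and> dist x' 0 < e" using d x unfolding U_def by blast
  qed
  have "f z * Q z - P z = 0"
  proof (rule analytic_continuation[OF hol open_ball connected_ball _ _ lim _ z])
    show "U \<subseteq> ball 0 1" unfolding U_def using inball by auto
    show "\<And>z. z \<in> U \<Longrightarrow> f z * Q z - P z = 0"
      unfolding U_def using key inball theta3_real_nonzero by auto
  qed auto
  then show ?thesis using Den_factor_nonzero[OF z] unfolding P_def Q_def by (simp add: field_simps)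
qed

end

section \<open>Lattice sums and elliptic functions\<close>

definition lattice_pt :: "complex \<Rightarrow> int \<times> int \<Rightarrow> complex" where
  "lattice_pt \<tau> x = of_int (fst x) + of_int (snd x) * \<tau>"

text \<open>A majorant independent of \<open>\<tau>\<close>, which makes the estimates locally
  uniform; at the origin it takes the value \<open>1 / 0 = 0\<close>.\<close>

definition lattice_bound :: "int \<times> int \<Rightarrow> real" where
  "lattice_bound x = 1 / (\<bar>of_int (fst x)\<bar> + \<bar>of_int (snd x)\<bar>) ^ 3"

lemma eisenstein_G_eq: "eisenstein_G k \<tau> = (\<Sum>\<^sub>\<infinity>x\<in>UNIV-{(0,0)}. 1 / lattice_pt \<tau> x ^ k)"
  unfolding eisenstein_G_def lattice_pt_def by (intro infsum_cong) auto

text \<open>The imaginary part bounds the coefficient of \<open>\<tau>\<close>; subtracting that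
  multiple of \<open>\<tau>\<close> then bounds the other coefficient.\<close>

lemma lattice_lower:
  assumes "0 < \<delta>" "\<delta> \<le> Im \<tau>" "norm \<tau> \<le> R"
  shows "\<bar>of_int (fst x)\<bar> + \<bar>of_int (snd x)\<bar> \<le> (1 + (R + 1) / \<delta>) * norm (lattice_pt \<tau> x)"
proof -
  define m n :: real where "m = of_int (fst x)" and "n = of_int (snd x)"
  define w where "w = lattice_pt \<tau> x"
  have w: "w = of_real m + of_real n * \<tau>" by (simp add: w_def lattice_pt_def m_def n_def)
  have R: "0 \<le> R" using assms(3) norm_ge_zero order_trans by blast
  have "\<bar>n\<bar> * \<delta> \<le> \<bar>n\<bar> * Im \<tau>" using assms by (intro mult_left_mono) auto
  also have "\<dots> = \<bar>Im w\<bar>" using assms by (simp add: w abs_mult)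
  also have "\<dots> \<le> norm w" by (rule abs_Im_le_cmod)
  finally have n: "\<bar>n\<bar> \<le> norm w / \<delta>" using assms by (simp add: field_simps)
  have "\<bar>m\<bar> = norm (w - of_real n * \<tau>)" by (simp add: w)
  also have "\<dots> \<le> norm w + \<bar>n\<bar> * norm \<tau>" by (metis norm_mult norm_of_real norm_triangle_ineq4)
  also have "\<bar>n\<bar> * norm \<tau> \<le> norm w / \<delta> * R" using n assms R by (intro mult_mono) auto
  finally have "\<bar>m\<bar> + \<bar>n\<bar> \<le> norm w + norm w / \<delta> * R + norm w / \<delta>" using n by linarith
  also have "\<dots> = (1 + (R + 1) / \<delta>) * norm w" using assms by (simp add: field_simps)
  finally show ?thesis by (simp add: m_def n_def w_def)
qed

lemma lattice_norm_ge:
  assumes "0 < \<delta>" "\<delta> \<le> Im \<tau>" "norm \<tau> \<le> R" "x \<noteq> (0,0)"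
  shows "norm (lattice_pt \<tau> x) \<ge> 1 / (1 + (R + 1) / \<delta>)"
proof -
  have R: "0 \<le> R" using assms(3) norm_ge_zero order_trans by blast
  have "\<bar>fst x\<bar> + \<bar>snd x\<bar> \<ge> 1" using assms(4) by (cases x) auto
  then have "1 \<le> real_of_int (\<bar>fst x\<bar> + \<bar>snd x\<bar>)" by (simp only: of_int_1_le_iff)
  also have "\<dots> \<le> (1 + (R + 1) / \<delta>) * norm (lattice_pt \<tau> x)"
    using lattice_lower[OF assms(1-3), of x] by simp
  finally show ?thesis using R assms(1) by (simp add: divide_le_eq mult.commute add_pos_nonneg)
qed

text \<open>Off the origin the two coefficients have absolute sum at least 1, so higher powers
  dominate the cube; at the origin both sides are 0.\<close>

lemma lattice_norm_power_le:
  assumes "0 < \<delta>" "\<delta> \<le> Im \<tau>" "norm \<tau> \<le> R" "k \<ge> 3"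
  shows "norm (1 / lattice_pt \<tau> x ^ k) \<le> (1 + (R + 1) / \<delta>) ^ k * lattice_bound x"
proof (cases "x = (0,0)")
  case True
  then show ?thesis using assms by (simp add: lattice_pt_def lattice_bound_def)
next
  case False
  define C where "C = 1 + (R + 1) / \<delta>"
  have R: "0 \<le> R" using assms(3) norm_ge_zero order_trans by blast
  have C: "C > 0" using assms R by (simp add: C_def add_pos_nonneg)
  have s: "\<bar>fst x\<bar> + \<bar>snd x\<bar> \<ge> 1" using False by (cases x) auto
  define M where "M = real_of_int (\<bar>fst x\<bar> + \<bar>snd x\<bar>)"
  have M1: "M \<ge> 1" using s unfolding M_def by linarith
  have M: "M \<le> C * norm (lattice_pt \<tau> x)"
    using lattice_lower[OF assms(1-3), of x] by (simp add: C_def M_def)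
  then have "0 < C * norm (lattice_pt \<tau> x)" using M1 by linarith
  then have pos: "norm (lattice_pt \<tau> x) > 0" using C by (simp add: zero_less_mult_iff)
  have "M ^ 3 \<le> M ^ k" using M1 assms by (intro power_increasing) auto
  also have "\<dots> \<le> (C * norm (lattice_pt \<tau> x)) ^ k" using M M1 by (intro power_mono) auto
  finally have "M ^ 3 \<le> C ^ k * norm (lattice_pt \<tau> x) ^ k" by (simp add: power_mult_distrib)
  then have "1 / norm (lattice_pt \<tau> x) ^ k \<le> C ^ k * (1 / M ^ 3)"
    using M1 pos by (simp add: field_simps)
  then show ?thesis by (simp add: norm_divide norm_power C_def M_def lattice_bound_def)
qed

text \<open>When \<open>a + b \<ge> 1\<close>, both \<open>1 + a\<close> and \<open>1 + b\<close>
  are at most \<open>2 * (a + b)\<close>. Raising their product to the power 3/2 separates the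
  variables, and each single series converges because 3/2 exceeds 1.\<close>

lemma lattice_bound_summable: "lattice_bound summable_on UNIV"
proof -
  define g where "g m = (1 + \<bar>real_of_int m\<bar>) powr (-3/2)" for m
  have "summable (\<lambda>n. real n powr (-3/2))" by (subst summable_real_powr_iff) simp
  then have "summable (\<lambda>n. real (Suc n) powr (-3/2))" by (subst summable_Suc_iff)
  then have "(\<lambda>n. real (Suc n) powr (-3/2)) summable_on UNIV"
    by (intro summable_nonneg_imp_summable_on) auto
  from summable_on_int_abs[OF this] have g: "g summable_on UNIV"
    by (simp add: g_def[abs_def])
  have "(\<lambda>(m,n). 8 * (g m * g n)) summable_on Sigma UNIV (\<lambda>_. UNIV)"
  proof (rule summable_on_SigmaI)
    show "((\<lambda>n. case (m, n) of (m, n) \<Rightarrow> 8 * (g m * g n)) has_sum 8 * (g m * infsum g UNIV)) UNIV" for m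
      using g by (auto intro!: has_sum_cmult_right)
    show "(\<lambda>m. 8 * (g m * infsum g UNIV)) summable_on UNIV"
      using g by (intro summable_on_cmult_right summable_on_cmult_left)
  qed (auto simp: g_def)
  then have s: "(\<lambda>(m,n). 8 * (g m * g n)) summable_on UNIV" by simp
  have le: "lattice_bound x \<le> (case x of (m,n) \<Rightarrow> 8 * (g m * g n))" for x
  proof (cases x)
    case (Pair m n)
    define a b where "a = \<bar>real_of_int m\<bar>" and "b = \<bar>real_of_int n\<bar>"
    show ?thesis
    proof (cases "m = 0 \<and> n = 0")
      case True
      then show ?thesis by (simp add: Pair lattice_bound_def g_def)
    next
      case False
      then have ab: "a + b \<ge> 1" "a \<ge> 0" "b \<ge> 0" unfolding a_def b_def by linarith+
      have "((1 + a) * (1 + b)) powr (3/2) \<le> ((2 * (a + b)) * (2 * (a + b))) powr (3/2)"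
        using ab by (intro powr_mono2 mult_mono) auto
      also have "\<dots> = ((2 * (a + b)) powr 2) powr (3/2)"
        using ab by (simp add: power2_eq_square)
      also have "\<dots> = (2 * (a + b)) powr 3" unfolding powr_powr by simp
      also have "\<dots> = 8 * (a + b) ^ 3" using ab by (simp add: power_mult_distrib del: distrib_left_numeral)
      finally have le: "(1 + a) powr (3/2) * (1 + b) powr (3/2) \<le> 8 * (a + b) ^ 3"
        using ab by (simp add: powr_mult)
      moreover have "(a + b) ^ 3 > 0" "(1 + a) powr (3/2) > 0" "(1 + b) powr (3/2) > 0" using ab by auto
      ultimately have "1 / (a + b) ^ 3 \<le> 8 * (1 / (1 + a) powr (3/2) * (1 / (1 + b) powr (3/2)))"
        by (simp add: field_simps)
      moreover have "g m = 1 / (1 + a) powr (3/2)" "g n = 1 / (1 + b) powr (3/2)"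
        by (simp_all add: g_def a_def b_def powr_minus_divide)
      ultimately show ?thesis by (simp add: Pair lattice_bound_def a_def b_def mult_ac)
    qed
  qed
  show ?thesis
    by (rule summable_on_comparison_test[OF s le]) (simp add: lattice_bound_def)
qed

lemma lattice_finite:
  assumes "Im \<tau> > 0"
  shows "finite {x. norm (lattice_pt \<tau> x) \<le> \<rho>}"
proof -
  define C where "C = 1 + (norm \<tau> + 1) / Im \<tau>"
  have C: "C > 0" using assms by (simp add: C_def add_pos_nonneg)
  define N where "N = \<lceil>C * \<rho>\<rceil>"
  have "{x. norm (lattice_pt \<tau> x) \<le> \<rho>} \<subseteq> {-N..N} \<times> {-N..N}"
  proof
    fix x assume "x \<in> {x. norm (lattice_pt \<tau> x) \<le> \<rho>}"
    then have "C * norm (lattice_pt \<tau> x) \<le> C * \<rho>" using C by simp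
    then have "\<bar>of_int (fst x)\<bar> + \<bar>of_int (snd x)\<bar> \<le> C * \<rho>"
      using lattice_lower[OF assms order_refl order_refl, of x] unfolding C_def by linarith
    then have "real_of_int \<bar>fst x\<bar> \<le> of_int N" "real_of_int \<bar>snd x\<bar> \<le> of_int N"
      unfolding N_def by linarith+
    then have "\<bar>fst x\<bar> \<le> N" "\<bar>snd x\<bar> \<le> N" by linarith+
    then show "x \<in> {-N..N} \<times> {-N..N}" by (cases x) auto
  qed
  then show ?thesis by (rule finite_subset) simp
qed

lemma eisenstein_G_holomorphic:
  assumes "k \<ge> 3"
  shows "eisenstein_G k holomorphic_on upper_half_plane"
  unfolding eisenstein_G_eq
proof (rule infsum_holomorphic)
  have nz: "lattice_pt \<tau> x \<noteq> 0" if "x \<noteq> (0,0)" "Im \<tau> > 0" for x \<tau>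
  proof -
    have "1 / (1 + (norm \<tau> + 1) / Im \<tau>) > 0" using that by (simp add: add_pos_nonneg)
    then show ?thesis
      using lattice_norm_ge[OF that(2) order_refl order_refl that(1)] by auto
  qed
  show "(\<lambda>\<tau>. 1 / lattice_pt \<tau> x ^ k) holomorphic_on upper_half_plane" if "x \<in> UNIV - {(0,0)}" for x
    using nz that unfolding lattice_pt_def
    by (intro holomorphic_intros) (auto simp: upper_half_plane_def)
  fix z assume z: "z \<in> upper_half_plane"
  \<comment> \<open>Points \<open>w\<close> of a ball of this radius satisfy
    \<open>Im w \<ge> r\<close>, so \<open>r\<close> is also the lower bound in the lattice
    estimate.\<close>
  define r where "r = Im z / 2"
  have r: "r > 0" using z by (simp add: r_def upper_half_plane_def)
  have b: "r \<le> Im w" "norm w \<le> norm z + r" if "w \<in> cball z r" for w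
  proof -
    have "\<bar>Im (z - w)\<bar> \<le> r" using that abs_Im_le_cmod[of "z - w"] by (simp add: dist_norm)
    then show "r \<le> Im w" unfolding r_def abs_le_iff by simp
    show "norm w \<le> norm z + r"
      using that norm_triangle_ineq2[of w z] by (simp add: dist_norm norm_minus_commute)
  qed
  let ?M = "\<lambda>x. (1 + ((norm z + r) + 1) / r) ^ k * lattice_bound x"
  show "\<exists>r>0. \<exists>M. cball z r \<subseteq> upper_half_plane \<and> M summable_on UNIV - {(0,0)} \<and>
     (\<forall>x\<in>UNIV - {(0,0)}. \<forall>w\<in>cball z r. norm (1 / lattice_pt w x ^ k) \<le> M x)"
  proof (intro exI[of _ r] exI[of _ ?M] conjI ballI r)
    show "cball z r \<subseteq> upper_half_plane" using b r by (force simp: upper_half_plane_def)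
    show "?M summable_on UNIV - {(0,0)}"
      by (intro summable_on_cmult_right summable_on_subset[OF lattice_bound_summable]) auto
  qed (use b r assms in \<open>auto intro!: lattice_norm_power_le\<close>)
qed

section \<open>Local expansions and Liouville's theorem for elliptic functions\<close>

lemma higher_deriv_inverse_cube:
  fixes w :: complex
  assumes "s \<noteq> w"
  shows "(deriv ^^ m) (\<lambda>s. 1 / (s - w) ^ 3) s = (-1) ^ m * (fact (m + 2) / 2) / (s - w) ^ (m + 3)"
  using assms
proof (induction m arbitrary: s)
  case 0
  then show ?case by simp
next
  case (Suc m)
  have ev: "\<forall>\<^sub>F z in nhds s. (deriv ^^ m) (\<lambda>s. 1 / (s - w) ^ 3) z = (-1) ^ m * (fact (m + 2) / 2) / (z - w) ^ (m + 3)"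
    using t1_space_nhds[OF Suc.prems] by eventually_elim (rule Suc.IH)
  have "(deriv ^^ Suc m) (\<lambda>s. 1 / (s - w) ^ 3) s = deriv (\<lambda>z. (-1) ^ m * (fact (m + 2) / 2) / (z - w) ^ (m + 3)) s"
    using deriv_cong_ev[OF ev refl] by simp
  also have "\<dots> = (-1) ^ Suc m * (fact (Suc m + 2) / 2) / (s - w) ^ (Suc m + 3)"
  proof (rule DERIV_imp_deriv)
    have nz: "s - w \<noteq> 0" using Suc.prems by simp
    have "((\<lambda>z. (-1) ^ m * (fact (m + 2) / 2) / (z - w) ^ (m + 3)) has_field_derivative
        - ((-1) ^ m * (fact (m + 2) / 2) * (of_nat (m + 3) * (s - w) ^ (m + 2))) / ((s - w) ^ (m + 3) * (s - w) ^ (m + 3))) (at s)"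
      using nz by (auto intro!: derivative_eq_intros)
    moreover have "- ((-1) ^ m * (fact (m + 2) / 2) * (of_nat (m + 3) * (s - w) ^ (m + 2))) / ((s - w) ^ (m + 3) * (s - w) ^ (m + 3))
        = (-1) ^ Suc m * (fact (Suc m + 2) / 2) / (s - w) ^ (Suc m + 3)"
    proof -
      have p: "(s - w) ^ (m + 3) = (s - w) * (s - w) ^ (m + 2)" "(s - w) ^ (Suc m + 3) = (s - w) * (s - w) * (s - w) ^ (m + 2)"
        by (simp_all add: numeral_eq_Suc)
      have g: "- (A * (c * P)) / ((t * P) * (t * P)) = - (A * c) / (t * t * P)" if "t \<noteq> 0" "P \<noteq> 0" for t P A c :: complex
        using that by simp
      have f: "(fact (Suc m + 2) :: complex) = of_nat (m + 3) * fact (m + 2)"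
        by (simp add: numeral_eq_Suc algebra_simps)
      show ?thesis unfolding p g[OF nz power_not_zero[OF nz]] unfolding f by simp
    qed
    ultimately show "((\<lambda>z. (-1) ^ m * (fact (m + 2) / 2) / (z - w) ^ (m + 3)) has_field_derivative
       (-1) ^ Suc m * (fact (Suc m + 2) / 2) / (s - w) ^ (Suc m + 3)) (at s)" by simp
  qed
  finally show ?case .
qed

text \<open>The remainder is the shifted power series, hence holomorphic on the full ball: it may be
  differentiated and has a limit at 0.\<close>

lemma holomorphic_taylor_remainder:
  assumes f: "f holomorphic_on ball 0 r"
  obtains g where "g holomorphic_on ball 0 r"
    "\<And>s. s \<in> ball 0 r \<Longrightarrow> f s = (\<Sum>k<N. (deriv ^^ k) f 0 / fact k * s ^ k) + s ^ N * g s"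
proof
  let ?F = "fps_expansion f 0"
  let ?g = "eval_fps (fps_shift N ?F)"
  have f': "f holomorphic_on eball 0 (ereal r)" using f by simp
  have rad: "fps_conv_radius ?F \<ge> ereal r"
    by (rule conv_radius_fps_expansion[OF f'])
  show "?g holomorphic_on ball 0 r"
  proof (rule holomorphic_on_eval_fps, rule subsetI)
    fix x :: complex assume "x \<in> ball 0 r"
    then have "ereal (norm x) < ereal r" by simp
    then have "ereal (norm x) < fps_conv_radius ?F" using rad by (rule less_le_trans)
    then show "x \<in> eball 0 (fps_conv_radius (fps_shift N ?F))" by simp
  qed
  fix s :: complex assume s: "s \<in> ball 0 r"
  then have "ereal (norm s) < ereal r" by simp
  then have sr: "norm s < fps_conv_radius ?F" using rad by (rule less_le_trans)
  have "(\<lambda>k. fps_nth ?F k * s ^ k) sums eval_fps ?F s" by (rule sums_eval_fps[OF sr])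
  moreover have "eval_fps ?F s = f s" using eval_fps_expansion'[OF f', of s] s by simp
  ultimately have sm: "(\<lambda>k. fps_nth ?F k * s ^ k) sums f s" by simp
  have "(\<lambda>k. fps_nth ?F (k + N) * s ^ (k + N)) sums (f s - (\<Sum>k<N. fps_nth ?F k * s ^ k))"
    by (rule sums_split_initial_segment[OF sm])
  moreover have "(\<lambda>k. s ^ N * (fps_nth (fps_shift N ?F) k * s ^ k)) sums (s ^ N * ?g s)"
    by (intro sums_mult sums_eval_fps) (use sr in simp)
  ultimately have "f s - (\<Sum>k<N. fps_nth ?F k * s ^ k) = s ^ N * ?g s"
    by (intro sums_unique2[of "\<lambda>k. fps_nth ?F (k + N) * s ^ (k + N)"]) (simp_all add: power_add mult_ac)
  then show "f s = (\<Sum>k<N. (deriv ^^ k) f 0 / fact k * s ^ k) + s ^ N * ?g s"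
    by (simp add: fps_expansion_def algebra_simps)
qed

text \<open>Finite limits at the exceptional points make the function entire after removal of
  singularities. Identities between elliptic functions thus reduce to local checks at the
  poles.\<close>

lemma elliptic_liouville:
  fixes f :: "complex \<Rightarrow> complex"
  assumes S: "\<And>z. \<not> z islimpt S" and hol: "f holomorphic_on - S"
    and lim: "\<And>p. p \<in> S \<Longrightarrow> \<exists>l. f \<midarrow>p\<rightarrow> l"
    and b: "Im b > 0" and per: "\<And>z. f (z + 1) = f z" "\<And>z. f (z + b) = f z"
  obtains c where "\<And>z. z \<notin> S \<Longrightarrow> f z = c"
proof -
  have cl: "closed (S - X)" for X
    using S unfolding closed_limpt by (meson Diff_subset islimpt_subset)
  have cS: "closed S" using cl[of "{}"] by simp
  define h where "h = remove_sings f"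
  have anS: "f analytic_on {z}" if "z \<notin> S" for z
    using hol cS that by (auto simp: analytic_at open_Compl intro!: exI[of _ "- S"])
  have "h analytic_on {z}" for z
  proof (cases "z \<in> S")
    case True
    have "f holomorphic_on - (S - {z}) - {z}"
      by (rule holomorphic_on_subset[OF hol]) auto
    then have "isolated_singularity_at f z"
      by (rule isolated_singularity_at_holomorphic[OF _ open_Compl[OF cl[of "{z}"]]]) auto
    then show ?thesis unfolding h_def using lim[OF True] remove_sings_analytic_at by blast
  qed (auto simp: h_def intro!: remove_sings_analytic_on anS)
  then have hh: "h holomorphic_on UNIV"
    by (metis analytic_imp_holomorphic analytic_on_analytic_at)
  have hf: "h z = f z" if "z \<notin> S" for z using anS[OF that] by (simp add: h_def)
  \<comment> \<open>\<open>h\<close> agrees with \<open>f\<close> only off \<open>S\<close>; since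
    \<open>S\<close> has no limit point, \<open>d\<close> vanishes in a punctured neighbourhood of
    \<open>z\<close>, and at \<open>z\<close> by continuity.\<close>
  have period: "h (z + c) = h z" if p: "\<And>z. f (z + c) = f z" for z c
  proof -
    define d where "d z = h (z + c) - h z" for z
    have ch: "continuous_on UNIV h" using holomorphic_on_imp_continuous_on[OF hh] .
    have "continuous_on UNIV (\<lambda>z. h (z + c))"
      by (rule continuous_on_compose2[OF ch]) (auto intro!: continuous_intros)
    then have "continuous_on UNIV d"
      unfolding d_def using ch by (rule continuous_on_diff)
    then have "(d \<longlongrightarrow> d z) (at z)" by (simp add: continuous_on_def)
    moreover have "\<forall>\<^sub>F y in at z. d y = 0"
    proof -
      have ev: "\<forall>\<^sub>F y in at w. y \<notin> S" for w
        using S by (auto simp: islimpt_iff_eventually)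
      have "filterlim (\<lambda>y. y + c) (at (z + c)) (at z)"
        by (intro filterlim_atI tendsto_intros) (auto simp: eventually_at_filter)
      from eventually_compose_filterlim[OF ev this] ev[of z]
      show ?thesis by eventually_elim (simp add: d_def hf p)
    qed
    then have "(d \<longlongrightarrow> 0) (at z)" by (rule tendsto_eventually)
    ultimately have "d z = 0" by (metis tendsto_unique trivial_limit_at)
    then show ?thesis by (simp add: d_def)
  qed
  obtain c where "\<And>z. h z = c"
    using entire_doubly_periodic_constant[OF hh, of 1 b] period[OF per(1)] period[OF per(2)] b by auto
  then show ?thesis using that[of c] hf by metis
qed

text \<open>With \<open>p\<close> and \<open>p2\<close> the Laurent expansions of \<open>\<wp>(s)\<close> and \<open>\<wp>(2s)\<close>, all terms of order at most \<open>0\<close>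
  cancel; the explicit remainders were found by computer algebra.\<close>
lemma ode_expansion:
  fixes s a b n d p dp :: complex
  assumes "s \<noteq> 0" "p = 1/s^2 + a* s^2 + b* s^4 + s^6*n" "dp = -2/s^3 + 2*a* s + 4*b* s^3 + 6* s^5*n + s^6*d"
  shows "dp^2 - 4*p^3 + 20*a*p + 28*b = s^2 * (12*a^2 - 36*n - 4*d* s + 12*a*b* s^2 + 20*a*n* s^4 - 4*a^3* s^4 + 4*b^2* s^4 + 4*a*d* s^5 - 12*a^2*b* s^6 + 24*b*n* s^6 + 8*b*d* s^7 - 12*a*b^2* s^8 - 12*a^2*n* s^8 + 24*n^2* s^8 + 12*d*n* s^9 - 24*a*b*n* s^10 - 4*b^3* s^10 + d^2* s^10 - 12*a*n^2* s^12 - 12*b^2*n* s^12 - 12*b*n^2* s^14 - 4*n^3* s^16)" (is "?L = ?R")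
proof -
  \<comment> \<open>Multiplying by powers of \<open>s\<close> clears the poles and leaves polynomial
    identities.\<close>
  have 1: "p * s^2 = 1 + a* s^4 + b* s^6 + n* s^8" and 2: "dp * s^3 = -2 + 2*a* s^4+4*b* s^6+6* s^8*n+s^9*d"
    using assms by (simp_all add: field_simps eval_nat_numeral)
  have "?L * s^6 = (dp * s^3)^2 - 4 * (p * s^2)^3 + 20 * a * s^4 * (p * s^2) + 28 * b * s^6" by Groebner_Basis.algebra
  also have "\<dots> = ?R * s^6" unfolding 1 2 by Groebner_Basis.algebra
  finally show ?thesis using assms(1) by simp
qed
text \<open>\<open>X\<close> and \<open>Z / 4\<close> are the tails of the two expansions. Their
  terms with \<open>a^2/3\<close> encode the value \<open>c = a\<^sup>2 / 3\<close> of the next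
  Laurent coefficient, which makes the terms of order 0 cancel.\<close>

lemma dup_expansion:
  fixes s a b X Z n m p p2 :: complex
  assumes "s \<noteq> 0" "p = 1/s^2 + a * s^2 + s^4 * X" "p2 = 1/(2 * s)^2 + 4 * a * s^2 + s^4 * Z / 4"
     "X = b + a^2/3 * s^2 + s^4 * n" "Z = 64 * b + 256 * a^2/3 * s^2 + s^4 * m"
  shows "4 * ((4 * p^3 - 20 * a * p - 28 * b) * p2 - (p^2 + 5 * a)^2 - 56 * b * p) = s^2 * (4 * m - 4 * n + (68 * X * a - 8 * Z * a - 672 * a * b + 12 * X * Z * s^2 - 224 * X * b * s^2 - 12 * X^2 * s^2 - 28 * Z * b * s^2 - 180 * a^3 * s^2 - 52 * X * a^2 * s^4 - 8 * Z * a^2 * s^4 + 4 * X * Z * a * s^6 + 116 * X^2 * a * s^6 + 60 * a^4 * s^6 + 176 * X * a^3 * s^8 + 12 * X^2 * Z * s^8 - 12 * X^3 * s^8 + 4 * Z * a^3 * s^8 + 12 * X * Z * a^2 * s^10 + 168 * X^2 * a^2 * s^10 + 12 * X^2 * Z * a * s^12 + 48 * X^3 * a * s^12 + 4 * X^3 * Z * s^14 - 4 * X^4 * s^14))" (is "?L = s^2 * (_ + ?R)")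
proof -
  have 1: "p * s^2 = 1 + a * s^4 + s^6 * X" and 2: "4 * (p2 * s^2) = 1 + 16 * a * s^4 + s^6 * Z"
    using assms(1-3) by (simp_all add: field_simps eval_nat_numeral)
  have "?L * s^8 = (4 * (p * s^2)^3 - 20 * a * s^4 * (p * s^2) - 28 * b * s^6) * (4 * (p2 * s^2)) - 4 * ((p * s^2)^2 + 5 * a * s^4)^2 - 224 * b * s^6 * (p * s^2)" by Groebner_Basis.algebra
  also have "\<dots> = s^6 * (4 * Z - 4 * X - 252 * b) - 340 * a^2 * s^8 + s^10 * ?R" unfolding 1 2 by Groebner_Basis.algebra
  also have "4 * Z - 4 * X - 252 * b = 340 * a^2 * s^2 + s^4 * (4 * m - 4 * n)" unfolding assms(4,5) by Groebner_Basis.algebra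
  also have "s^6 * (340 * a^2 * s^2 + s^4 * (4 * m - 4 * n)) - 340 * a^2 * s^8 + s^10 * ?R = s^2 * (4 * m - 4 * n + ?R) * s^8"
    by Groebner_Basis.algebra
  finally show ?thesis using assms(1) by simp
qed

lemma eisenstein_G_odd:
  assumes "odd k" shows "eisenstein_G k \<tau> = 0"
proof -
  have "eisenstein_G k \<tau> = (\<Sum>\<^sub>\<infinity>x\<in>UNIV-{(0,0)}. - (1 / lattice_pt \<tau> x ^ k))"
    unfolding eisenstein_G_eq
  proof (rule infsum_reindex_bij_witness[of _ "\<lambda>x. (- fst x, - snd x)" "\<lambda>x. (- fst x, - snd x)"])
    fix x :: "int \<times> int"
    have "lattice_pt \<tau> (- fst x, - snd x) = - lattice_pt \<tau> x" by (simp add: lattice_pt_def)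
    then show "- (1 / lattice_pt \<tau> (- fst x, - snd x) ^ k) = 1 / lattice_pt \<tau> x ^ k" using assms by simp
  qed auto
  then have "eisenstein_G k \<tau> = - eisenstein_G k \<tau>" unfolding eisenstein_G_eq infsum_uminus .
  then show ?thesis by simp
qed

section \<open>The lattice, the function \<open>Y\<close> and the sum of inverse cubes\<close>

context imaginary_tau
begin

definition Lat :: "complex set" where "Lat = range (lattice_pt \<tau>)"

lemma Lat_iff: "s \<in> Lat \<longleftrightarrow> (\<exists>m n::int. s = of_int m + of_int n * \<tau>)"
  by (auto simp: Lat_def lattice_pt_def image_iff)

lemma Lat_0: "0 \<in> Lat" unfolding Lat_iff by (intro exI[of _ 0]) simp

lemma Lat_add: "s \<in> Lat \<Longrightarrow> t \<in> Lat \<Longrightarrow> s + t \<in> Lat"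
  unfolding Lat_iff
proof (elim exE)
  fix m n k l :: int assume "s = of_int m + of_int n * \<tau>" "t = of_int k + of_int l * \<tau>"
  then have "s + t = of_int (m + k) + of_int (n + l) * \<tau>" by (simp add: algebra_simps)
  then show "\<exists>m n. s + t = of_int m + of_int n * \<tau>" by blast
qed

lemma Lat_minus: "s \<in> Lat \<Longrightarrow> - s \<in> Lat"
  unfolding Lat_iff
proof (elim exE)
  fix m n :: int assume "s = of_int m + of_int n * \<tau>"
  then have "- s = of_int (-m) + of_int (-n) * \<tau>" by simp
  then show "\<exists>m n. - s = of_int m + of_int n * \<tau>" by blast
qed

lemma Lat_minus_iff: "- s \<in> Lat \<longleftrightarrow> s \<in> Lat" using Lat_minus[of s] Lat_minus[of "- s"] by auto

lemma Lat_1: "1 \<in> Lat" and Lat_tau: "\<tau> \<in> Lat"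
  unfolding Lat_iff by (rule exI[of _ 1], rule exI[of _ 0], simp) (rule exI[of _ 0], rule exI[of _ 1], simp)

text \<open>Used with \<open>k = 1\<close> for the lattice and with \<open>k = 2\<close> for the
  possible singularities in the duplication formula.\<close>

lemma Lat_no_limit_point:
  assumes k: "k > (0::nat)"
  shows "\<not> z islimpt {s. of_nat k * s \<in> Lat}"
proof
  assume lim: "z islimpt {s. of_nat k * s \<in> Lat}"
  have inf: "infinite ({s. of_nat k * s \<in> Lat} \<inter> ball z 1)"
    by (rule lim[unfolded islimpt_eq_infinite_ball, rule_format]) simp
  have "{s. of_nat k * s \<in> Lat} \<inter> ball z 1
      \<subseteq> (\<lambda>x. lattice_pt \<tau> x / of_nat k) ` {x. norm (lattice_pt \<tau> x) \<le> real k * (norm z + 1)}"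
  proof
    fix s assume s: "s \<in> {s. of_nat k * s \<in> Lat} \<inter> ball z 1"
    then obtain x where x: "of_nat k * s = lattice_pt \<tau> x" by (auto simp: Lat_def)
    have "norm s \<le> norm z + 1"
      using s norm_triangle_ineq2[of s z] by (simp add: dist_norm norm_minus_commute)
    then have "norm (lattice_pt \<tau> x) \<le> real k * (norm z + 1)"
      unfolding x[symmetric] using k by (simp add: norm_mult)
    moreover have "s = lattice_pt \<tau> x / of_nat k" using x k by (simp add: field_simps)
    ultimately show "s \<in> (\<lambda>x. lattice_pt \<tau> x / of_nat k) ` {x. norm (lattice_pt \<tau> x) \<le> real k * (norm z + 1)}"
      by blast
  qed
  then show False using inf lattice_finite[OF Im_tau] finite_surj by blast
qed

lemma Lat_no_limit: "\<not> z islimpt Lat" using Lat_no_limit_point[of 1 z] by simp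

lemma Lat_closed: "closed (Lat - X)"
  using Lat_no_limit unfolding closed_limpt by (meson Diff_subset islimpt_subset)

lemma Lat_open: "open (- Lat)" using Lat_closed[of "{}"] by (simp add: open_Compl)

lemma periodic_Lat:
  assumes "\<And>z. f (z + 1) = f z" "\<And>z. f (z + \<tau>) = f z" "p \<in> Lat"
  shows "f (z + p) = f z"
proof -
  obtain m n :: int where p: "p = of_int m + of_int n * \<tau>" using assms(3) Lat_iff by blast
  show ?thesis
    using periodic_int[of f \<tau> "z + of_int m" n, OF assms(2)] periodic_int[of f 1 z m] assms(1)
    by (simp add: p add.assoc)
qed

text \<open>Thanks to this, local expansions have to be computed at 0 only.\<close>

lemma limit_Lat:
  fixes f :: "complex \<Rightarrow> complex"
  assumes "\<And>z. f (z + 1) = f z" "\<And>z. f (z + \<tau>) = f z" "p \<in> Lat" "f \<midarrow>0\<rightarrow> l"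
  shows "f \<midarrow>p\<rightarrow> l"
  using LIM_offset[OF assms(4), of "- p"] periodic_Lat[of f "- p", OF assms(1,2) Lat_minus[OF assms(3)]] by simp

lemma deriv_periodic:
  fixes f :: "complex \<Rightarrow> complex"
  assumes "\<And>z. f (z + c) = f z" shows "deriv f (z + c) = deriv f z"
proof -
  have "(f has_field_derivative D) (at (z + c)) \<longleftrightarrow> (f has_field_derivative D) (at z)" for D
    using DERIV_shift[of f D z c] assms by simp
  then show ?thesis by (simp add: deriv_def)
qed

text \<open>In the variable \<open>s\<close> with \<open>v = \<pi>/2 + \<pi> s\<close>, the function \<open>W\<^sup>2 + W\<^sup>-\<^sup>2\<close> of
  \<open>W = \<vartheta>\<^sub>2/\<vartheta>\<^sub>3\<close> is invariant under \<open>\<int> + \<int>\<tau>\<close>, although \<open>W\<close> itself only has the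
  periods of \<open>2\<int> + 2\<int>\<tau>\<close>; this is what ties it to the invariant \<open>j(\<tau>)\<close>.\<close>

definition th2 where "th2 s = theta2 (of_real pi / 2 + of_real pi * s) \<tau>"
definition th3 where "th3 s = theta3 (of_real pi / 2 + of_real pi * s) \<tau>"
definition Y where "Y s = (th2 s ^ 4 + th3 s ^ 4) / (th2 s * th3 s)\<^sup>2"

lemma th_shift_1: "th2 (s + 1) = - th2 s" "th3 (s + 1) = th3 s"
  using theta2_plus_pi[of "of_real pi / 2 + of_real pi * s" \<tau>] theta3_plus_pi[of "of_real pi / 2 + of_real pi * s" \<tau>]
  by (simp_all add: th2_def th3_def algebra_simps)

lemma th_shift_tau: "\<exists>e. e \<noteq> 0 \<and> th2 (s + \<tau>) = e * th3 s \<and> th3 (s + \<tau>) = e * th2 s"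
  using theta2_plus_pi_tau[of "of_real pi / 2 + of_real pi * s" \<tau>] theta3_plus_pi_tau[of "of_real pi / 2 + of_real pi * s" \<tau>]
  by (intro exI[of _ "exp (- \<i> * of_real pi * \<tau> / 2 - \<i> * (of_real pi / 2 + of_real pi * s))"])
     (simp add: th2_def th3_def algebra_simps)

lemma th_minus: "th2 (- s) = - th2 s" "th3 (- s) = th3 s"
proof -
  have e: "of_real pi / 2 + of_real pi * s = - (of_real pi / 2 + of_real pi * (- s)) + of_real pi"
    by (simp add: field_simps)
  show "th2 (- s) = - th2 s" "th3 (- s) = th3 s"
    unfolding th2_def th3_def e theta2_plus_pi theta3_plus_pi theta2_minus theta3_minus by simp_all
qed

lemma Y_plus_1: "Y (s + 1) = Y s" unfolding Y_def th_shift_1 by simp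

lemma Y_plus_tau: "Y (s + \<tau>) = Y s"
proof -
  obtain e where e: "e \<noteq> 0" "th2 (s + \<tau>) = e * th3 s" "th3 (s + \<tau>) = e * th2 s" using th_shift_tau by blast
  have "Y (s + \<tau>) = (e ^ 4 * (th2 s ^ 4 + th3 s ^ 4)) / (e ^ 4 * (th2 s * th3 s)\<^sup>2)"
    unfolding Y_def e(2,3) by (intro arg_cong2[of _ _ _ _ "(/)"]) Groebner_Basis.algebra+
  then show ?thesis using e(1) by (simp add: Y_def)
qed

lemma Y_minus: "Y (- s) = Y s" unfolding Y_def th_minus by simp

text \<open>\<open>th2\<close> vanishes at the lattice points with an even coefficient of
  \<open>\<tau>\<close>, \<open>th3\<close> at those with an odd one.\<close>

lemma th_zero_iff: "th2 s * th3 s = 0 \<longleftrightarrow> s \<in> Lat"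
proof -
  have 2: "th2 s = 0 \<longleftrightarrow> (\<exists>k l::int. s = of_int k + of_int (2 * l) * \<tau>)"
    unfolding th2_def theta2_eq_0_iff
  proof (intro ex_cong1)
    fix k l :: int
    have "of_real pi / 2 + of_real pi * s = of_real pi / 2 + of_int k * of_real pi + of_int l * (2 * of_real pi * \<tau>)
       \<longleftrightarrow> of_real pi * s = of_real pi * (of_int k + of_int (2 * l) * \<tau>)" by (simp add: algebra_simps)
    then show "(of_real pi / 2 + of_real pi * s = of_real pi / 2 + of_int k * of_real pi + of_int l * (2 * of_real pi * \<tau>))
       = (s = of_int k + of_int (2 * l) * \<tau>)" by simp
  qed
  have 3: "th3 s = 0 \<longleftrightarrow> (\<exists>k l::int. s = of_int k + of_int (2 * l + 1) * \<tau>)"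
    unfolding th3_def theta3_eq_0_iff
  proof (intro ex_cong1)
    fix k l :: int
    have "of_real pi / 2 + of_real pi * s = of_real pi / 2 + of_real pi * \<tau> + of_int k * of_real pi + of_int l * (2 * of_real pi * \<tau>)
       \<longleftrightarrow> of_real pi * s = of_real pi * (of_int k + of_int (2 * l + 1) * \<tau>)" by (simp add: algebra_simps)
    then show "(of_real pi / 2 + of_real pi * s = of_real pi / 2 + of_real pi * \<tau> + of_int k * of_real pi + of_int l * (2 * of_real pi * \<tau>))
       = (s = of_int k + of_int (2 * l + 1) * \<tau>)" by simp
  qed
  have split: "(\<exists>n. Q n) \<longleftrightarrow> (\<exists>l. Q (2 * l)) \<or> (\<exists>l. Q (2 * l + 1))" for Q :: "int \<Rightarrow> bool"
    by (metis evenE oddE)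
  let ?Q = "\<lambda>n. \<exists>m. s = of_int m + of_int n * \<tau>"
  have "s \<in> Lat \<longleftrightarrow> (\<exists>n. ?Q n)" unfolding Lat_iff by (rule ex_comm)
  moreover have "th2 s = 0 \<longleftrightarrow> (\<exists>l. ?Q (2 * l))" unfolding 2 by (rule ex_comm)
  moreover have "th3 s = 0 \<longleftrightarrow> (\<exists>l. ?Q (2 * l + 1))" unfolding 3 by (rule ex_comm)
  ultimately show ?thesis using split[of ?Q] by (simp only: mult_eq_0_iff)
qed

lemma th_entire: "th2 holomorphic_on UNIV" "th3 holomorphic_on UNIV"
  unfolding th2_def th3_def using Im_tau
  by (intro theta2_holomorphic theta3_holomorphic holomorphic_intros; simp)+

lemma Y_holomorphic: "Y holomorphic_on - Lat"
proof -
  have "th2 holomorphic_on - Lat" "th3 holomorphic_on - Lat"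
    using th_entire holomorphic_on_subset by blast+
  then show ?thesis
    unfolding Y_def using th_zero_iff by (intro holomorphic_intros) auto
qed

text \<open>Nonzero lattice points have norm at least \<open>1 / lat_const\<close>. With half of
  this as radius, points of the ball round 0 keep distance \<open>lat_radius\<close> from all of
  them.\<close>

definition lat_const where "lat_const = 1 + (norm \<tau> + 1) / Im \<tau>"
definition lat_radius where "lat_radius = 1 / (2 * lat_const)"

lemma lat_const_pos: "lat_const > 0" using Im_tau by (simp add: lat_const_def add_pos_nonneg)

lemma lat_radius_pos: "lat_radius > 0" using lat_const_pos by (simp add: lat_radius_def)

lemma lattice_pt_norm_ge: "x \<noteq> (0,0) \<Longrightarrow> norm (lattice_pt \<tau> x) \<ge> 2 * lat_radius"
proof -
  assume x: "x \<noteq> (0,0)"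
  have "2 * lat_radius = 1 / lat_const" by (simp add: lat_radius_def)
  then show ?thesis
    using lattice_norm_ge[OF Im_tau order_refl order_refl x] unfolding lat_const_def[symmetric] by simp
qed

lemma Lat_ball: "s \<in> Lat \<Longrightarrow> s \<in> ball 0 (2 * lat_radius) \<Longrightarrow> s = 0"
proof -
  assume "s \<in> Lat" "s \<in> ball 0 (2 * lat_radius)"
  then obtain x where "s = lattice_pt \<tau> x" "norm (lattice_pt \<tau> x) < 2 * lat_radius" by (auto simp: Lat_def)
  then show "s = 0" using lattice_pt_norm_ge[of x] by (cases "x = (0,0)") (auto simp: lattice_pt_def)
qed

text \<open>\<open>th2\<close> has a simple zero at 0 and \<open>th3\<close> none, so
  \<open>Y\<close> has a double pole; evenness removes the term in \<open>1 / s\<close>.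
  \<open>A\<close> is the leading coefficient, and \<open>B\<close> is chosen to remove the constant
  term.\<close>

lemma Y_expansion:
  obtains A B U where "A \<noteq> 0" "U holomorphic_on ball 0 lat_radius" "U 0 = 0"
    "\<And>s. s \<in> ball 0 lat_radius \<Longrightarrow> s \<noteq> 0 \<Longrightarrow> (Y s - B) / A = 1 / s\<^sup>2 + U s"
proof -
  have t0: "th2 0 = 0" by (simp add: th2_def theta2_half_pi)
  obtain a1 where a1: "a1 holomorphic_on UNIV" "\<And>s. th2 s = a1 s * s"
    by (rule entire_quotient[of th2 "\<lambda>s. s"]) (use th_entire t0 in \<open>auto simp: holomorphic_on_ident\<close>)
  have d1: "(th2 has_field_derivative deriv (\<lambda>v. theta2 v \<tau>) (of_real pi / 2) * of_real pi) (at 0)"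
  proof -
    have "((\<lambda>v. theta2 v \<tau>) has_field_derivative deriv (\<lambda>v. theta2 v \<tau>) (of_real pi / 2 + of_real pi * 0)) (at (of_real pi / 2 + of_real pi * 0))"
      by (rule holomorphic_derivI[OF theta2_entire]) auto
    then have "((\<lambda>s. theta2 (of_real pi / 2 + of_real pi * s) \<tau>) has_field_derivative
       deriv (\<lambda>v. theta2 v \<tau>) (of_real pi / 2 + of_real pi * 0) * of_real pi) (at 0)"
      by (rule DERIV_chain2) (auto intro!: derivative_eq_intros)
    then show ?thesis by (simp add: th2_def[abs_def])
  qed
  have d2: "(th2 has_field_derivative a1 0) (at 0)"
  proof -
    have "((\<lambda>s. a1 s * s) has_field_derivative deriv a1 0 * 0 + a1 0 * 1) (at 0)"
      by (rule derivative_eq_intros holomorphic_derivI[OF a1(1)] | simp)+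
    moreover have "th2 = (\<lambda>s. a1 s * s)" using a1(2) by blast
    ultimately show ?thesis by simp
  qed
  have a10: "a1 0 \<noteq> 0"
    using DERIV_unique[OF d1 d2] theta2_simple_zero[OF theta2_half_pi] by auto
  have b0: "th3 0 \<noteq> 0" using theta3_real_nonzero[of "pi/2"] by (simp add: th3_def)
  have sub: "ball 0 lat_radius \<subseteq> ball 0 (2 * lat_radius)" using lat_radius_pos by auto
  have nz: "a1 s * th3 s \<noteq> 0" if "s \<in> ball 0 lat_radius" for s
  proof (cases "s = 0")
    case False
    then have "th2 s * th3 s \<noteq> 0" using Lat_ball[of s] that sub th_zero_iff by blast
    then show ?thesis using a1(2)[of s] by auto
  qed (use a10 b0 in simp)
  define G where "G s = (th2 s ^ 4 + th3 s ^ 4) / (a1 s * th3 s)\<^sup>2" for s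
  have G: "G holomorphic_on ball 0 lat_radius"
  proof -
    have "th2 holomorphic_on ball 0 lat_radius" "th3 holomorphic_on ball 0 lat_radius" "a1 holomorphic_on ball 0 lat_radius"
      using th_entire a1(1) holomorphic_on_subset by blast+
    then show ?thesis unfolding G_def using nz by (intro holomorphic_intros) auto
  qed
  have YG: "Y s = G s / s\<^sup>2" if "s \<noteq> 0" for s
    unfolding Y_def G_def a1(2)[of s] by (simp add: power_mult_distrib mult_ac)
  define A where "A = G 0"
  have A: "A \<noteq> 0" using a10 b0 t0 by (simp add: A_def G_def)
  define g where "g s = G s / A" for s
  have g: "g holomorphic_on ball 0 lat_radius" unfolding g_def using A G by (intro holomorphic_intros)
  have g0: "g 0 = 1" using A by (simp add: g_def A_def)
  have geven: "g (- s) = g s" for s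
  proof (cases "s = 0")
    case False
    then have "G (- s) / s\<^sup>2 = G s / s\<^sup>2" using YG[of s] YG[of "- s"] Y_minus[of s] by simp
    then show ?thesis using False by (simp add: g_def)
  qed simp
  have dg: "deriv g 0 = 0"
  proof -
    have D: "(g has_field_derivative deriv g 0) (at 0)"
      by (rule holomorphic_derivI[OF g]) (use lat_radius_pos in auto)
    then have "(g has_field_derivative deriv g 0) (at (- 0))" by simp
    then have "((\<lambda>s. g (- s)) has_field_derivative deriv g 0 * (- 1)) (at 0)"
      by (rule DERIV_chain2) (auto intro!: derivative_eq_intros)
    then have "(g has_field_derivative - deriv g 0) (at 0)" by (simp add: geven)
    from DERIV_unique[OF D this] show ?thesis by simp
  qed
  obtain k where k: "k holomorphic_on ball 0 lat_radius"
    "\<And>s. s \<in> ball 0 lat_radius \<Longrightarrow> g s = (\<Sum>i<2. (deriv ^^ i) g 0 / fact i * s ^ i) + s ^ 2 * k s"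
    using holomorphic_taylor_remainder[OF g, of 2] by blast
  have gk: "g s = 1 + s\<^sup>2 * k s" if "s \<in> ball 0 lat_radius" for s
    using k(2)[OF that] by (simp add: numeral_2_eq_2 g0 dg)
  show ?thesis
  proof (rule that[of A "\<lambda>s. k s - k 0" "A * k 0"])
    show "(\<lambda>s. k s - k 0) holomorphic_on ball 0 lat_radius" using k(1) by (intro holomorphic_intros)
    fix s :: complex assume s: "s \<in> ball 0 lat_radius" "s \<noteq> 0"
    have "Y s / A = g s / s\<^sup>2" using YG[OF s(2)] by (simp add: g_def mult.commute)
    then have "Y s / A = (1 + s\<^sup>2 * k s) / s\<^sup>2" unfolding gk[OF s(1)] .
    then show "(Y s - A * k 0) / A = 1 / s\<^sup>2 + (k s - k 0)" using s A by (simp add: diff_divide_distrib add_divide_distrib)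
  qed (use A in auto)
qed

text \<open>Up to the factor -2, \<open>cube_sum\<close> is the derivative of Weierstrass's
  function. Exponent 3 gives absolute convergence without correction terms, so the periods are mere
  reindexings; \<open>cube_rest\<close> leaves out the pole at 0.\<close>

definition cube_rest where "cube_rest s = (\<Sum>\<^sub>\<infinity>x\<in>UNIV-{(0,0)}. 1 / (s - lattice_pt \<tau> x) ^ 3)"
definition cube_sum where "cube_sum s = (\<Sum>\<^sub>\<infinity>x. 1 / (s - lattice_pt \<tau> x) ^ 3)"

text \<open>For a lattice point \<open>w\<close> the triangle inequality and
  \<open>norm (s - w) \<ge> r\<close> give
  \<open>norm w \<le> (1 + M / r) * norm (s - w)\<close>.\<close>

lemma cube_bound:
  assumes "r > 0" "\<And>x. x \<noteq> (0,0) \<Longrightarrow> norm (s - lattice_pt \<tau> x) \<ge> r" "norm s \<le> M" "x \<noteq> (0,0)"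
  shows "norm (1 / (s - lattice_pt \<tau> x) ^ 3) \<le> (1 + M / r) ^ 3 * lat_const ^ 3 * lattice_bound x"
proof -
  have M: "M \<ge> 0" using assms(3) norm_ge_zero order_trans by blast
  have "norm (lattice_pt \<tau> x) \<le> norm (s - lattice_pt \<tau> x) + norm s" using norm_triangle_ineq2[of "lattice_pt \<tau> x" s]
    by (simp add: norm_minus_commute)
  also have "\<dots> \<le> norm (s - lattice_pt \<tau> x) + norm (s - lattice_pt \<tau> x) * (M / r)"
  proof -
    have "M = r * (M / r)" using assms(1) by simp
    also have "\<dots> \<le> norm (s - lattice_pt \<tau> x) * (M / r)" using assms(1,2,4) M by (intro mult_right_mono) auto
    finally show ?thesis using assms(3) by linarith
  qed
  finally have le: "norm (lattice_pt \<tau> x) \<le> (1 + M / r) * norm (s - lattice_pt \<tau> x)" by (simp add: algebra_simps)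
  have pos: "norm (lattice_pt \<tau> x) > 0" using lattice_pt_norm_ge[OF assms(4)] lat_radius_pos by linarith
  have pos2: "norm (s - lattice_pt \<tau> x) > 0" using assms(1) assms(2)[OF assms(4)] by linarith
  have "norm (lattice_pt \<tau> x) ^ 3 \<le> (1 + M / r) ^ 3 * norm (s - lattice_pt \<tau> x) ^ 3"
    using power_mono[OF le, of 3] by (simp add: power_mult_distrib)
  then have "1 / norm (s - lattice_pt \<tau> x) ^ 3 \<le> (1 + M / r) ^ 3 * (1 / norm (lattice_pt \<tau> x) ^ 3)"
    using pos pos2 by (simp add: field_simps)
  also have "1 / norm (lattice_pt \<tau> x) ^ 3 \<le> lat_const ^ 3 * lattice_bound x"
    using lattice_norm_power_le[OF Im_tau order_refl order_refl, of 3 x] by (simp add: norm_divide norm_power lat_const_def)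
  finally show ?thesis using M assms(1) by (simp add: norm_divide norm_power mult.assoc mult_left_mono)
qed

lemma cube_rest_bound_at:
  assumes "z \<notin> Lat - {0}"
  obtains r where "r > 0" "\<And>w x. w \<in> cball z r \<Longrightarrow> x \<noteq> (0,0) \<Longrightarrow> norm (w - lattice_pt \<tau> x) \<ge> r"
proof -
  have "open (- (Lat - {0}))" using Lat_closed[of "{0}"] by (rule open_Compl)
  then obtain e where e: "e > 0" "ball z e \<subseteq> - (Lat - {0})" using assms by (meson ComplI openE)
  have "norm (w - lattice_pt \<tau> x) \<ge> e/2" if "w \<in> cball z (e/2)" "x \<noteq> (0,0)" for w x
  proof -
    have "lattice_pt \<tau> x \<in> Lat - {0}"
      using lattice_pt_norm_ge[OF that(2)] lat_radius_pos by (auto simp: Lat_def)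
    then have "lattice_pt \<tau> x \<notin> ball z e" using e by blast
    then have "e \<le> dist z (lattice_pt \<tau> x)" by simp
    also have "\<dots> \<le> dist z w + dist w (lattice_pt \<tau> x)" by (rule dist_triangle)
    finally show ?thesis using that(1) by (simp add: dist_norm)
  qed
  then show ?thesis using that[of "e/2"] e(1) by simp
qed

lemma cube_rest_holomorphic: "cube_rest holomorphic_on - (Lat - {0})"
  unfolding cube_rest_def
proof (rule infsum_holomorphic)
  fix x :: "int \<times> int" assume "x \<in> UNIV - {(0,0)}"
  then have "lattice_pt \<tau> x \<in> Lat - {0}"
    using lattice_pt_norm_ge[of x] lat_radius_pos by (auto simp: Lat_def)
  then show "(\<lambda>s. 1 / (s - lattice_pt \<tau> x) ^ 3) holomorphic_on - (Lat - {0})"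
    by (intro holomorphic_intros) auto
next
  fix z assume "z \<in> - (Lat - {0})"
  then obtain r where r: "r > 0" "\<And>w x. w \<in> cball z r \<Longrightarrow> x \<noteq> (0,0) \<Longrightarrow> norm (w - lattice_pt \<tau> x) \<ge> r"
    using cube_rest_bound_at[of z] by auto
  show "\<exists>r>0. \<exists>M. cball z r \<subseteq> - (Lat - {0}) \<and> M summable_on UNIV - {(0, 0)} \<and>
           (\<forall>x\<in>UNIV - {(0, 0)}. \<forall>w\<in>cball z r. norm (1 / (w - lattice_pt \<tau> x) ^ 3) \<le> M x)"
  proof (intro exI[of _ r] exI[of _ "\<lambda>x. (1 + (norm z + r) / r) ^ 3 * lat_const ^ 3 * lattice_bound x"] conjI r(1) ballI)
    show "cball z r \<subseteq> - (Lat - {0})"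
    proof
      fix w assume w: "w \<in> cball z r"
      show "w \<in> - (Lat - {0})"
      proof
        assume "w \<in> Lat - {0}"
        then obtain x where x': "w = lattice_pt \<tau> x" "w \<noteq> 0" by (auto simp: Lat_def)
        then have x: "w = lattice_pt \<tau> x" "x \<noteq> (0,0)" by (auto simp: lattice_pt_def)
        show False using r(2)[OF w x(2)] r(1) x(1) by simp
      qed
    qed
    show "(\<lambda>x. (1 + (norm z + r) / r) ^ 3 * lat_const ^ 3 * lattice_bound x) summable_on UNIV - {(0, 0)}"
      by (intro summable_on_cmult_right summable_on_subset[OF lattice_bound_summable]) auto
    fix x w assume "x \<in> UNIV - {(0::int, 0::int)}" and w: "w \<in> cball z r"
    moreover have "norm w \<le> norm z + r"
      using w norm_triangle_ineq2[of w z] by (simp add: dist_norm norm_minus_commute)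
    ultimately show "norm (1 / (w - lattice_pt \<tau> x) ^ 3) \<le> (1 + (norm z + r) / r) ^ 3 * lat_const ^ 3 * lattice_bound x"
      using r by (intro cube_bound) auto
  qed
qed

lemma cube_sum_eq:
  assumes "s \<notin> Lat" shows "cube_sum s = 1 / s ^ 3 + cube_rest s"
proof -
  obtain r where r: "r > 0" "\<And>w x. w \<in> cball s r \<Longrightarrow> x \<noteq> (0,0) \<Longrightarrow> norm (w - lattice_pt \<tau> x) \<ge> r"
    using cube_rest_bound_at[of s] assms by auto
  have "(\<lambda>x. (1 + norm s / r) ^ 3 * lat_const ^ 3 * lattice_bound x) summable_on UNIV - {(0, 0)}"
    by (intro summable_on_cmult_right summable_on_subset[OF lattice_bound_summable]) auto
  then have "(\<lambda>x. norm (1 / (s - lattice_pt \<tau> x) ^ 3)) summable_on UNIV - {(0, 0)}"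
  proof (rule Infinite_Sum.abs_summable_on_comparison_test')
    fix x :: "int \<times> int" assume "x \<in> UNIV - {(0,0)}"
    then show "norm (1 / (s - lattice_pt \<tau> x) ^ 3) \<le> (1 + norm s / r) ^ 3 * lat_const ^ 3 * lattice_bound x"
      using r(2)[of s] r(1) by (intro cube_bound[OF r(1)]) auto
  qed
  then have sm: "(\<lambda>x. 1 / (s - lattice_pt \<tau> x) ^ 3) summable_on UNIV - {(0, 0)}"
    by (rule abs_summable_summable)
  have "cube_sum s = infsum (\<lambda>x. 1 / (s - lattice_pt \<tau> x) ^ 3) (insert (0,0) (UNIV - {(0,0)}))"
    unfolding cube_sum_def by (rule arg_cong[of _ _ "infsum _"]) auto
  also have "\<dots> = 1 / (s - lattice_pt \<tau> (0,0)) ^ 3 + cube_rest s"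
    unfolding cube_rest_def by (subst infsum_insert[OF sm]) auto
  finally show ?thesis by (simp add: lattice_pt_def)
qed

lemma cube_sum_holomorphic: "cube_sum holomorphic_on - Lat"
proof -
  have "cube_rest holomorphic_on - Lat" by (rule holomorphic_on_subset[OF cube_rest_holomorphic]) auto
  then have "(\<lambda>s. 1 / s ^ 3 + cube_rest s) holomorphic_on - Lat"
    using Lat_0 by (intro holomorphic_intros) auto
  then show ?thesis by (rule holomorphic_transform) (simp add: cube_sum_eq)
qed

lemma cube_sum_plus_1: "cube_sum (s + 1) = cube_sum s"
  unfolding cube_sum_def
  by (rule infsum_reindex_bij_witness[of _ "\<lambda>x. (fst x + 1, snd x)" "\<lambda>x. (fst x - 1, snd x)"])
     (auto simp: lattice_pt_def algebra_simps)

lemma cube_sum_plus_tau: "cube_sum (s + \<tau>) = cube_sum s"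
  unfolding cube_sum_def
  by (rule infsum_reindex_bij_witness[of _ "\<lambda>x. (fst x, snd x + 1)" "\<lambda>x. (fst x, snd x - 1)"])
     (auto simp: lattice_pt_def algebra_simps)

lemma cube_sum_minus: "cube_sum (- s) = - cube_sum s"
proof -
  have "cube_sum (- s) = (\<Sum>\<^sub>\<infinity>x. - (1 / (s - lattice_pt \<tau> x) ^ 3))"
    unfolding cube_sum_def
  proof (rule infsum_reindex_bij_witness[of _ "\<lambda>x. (- fst x, - snd x)" "\<lambda>x. (- fst x, - snd x)"])
    fix x :: "int \<times> int"
    have e: "s - lattice_pt \<tau> (- fst x, - snd x) = - (- s - lattice_pt \<tau> x)" by (simp add: lattice_pt_def)
    have "- (1 / (- y) ^ 3) = 1 / y ^ 3" for y :: complex by simp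
    then show "- (1 / (s - lattice_pt \<tau> (- fst x, - snd x)) ^ 3) = 1 / (- s - lattice_pt \<tau> x) ^ 3"
      unfolding e .
  qed auto
  then show ?thesis unfolding cube_sum_def infsum_uminus .
qed

text \<open>Termwise differentiation; the minus sign is \<open>(-1) ^ m\<close> against the
  \<open>(-1) ^ (m + 3)\<close> of the negated lattice point.\<close>

lemma cube_rest_deriv:
  "(deriv ^^ m) cube_rest 0 = - (fact (m + 2) / 2) * eisenstein_G (m + 3) \<tau>"
proof -
  let ?M = "\<lambda>x. (1 + lat_radius / lat_radius) ^ 3 * lat_const ^ 3 * lattice_bound x"
  have far: "norm (s - lattice_pt \<tau> x) \<ge> lat_radius" if "s \<in> ball 0 lat_radius" "x \<noteq> (0,0)" for s x
    using lattice_pt_norm_ge[OF that(2)] that(1) norm_triangle_ineq2[of "lattice_pt \<tau> x" s]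
    by (simp add: norm_minus_commute)
  have "((\<lambda>x. (deriv ^^ m) (\<lambda>s. 1 / (s - lattice_pt \<tau> x) ^ 3) 0) has_sum (deriv ^^ m) cube_rest 0) (UNIV - {(0,0)})"
    unfolding cube_rest_def
  proof (rule higher_deriv_infsum)
    show "(0::complex) \<in> ball 0 lat_radius" using lat_radius_pos by simp
    show "?M summable_on UNIV - {(0, 0)}"
      by (intro summable_on_cmult_right summable_on_subset[OF lattice_bound_summable]) auto
    show "(\<lambda>s. 1 / (s - lattice_pt \<tau> x) ^ 3) holomorphic_on ball 0 lat_radius" if "x \<in> UNIV - {(0,0)}" for x
      using far[of _ x] that lat_radius_pos by (intro holomorphic_intros) fastforce
    show "norm (1 / (s - lattice_pt \<tau> x) ^ 3) \<le> ?M x" if "x \<in> UNIV - {(0,0)}" "s \<in> ball 0 lat_radius" for x s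
      using that far lat_radius_pos by (intro cube_bound) auto
  qed simp
  then have "(deriv ^^ m) cube_rest 0 = (\<Sum>\<^sub>\<infinity>x\<in>UNIV-{(0,0)}. (deriv ^^ m) (\<lambda>s. 1 / (s - lattice_pt \<tau> x) ^ 3) 0)"
    by (simp add: infsumI)
  also have "\<dots> = (\<Sum>\<^sub>\<infinity>x\<in>UNIV-{(0,0)}. - (fact (m + 2) / 2) * (1 / lattice_pt \<tau> x ^ (m + 3)))"
  proof (rule infsum_cong)
    fix x :: "int \<times> int" assume "x \<in> UNIV - {(0,0)}"
    then have "0 \<noteq> lattice_pt \<tau> x" using lattice_pt_norm_ge[of x] lat_radius_pos by auto
    then have "(deriv ^^ m) (\<lambda>s. 1 / (s - lattice_pt \<tau> x) ^ 3) 0 = (-1) ^ m * (fact (m + 2) / 2) / (- lattice_pt \<tau> x) ^ (m + 3)"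
      using higher_deriv_inverse_cube[of 0 "lattice_pt \<tau> x" m] by simp
    also have "(- lattice_pt \<tau> x) ^ (m + 3) = (-1) ^ m * (-1) ^ 3 * lattice_pt \<tau> x ^ (m + 3)"
      by (subst power_minus) (simp add: power_add)
    finally show "(deriv ^^ m) (\<lambda>s. 1 / (s - lattice_pt \<tau> x) ^ 3) 0 = - (fact (m + 2) / 2) * (1 / lattice_pt \<tau> x ^ (m + 3))"
      by simp
  qed
  also have "\<dots> = - (fact (m + 2) / 2) * eisenstein_G (m + 3) \<tau>"
    unfolding eisenstein_G_eq by (rule infsum_cmult_right')
  finally show ?thesis .
qed

end

section \<open>The Weierstrass equation and the duplication formula\<close>

locale weierstrass = imaginary_tau +
  fixes A B :: complex and U :: "complex \<Rightarrow> complex"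
  assumes A: "A \<noteq> 0" and U: "U holomorphic_on ball 0 lat_radius" "U 0 = 0"
    and Y_near: "\<And>s. s \<in> ball 0 lat_radius \<Longrightarrow> s \<noteq> 0 \<Longrightarrow> (Y s - B) / A = 1 / s\<^sup>2 + U s"
begin

text \<open>Weierstrass's function of the lattice \<open>Lat\<close>: it has the principal part
  \<open>1 / s\<^sup>2\<close> and, since \<open>U 0 = 0\<close>, no constant term at 0.\<close>

definition P where "P s = (Y s - B) / A"

lemma Y_eq: "Y s = A * P s + B" using A by (simp add: P_def)

lemma P_periodic: "P (s + 1) = P s" "P (s + \<tau>) = P s" "P (- s) = P s"
  unfolding P_def Y_plus_1 Y_plus_tau Y_minus by simp_all

lemma P_holomorphic: "P holomorphic_on - Lat"
  unfolding P_def using A by (intro holomorphic_intros Y_holomorphic)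

lemma P_deriv: "s \<notin> Lat \<Longrightarrow> (P has_field_derivative deriv P s) (at s)"
  by (rule holomorphic_derivI[OF P_holomorphic Lat_open]) simp

lemma dP_holomorphic: "deriv P holomorphic_on - Lat"
  by (rule holomorphic_deriv[OF P_holomorphic Lat_open])

lemma dP_periodic: "deriv P (s + 1) = deriv P s" "deriv P (s + \<tau>) = deriv P s"
  by (rule deriv_periodic, rule P_periodic)+

lemma dP_minus:
  assumes "s \<notin> Lat" shows "deriv P (- s) = - deriv P s"
proof -
  have "(P has_field_derivative deriv P (- s)) (at (- s))" using assms Lat_minus_iff P_deriv by blast
  then have "((\<lambda>s. P (- s)) has_field_derivative deriv P (- s) * (- 1)) (at s)"
    by (rule DERIV_chain2) (auto intro!: derivative_eq_intros)
  then have "(P has_field_derivative - deriv P (- s)) (at s)" by (simp add: P_periodic)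
  from DERIV_unique[OF P_deriv[OF assms] this] show ?thesis by simp
qed

lemma near_not_Lat: "s \<in> ball 0 lat_radius \<Longrightarrow> s \<noteq> 0 \<Longrightarrow> s \<notin> Lat"
  using Lat_ball[of s] lat_radius_pos by auto

lemma P_near: "s \<in> ball 0 lat_radius \<Longrightarrow> s \<noteq> 0 \<Longrightarrow> P s = 1 / s\<^sup>2 + U s"
  unfolding P_def by (rule Y_near)

lemma eventually_near: "\<forall>\<^sub>F s in at 0. s \<in> ball 0 lat_radius \<and> s \<noteq> (0::complex)"
  using lat_radius_pos by (auto simp: eventually_at_topological intro!: exI[of _ "ball 0 lat_radius"])

lemma dP_near:
  assumes "s \<in> ball 0 lat_radius" "s \<noteq> 0"
  shows "deriv P s = - 2 / s ^ 3 + deriv U s"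
proof -
  have op: "open (ball 0 lat_radius - {0::complex})" by (intro open_delete) simp
  have "(U has_field_derivative deriv U s) (at s)" by (rule holomorphic_derivI[OF U(1)]) (use assms in auto)
  then have "((\<lambda>s. 1 / s\<^sup>2 + U s) has_field_derivative - 2 / s ^ 3 + deriv U s) (at s)"
    using assms by (auto intro!: derivative_eq_intros simp: field_simps eval_nat_numeral)
  then have "(P has_field_derivative - 2 / s ^ 3 + deriv U s) (at s)"
    by (rule has_field_derivative_transform_within_open[OF _ op]) (use assms P_near in auto)
  then show ?thesis by (rule DERIV_imp_deriv)
qed

lemma holomorphic_tendsto_0: "f holomorphic_on ball 0 lat_radius \<Longrightarrow> f \<midarrow>0\<rightarrow> f 0"
  using lat_radius_pos holomorphic_on_imp_continuous_on[of f "ball 0 lat_radius"]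
  by (simp add: continuous_on_eq_continuous_at continuous_at isCont_def)

lemma cube_rest_holomorphic_ball: "cube_rest holomorphic_on ball 0 lat_radius"
  by (rule holomorphic_on_subset[OF cube_rest_holomorphic]) (use near_not_Lat in blast)

lemma deriv_U_holomorphic: "deriv U holomorphic_on ball 0 lat_radius"
  by (rule holomorphic_deriv[OF U(1)]) simp

lemma half_not_Lat: "1/2 \<notin> Lat"
proof
  assume "1/2 \<in> Lat"
  then obtain m n :: int where mn: "1/2 = of_int m + of_int n * \<tau>" using Lat_iff by blast
  have "Re (1/2) = Re (of_int m + of_int n * \<tau>)" by (subst mn) simp
  then have "1/2 = (of_int m :: real)" using Re_tau by simp
  then have "(of_int (2 * m) :: real) = of_int 1" by simp
  then have "2 * m = 1" by (simp only: of_int_eq_iff)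
  then show False by presburger
qed

text \<open>The poles cancel, so the two sides differ by a constant. Both are odd, and comparing
  \<open>1/2\<close> with \<open>-1/2\<close> makes the constant 0.\<close>

lemma dP_cube_sum:
  assumes "s \<notin> Lat" shows "deriv P s = - 2 * cube_sum s"
proof -
  define f where "f s = deriv P s + 2 * cube_sum s" for s
  have near: "f s = deriv U s + 2 * cube_rest s" if "s \<in> ball 0 lat_radius" "s \<noteq> 0" for s
    using dP_near[OF that] cube_sum_eq[OF near_not_Lat[OF that]] by (simp add: f_def)
  have "(\<lambda>s. deriv U s + 2 * cube_rest s) \<midarrow>0\<rightarrow> deriv U 0 + 2 * cube_rest 0"
    by (intro holomorphic_tendsto_0 holomorphic_intros cube_rest_holomorphic_ball deriv_U_holomorphic)
  moreover have "\<forall>\<^sub>F s in at 0. deriv U s + 2 * cube_rest s = f s"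
    using eventually_near by eventually_elim (use near in auto)
  ultimately have lim0: "f \<midarrow>0\<rightarrow> deriv U 0 + 2 * cube_rest 0" by (rule Lim_transform_eventually)
  have per: "f (z + 1) = f z" "f (z + \<tau>) = f z" for z
    by (simp_all add: f_def dP_periodic cube_sum_plus_1 cube_sum_plus_tau)
  have "f holomorphic_on - Lat" unfolding f_def by (intro holomorphic_intros dP_holomorphic cube_sum_holomorphic)
  then obtain c where c: "\<And>z. z \<notin> Lat \<Longrightarrow> f z = c"
    using elliptic_liouville[of Lat f \<tau>] Lat_no_limit limit_Lat[of f, OF per _ lim0] Im_tau per by blast
  have "f (- (1/2)) = - f (1/2)" using dP_minus[OF half_not_Lat] by (simp add: f_def cube_sum_minus[of "1/2", simplified])
  then have "c = - c" using c half_not_Lat Lat_minus_iff[of "1/2"] by metis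
  then have "c = 0" by simp
  then show ?thesis using c[OF assms] by (simp add: f_def eq_neg_iff_add_eq_0)
qed

lemma dU_eq:
  assumes "s \<in> ball 0 lat_radius" shows "deriv U s = - 2 * cube_rest s"
proof (cases "s = 0")
  case False
  have n: "s \<notin> Lat" using near_not_Lat assms False by blast
  show ?thesis using dP_near[OF assms False] dP_cube_sum[OF n] cube_sum_eq[OF n] by simp
next
  \<comment> \<open>At 0 the identity follows by continuity from the punctured ball.\<close>
  case True
  have "(\<lambda>s. deriv U s + 2 * cube_rest s) \<midarrow>0\<rightarrow> deriv U 0 + 2 * cube_rest 0"
    by (intro holomorphic_tendsto_0 holomorphic_intros cube_rest_holomorphic_ball deriv_U_holomorphic)
  moreover have "\<forall>\<^sub>F s in at 0. deriv U s + 2 * cube_rest s = 0"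
    using eventually_near
  proof eventually_elim
    case (elim s)
    then have n: "s \<notin> Lat" using near_not_Lat by blast
    have "deriv U s = - 2 * cube_rest s" using dP_near[of s] dP_cube_sum[OF n] cube_sum_eq[OF n] elim by simp
    then show ?case by simp
  qed
  then have "(\<lambda>s. deriv U s + 2 * cube_rest s) \<midarrow>0\<rightarrow> 0" by (rule tendsto_eventually)
  ultimately have "deriv U 0 + 2 * cube_rest 0 = 0" by (rule LIM_unique)
  then show ?thesis using True by (simp add: eq_neg_iff_add_eq_0)
qed

lemma U_higher_deriv: "(deriv ^^ Suc m) U 0 = fact (m + 2) * eisenstein_G (m + 3) \<tau>"
proof -
  have "\<forall>\<^sub>F s in nhds 0. deriv U s = - 2 * cube_rest s"
    using eventually_nhds_in_open[of "ball 0 lat_radius" 0] lat_radius_pos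
    by (auto elim!: eventually_mono simp: dU_eq)
  then have "(deriv ^^ m) (deriv U) 0 = (deriv ^^ m) (\<lambda>s. - 2 * cube_rest s) 0"
    by (rule higher_deriv_cong_ev) simp
  also have "\<dots> = - 2 * (deriv ^^ m) cube_rest 0"
    by (rule higher_deriv_cmult[OF cube_rest_holomorphic_ball]) (use lat_radius_pos in auto)
  also have "\<dots> = fact (m + 2) * eisenstein_G (m + 3) \<tau>" unfolding cube_rest_deriv by simp
  finally show ?thesis by (simp only: funpow_Suc_right o_def)
qed

text \<open>The Laurent coefficients of \<open>P\<close> at the powers 2, 4 and 6 of
  \<open>s\<close>.\<close>

definition a where "a = 3 * eisenstein_G 4 \<tau>"
definition b where "b = 5 * eisenstein_G 6 \<tau>"
definition c where "c = 7 * eisenstein_G 8 \<tau>"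

lemma U_expansion:
  obtains n where "n holomorphic_on ball 0 lat_radius"
    "\<And>s. s \<in> ball 0 lat_radius \<Longrightarrow> U s = a * s^2 + b * s^4 + c * s^6 + s^8 * n s"
proof -
  obtain n where n: "n holomorphic_on ball 0 lat_radius"
    "\<And>s. s \<in> ball 0 lat_radius \<Longrightarrow> U s = (\<Sum>k<8. (deriv ^^ k) U 0 / fact k * s ^ k) + s ^ 8 * n s"
    using holomorphic_taylor_remainder[OF U(1), of 8] by blast
  have co: "(deriv ^^ Suc m) U 0 / fact (Suc m) = of_nat (m + 2) * eisenstein_G (m + 3) \<tau>" for m
    unfolding U_higher_deriv using of_nat_neq_0[of m, where 'a = complex] by (simp add: divide_simps) 
  have "(\<Sum>k<8. (deriv ^^ k) U 0 / fact k * s ^ k) = a * s^2 + b * s^4 + c * s^6" for s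
  proof -
    have "(\<Sum>k<8. (deriv ^^ k) U 0 / fact k * s ^ k)
        = U 0 + (\<Sum>m<7. (deriv ^^ Suc m) U 0 / fact (Suc m) * s ^ Suc m)"
      using sum.lessThan_Suc_shift[of "\<lambda>k. (deriv ^^ k) U 0 / fact k * s ^ k" 7] by simp
    also have "\<dots> = (\<Sum>m<7. of_nat (m + 2) * eisenstein_G (m + 3) \<tau> * s ^ Suc m)"
      unfolding co U(2) by simp
    also have "\<dots> = a * s^2 + b * s^4 + c * s^6"
    proof -
      have "{..<7::nat} = {0,1,2,3,4,5,6}" by auto
      moreover have "s * s = s^2" "s * s^3 = s^4" "s * s^5 = s^6" by (simp_all add: eval_nat_numeral)
      ultimately show ?thesis by (simp add: a_def b_def c_def eisenstein_G_odd)
    qed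
    finally show ?thesis .
  qed
  then show ?thesis using n that by simp
qed

definition g2 where "g2 = 20 * a"
definition g3 where "g3 = 28 * b"

text \<open>Near 0 the left side is \<open>s^2 * q s\<close>, so it is elliptic without poles and
  tends to 0 at 0, hence vanishes. Then \<open>q\<close> vanishes near 0 as well, and
  \<open>q 0 = 12 * a^2 - 36 * c\<close> gives the second claim.\<close>

lemma weierstrass_ode_aux:
  "s \<notin> Lat \<Longrightarrow> (deriv P s)^2 - 4 * P s ^ 3 + 20 * a * P s + 28 * b = 0" "c = a\<^sup>2 / 3"
proof -
  define \<Phi> where "\<Phi> s = (deriv P s)^2 - 4 * P s ^ 3 + 20 * a * P s + 28 * b" for s
  obtain n0 where n0: "n0 holomorphic_on ball 0 lat_radius"
    "\<And>s. s \<in> ball 0 lat_radius \<Longrightarrow> U s = a * s^2 + b * s^4 + c * s^6 + s^8 * n0 s" using U_expansion by blast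
  define n where "n s = c + s^2 * n0 s" for s
  have n: "n holomorphic_on ball 0 lat_radius" unfolding n_def using n0 by (intro holomorphic_intros)
  have Un: "U s = a * s^2 + b * s^4 + s^6 * n s" if "s \<in> ball 0 lat_radius" for s
    using n0(2)[OF that] by (simp add: n_def algebra_simps flip: power_add)
  have dn: "deriv n holomorphic_on ball 0 lat_radius" using n by (rule holomorphic_deriv) simp
  have dU: "deriv U s = 2 * a * s + 4 * b * s^3 + 6 * s^5 * n s + s^6 * deriv n s" if s: "s \<in> ball 0 lat_radius" for s
  proof (rule DERIV_imp_deriv)
    have "(n has_field_derivative deriv n s) (at s)" by (rule holomorphic_derivI[OF n]) (use s in auto)
    then have "((\<lambda>s. a * s^2 + b * s^4 + s^6 * n s) has_field_derivative 2 * a * s + 4 * b * s^3 + 6 * s^5 * n s + s^6 * deriv n s) (at s)"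
      by (auto intro!: derivative_eq_intros simp: algebra_simps)
    then show "(U has_field_derivative 2 * a * s + 4 * b * s^3 + 6 * s^5 * n s + s^6 * deriv n s) (at s)"
      by (rule has_field_derivative_transform_within_open[of _ _ _ "ball 0 lat_radius"]) (use s Un in auto)
  qed
  define q where "q s = 12 * a^2 - 36 * n s - 4 * deriv n s * s + 12 * a * b * s^2 + 20 * a * n s * s^4 - 4 * a^3 * s^4 + 4 * b^2 * s^4 + 4 * a * deriv n s * s^5 - 12 * a^2 * b * s^6 + 24 * b * n s * s^6 + 8 * b * deriv n s * s^7 - 12 * a * b^2 * s^8 - 12 * a^2 * n s * s^8 + 24 * (n s)^2 * s^8 + 12 * deriv n s * n s * s^9 - 24 * a * b * n s * s^10 - 4 * b^3 * s^10 + (deriv n s)^2 * s^10 - 12 * a * (n s)^2 * s^12 - 12 * b^2 * n s * s^12 - 12 * b * (n s)^2 * s^14 - 4 * (n s)^3 * s^16" for s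
  have near: "\<Phi> s = s^2 * q s" if s: "s \<in> ball 0 lat_radius" "s \<noteq> 0" for s
    unfolding \<Phi>_def q_def
    by (rule ode_expansion[OF s(2)])
       (simp_all add: P_near[OF s] dP_near[OF s] Un[OF s(1)] dU[OF s(1)] add.assoc)
  have tq: "q \<midarrow>0\<rightarrow> q 0"
    unfolding q_def by (intro tendsto_intros holomorphic_tendsto_0[OF n] holomorphic_tendsto_0[OF dn])
  have "(\<lambda>s. s^2 * q s) \<midarrow>0\<rightarrow> 0^2 * q 0"
    by (intro tendsto_intros tq)
  then have "(\<lambda>s. s^2 * q s) \<midarrow>0\<rightarrow> 0" by simp
  moreover have "\<forall>\<^sub>F s in at 0. s^2 * q s = \<Phi> s"
    using eventually_near by eventually_elim (use near in auto)
  ultimately have lim0: "\<Phi> \<midarrow>0\<rightarrow> 0" by (rule Lim_transform_eventually)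
  have per: "\<Phi> (z + 1) = \<Phi> z" "\<Phi> (z + \<tau>) = \<Phi> z" for z
    by (simp_all add: \<Phi>_def dP_periodic P_periodic)
  have "\<Phi> holomorphic_on - Lat" unfolding \<Phi>_def by (intro holomorphic_intros dP_holomorphic P_holomorphic)
  then obtain k where k: "\<And>z. z \<notin> Lat \<Longrightarrow> \<Phi> z = k"
    using elliptic_liouville[of Lat \<Phi> \<tau>] Lat_no_limit limit_Lat[of \<Phi>, OF per _ lim0] Im_tau per by blast
  have "\<forall>\<^sub>F s in at 0. \<Phi> s = k"
    using eventually_near by eventually_elim (use k near_not_Lat in auto)
  then have "\<Phi> \<midarrow>0\<rightarrow> k" by (rule tendsto_eventually)
  then have k0: "k = 0" using lim0 LIM_unique by blast
  then show "s \<notin> Lat \<Longrightarrow> (deriv P s)^2 - 4 * P s ^ 3 + 20 * a * P s + 28 * b = 0"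
    using k[of s] unfolding \<Phi>_def by simp
  have "\<forall>\<^sub>F s in at 0. q s = 0"
    using eventually_near
  proof eventually_elim
    case (elim s)
    then have "s^2 * q s = 0" using near[of s] k[of s] k0 near_not_Lat by auto
    then show ?case using elim by simp
  qed
  then have "q \<midarrow>0\<rightarrow> 0" by (rule tendsto_eventually)
  then have "q 0 = 0" using tq LIM_unique by blast
  then show "c = a\<^sup>2 / 3" by (simp add: q_def n_def field_simps)
qed

lemma weierstrass_ode: "s \<notin> Lat \<Longrightarrow> (deriv P s)\<^sup>2 = 4 * P s ^ 3 - g2 * P s - g3"
proof -
  assume "s \<notin> Lat"
  from weierstrass_ode_aux(1)[OF this] show ?thesis unfolding g2_def g3_def by Groebner_Basis.algebra
qed

text \<open>At a half period \<open>s\<close> and \<open>- s\<close> agree modulo the lattice,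
  whereas the derivative is odd.\<close>

lemma dP_half:
  assumes "2 * s \<in> Lat" "s \<notin> Lat" shows "deriv P s = 0"
proof -
  have "deriv P s = deriv P (- s + 2 * s)" by simp
  also have "\<dots> = deriv P (- s)" by (rule periodic_Lat[OF dP_periodic assms(1)])
  also have "\<dots> = - deriv P s" by (rule dP_minus[OF assms(2)])
  finally show ?thesis by simp
qed

lemma P_half_root:
  assumes "2 * s \<in> Lat" "s \<notin> Lat" shows "4 * P s ^ 3 - g2 * P s - g3 = 0"
  using weierstrass_ode[OF assms(2)] dP_half[OF assms] by simp

text \<open>The difference \<open>F\<close> of the two sides is elliptic. At lattice points the
  expansions give the limit 0. At the other half periods the double pole of \<open>P (2 * s)\<close>
  is compensated by the cubic, which equals \<open>(deriv P s)\<^sup>2\<close> and vanishes there to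
  order at least two. By Liouville \<open>F\<close> is constant, with value 0.\<close>

lemma duplication:
  assumes "2 * s \<notin> Lat"
  shows "P (2 * s) * (4 * P s ^ 3 - g2 * P s - g3) = (P s ^ 2 + g2 / 4)\<^sup>2 + 2 * g3 * P s"
proof -
  define F where "F s = (4 * P s ^ 3 - 20 * a * P s - 28 * b) * P (2 * s) - (P s ^ 2 + 5 * a)\<^sup>2 - 56 * b * P s" for s
  define S where "S = {s. 2 * s \<in> Lat}"
  have LatS: "Lat \<subseteq> S"
  proof
    fix s assume "s \<in> Lat"
    then have "s + s \<in> Lat" using Lat_add by blast
    then show "s \<in> S" unfolding S_def mult_2 by simp
  qed
  have noS: "\<not> z islimpt S" for z using Lat_no_limit_point[of 2 z] by (simp add: S_def)
  have per: "F (z + 1) = F z" "F (z + \<tau>) = F z" for z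
  proof -
    have "2 * (z + 1) = 2 * z + (1 + 1)" "2 * (z + \<tau>) = 2 * z + (\<tau> + \<tau>)" by simp_all
    then have "P (2 * (z + 1)) = P (2 * z)" "P (2 * (z + \<tau>)) = P (2 * z)"
      using periodic_Lat[of P "1 + 1" "2 * z"] periodic_Lat[of P "\<tau> + \<tau>" "2 * z"] P_periodic
        Lat_add[OF Lat_1 Lat_1] Lat_add[OF Lat_tau Lat_tau] by metis+
    then show "F (z + 1) = F z" "F (z + \<tau>) = F z" by (simp_all only: F_def P_periodic)
  qed
  have hol: "F holomorphic_on - S"
  proof -
    have "(P \<circ> (\<lambda>s. 2 * s)) holomorphic_on - S"
      by (rule holomorphic_on_compose_gen[OF _ P_holomorphic]) (auto simp: S_def intro!: holomorphic_intros)
    moreover have "P holomorphic_on - S" using LatS by (intro holomorphic_on_subset[OF P_holomorphic]) auto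
    ultimately show ?thesis unfolding F_def by (auto simp: o_def intro!: holomorphic_intros)
  qed
  obtain n where n: "n holomorphic_on ball 0 lat_radius"
    "\<And>s. s \<in> ball 0 lat_radius \<Longrightarrow> U s = a * s^2 + b * s^4 + c * s^6 + s^8 * n s" using U_expansion by blast
  have lim0: "F \<midarrow>0\<rightarrow> 0"
  proof -
    \<comment> \<open>The remainder at the doubled argument is \<open>(2 * s)^8 * n (2 * s)\<close>:
      256 is \<open>2^8\<close>, and the 4 compensates the \<open>Z / 4\<close> in
      \<open>dup_expansion\<close>.\<close>
    define m where "m s = 4 * (256 * n (2 * s))" for s
    define X where "X s = b + a^2/3 * s^2 + s^4 * n s" for s
    define Z where "Z s = 64 * b + 256 * a^2/3 * s^2 + s^4 * m s" for s
    define q where "q s = 4 * m s - 4 * n s + (68 * X s * a - 8 * Z s * a - 672 * a * b + 12 * X s * Z s * s^2 - 224 * X s * b * s^2 - 12 * (X s)^2 * s^2 - 28 * Z s * b * s^2 - 180 * a^3 * s^2 - 52 * X s * a^2 * s^4 - 8 * Z s * a^2 * s^4 + 4 * X s * Z s * a * s^6 + 116 * (X s)^2 * a * s^6 + 60 * a^4 * s^6 + 176 * X s * a^3 * s^8 + 12 * (X s)^2 * Z s * s^8 - 12 * (X s)^3 * s^8 + 4 * Z s * a^3 * s^8 + 12 * X s * Z s * a^2 * s^10 + 168 * (X s)^2 * a^2 * s^10 + 12 * (X s)^2 * Z s * a * s^12 + 48 * (X s)^3 * a * s^12 + 4 * (X s)^3 * Z s * s^14 - 4 * (X s)^4 * s^14)"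 for s
    have near: "4 * F s = s^2 * q s" if s: "2 * s \<in> ball 0 lat_radius" "s \<noteq> 0" for s
    proof -
      have "2 * norm s < lat_radius" using s(1) by (simp add: norm_mult)
      then have "norm s < lat_radius" using norm_ge_zero[of s] by linarith
      then have s1: "s \<in> ball 0 lat_radius" by simp
      have 1: "P s = 1/s^2 + a * s^2 + s^4 * X s"
        using P_near[OF s1 s(2)] n(2)[OF s1] by (simp add: X_def weierstrass_ode_aux(2) algebra_simps flip: power_add)
      have 2: "P (2 * s) = 1/(2 * s)^2 + 4 * a * s^2 + s^4 * Z s / 4"
        using P_near[OF s(1)] n(2)[OF s(1)] s(2)
        by (simp add: Z_def m_def weierstrass_ode_aux(2) power_mult_distrib algebra_simps flip: power_add)
      show ?thesis unfolding F_def q_def by (rule dup_expansion[OF s(2) 1 2]) (simp_all add: X_def Z_def)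
    qed
    define D where "D = ball (0::complex) (lat_radius / 2)"
    have D: "D \<subseteq> ball 0 lat_radius" "\<And>s. s \<in> D \<Longrightarrow> 2 * s \<in> ball 0 lat_radius" "open D" "0 \<in> D"
      using lat_radius_pos by (auto simp: D_def norm_mult)
    have "(n \<circ> (\<lambda>s. 2 * s)) holomorphic_on D"
      by (rule holomorphic_on_compose_gen[OF _ n(1)]) (use D(2) in \<open>auto intro!: holomorphic_intros\<close>)
    then have "m holomorphic_on D" unfolding m_def by (auto simp: o_def intro!: holomorphic_intros)
    moreover have "n holomorphic_on D" using n(1) D(1) holomorphic_on_subset by blast
    ultimately have "isCont m 0" "isCont n 0"
      using D holomorphic_on_imp_continuous_on continuous_on_eq_continuous_at by blast+
    then have tm: "m \<midarrow>0\<rightarrow> m 0" and tn: "n \<midarrow>0\<rightarrow> n 0" by (simp_all add: isCont_def)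
    have tX: "X \<midarrow>0\<rightarrow> X 0" unfolding X_def by (intro tendsto_intros tn) simp
    have tZ: "Z \<midarrow>0\<rightarrow> Z 0" unfolding Z_def by (intro tendsto_intros tm) simp
    have "q \<midarrow>0\<rightarrow> q 0" unfolding q_def by (intro tendsto_intros tm tn tX tZ)
    then have "(\<lambda>s. s^2 * q s / 4) \<midarrow>0\<rightarrow> 0^2 * q 0 / 4" by (intro tendsto_intros) simp_all
    moreover have "\<forall>\<^sub>F s in at 0. s^2 * q s / 4 = F s"
    proof -
      have "\<forall>\<^sub>F s in at 0. s \<in> D \<and> s \<noteq> 0" using D(3,4) by (auto simp: eventually_at_topological)
      then show ?thesis
      proof eventually_elim
        case (elim s)
        then show ?case using near[of s] D(2)[of s] by (metis nonzero_mult_div_cancel_left zero_neq_numeral)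
      qed
    qed
    ultimately show ?thesis by (simp add: Lim_transform_eventually)
  qed
  have lim: "\<exists>l. F \<midarrow>p\<rightarrow> l" if p: "p \<in> S" for p
  proof (cases "p \<in> Lat")
    case True
    then show ?thesis using limit_Lat[of F, OF per True lim0] by blast
  next
    case False
    have contP: "isCont P p" "isCont (deriv P) p"
      using False holomorphic_on_imp_continuous_on[OF P_holomorphic] holomorphic_on_imp_continuous_on[OF dP_holomorphic]
      unfolding continuous_on_eq_continuous_at[OF Lat_open] by simp_all
    have dd: "(deriv P has_field_derivative deriv (deriv P) p) (at p)"
      by (rule holomorphic_derivI[OF dP_holomorphic Lat_open]) (use False in auto)
    have dp0: "deriv P p = 0" using dP_half p False by (simp add: S_def)
    have quot: "(\<lambda>s. deriv P s / (s - p)) \<midarrow>p\<rightarrow> deriv (deriv P) p"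
      using dd dp0 unfolding has_field_derivative_iff by simp
    have Ulim: "(\<lambda>s. U (2 * (s - p))) \<midarrow>p\<rightarrow> U 0"
    proof -
      have "((\<lambda>s. 2 * (s - p)) \<longlongrightarrow> 2 * (p - p)) (at p)" by (intro tendsto_intros)
      moreover have "isCont U (2 * (p - p))" using holomorphic_tendsto_0[OF U(1)] by (simp add: isCont_def)
      ultimately show ?thesis using isCont_tendsto_compose[of "2 * (p - p)" U "\<lambda>s. 2 * (s - p)" "at p"] by simp
    qed
    have ev: "\<forall>\<^sub>F s in at p. 2 * (s - p) \<in> ball 0 lat_radius \<and> s \<noteq> p \<and> s \<notin> Lat"
    proof -
      have "open (ball p (lat_radius / 2) \<inter> - Lat)" using Lat_open by auto
      moreover have "p \<in> ball p (lat_radius / 2) \<inter> - Lat" using False lat_radius_pos by auto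
      ultimately have "\<forall>\<^sub>F s in at p. s \<in> ball p (lat_radius / 2) \<inter> - Lat \<and> s \<noteq> p"
        by (auto simp: eventually_at_topological)
      then show ?thesis
      proof eventually_elim
        case (elim s)
        have "norm (2 * (s - p)) = norm (2::complex) * norm (s - p)" by (rule norm_mult)
        also have "\<dots> < lat_radius" using elim by (simp add: dist_norm norm_minus_commute)
        finally have "norm (2 * (s - p)) < lat_radius" .
        then show ?case using elim by (metis IntD2 ComplD dist_0_norm mem_ball)
      qed
    qed
    \<comment> \<open>\<open>R\<close> is \<open>F\<close> near \<open>p\<close>, with the pole of
      \<open>P (2 * s) = P (2 * (s - p))\<close> absorbed into the difference quotient of
      \<open>deriv P\<close>.\<close>
    define R where "R s = (deriv P s / (s - p))\<^sup>2 / 4 + (deriv P s)\<^sup>2 * U (2 * (s - p)) - (P s ^ 2 + 5 * a)\<^sup>2 - 56 * b * P s" for s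
    have "\<forall>\<^sub>F s in at p. R s = F s"
      using ev
    proof eventually_elim
      case (elim s)
      have "P (2 * s) = P (2 * (s - p) + 2 * p)" by (simp add: algebra_simps)
      also have "\<dots> = P (2 * (s - p))" using p by (intro periodic_Lat[OF P_periodic(1,2)]) (simp add: S_def)
      also have "\<dots> = 1 / (2 * (s - p))\<^sup>2 + U (2 * (s - p))" using elim by (intro P_near) auto
      finally have P2: "P (2 * s) = 1 / (2 * (s - p))\<^sup>2 + U (2 * (s - p))" .
      have ode: "4 * P s ^ 3 - 20 * a * P s - 28 * b = (deriv P s)\<^sup>2"
        using weierstrass_ode_aux(1)[of s] elim by (simp add: algebra_simps)
      have sq: "(2 * (s - p))\<^sup>2 = 4 * (s - p)\<^sup>2" by (simp only: power_mult_distrib) simp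
      show ?case unfolding R_def F_def ode P2 sq
        by (simp add: distrib_left power_divide mult.commute)
    qed
    moreover have "R \<midarrow>p\<rightarrow> (deriv (deriv P) p)\<^sup>2 / 4 + (deriv P p)\<^sup>2 * U 0 - (P p ^ 2 + 5 * a)\<^sup>2 - 56 * b * P p"
      unfolding R_def using contP by (intro tendsto_intros quot Ulim) (auto simp: isCont_def)
    ultimately show ?thesis using Lim_transform_eventually by blast
  qed
  obtain k where k: "\<And>z. z \<notin> S \<Longrightarrow> F z = k"
    using elliptic_liouville[OF noS hol lim Im_tau per] by blast
  have "\<forall>\<^sub>F s in at 0. F s = k"
    using noS[of 0] k by (auto simp: islimpt_iff_eventually elim!: eventually_mono)
  then have "F \<midarrow>0\<rightarrow> k" by (rule tendsto_eventually)
  then have "k = 0" using lim0 LIM_unique by blast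
  then have "F s = 0" using k assms by (simp add: S_def)
  then show ?thesis unfolding F_def g2_def g3_def by (simp add: algebra_simps)
qed

end

section \<open>Torsion points\<close>

text \<open>The value \<open>c\<close> may be 0, so terms of lower order can be added without
  comparing degrees.\<close>

definition top_coeff :: "'a::comm_ring_1 poly \<Rightarrow> nat \<Rightarrow> 'a \<Rightarrow> bool" where
  "top_coeff p m c \<longleftrightarrow> Polynomial.degree p \<le> m \<and> poly.coeff p m = c"

lemma top_coeff_mult:
  assumes "top_coeff p m c" "top_coeff r n d" shows "top_coeff (p * r) (m + n) (c * d)"
proof -
  have "poly.coeff (p * r) (m + n) = (\<Sum>i\<le>m + n. poly.coeff p i * poly.coeff r (m + n - i))"
    by (rule coeff_mult)
  also have "\<dots> = (\<Sum>i\<in>{m}. poly.coeff p i * poly.coeff r (m + n - i))"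
  proof (rule sum.mono_neutral_right)
    show "\<forall>i\<in>{..m + n} - {m}. poly.coeff p i * poly.coeff r (m + n - i) = 0"
    proof
      fix i assume "i \<in> {..m + n} - {m}"
      then have "i > m \<or> m + n - i > n" by auto
      then show "poly.coeff p i * poly.coeff r (m + n - i) = 0"
        using assms unfolding top_coeff_def by (auto simp: coeff_eq_0)
    qed
  qed auto
  finally show ?thesis
    using assms degree_mult_le[of p r] unfolding top_coeff_def by auto
qed

lemma top_coeff_add: "top_coeff p m c \<Longrightarrow> top_coeff r m d \<Longrightarrow> top_coeff (p + r) m (c + d)"
  unfolding top_coeff_def by (auto intro: degree_add_le)

lemma top_coeff_diff: "top_coeff p m c \<Longrightarrow> top_coeff r m d \<Longrightarrow> top_coeff (p - r) m (c - d)"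
  unfolding top_coeff_def by (auto intro: degree_diff_le)

lemma top_coeff_smult: "top_coeff p m c \<Longrightarrow> top_coeff (Polynomial.smult k p) m (k * c)"
  unfolding top_coeff_def using degree_smult_le order_trans by fastforce

lemma top_coeff_raise: "top_coeff p m c \<Longrightarrow> m < n \<Longrightarrow> top_coeff p n 0"
  unfolding top_coeff_def by (auto simp: coeff_eq_0)

lemma top_coeff_power: "top_coeff p m c \<Longrightarrow> top_coeff (p ^ k) (k * m) (c ^ k)"
proof (induction k)
  case 0
  then show ?case by (simp add: top_coeff_def)
next
  case (Suc k)
  then show ?case using top_coeff_mult[of p m c "p ^ k" "k * m" "c ^ k"] by simp
qed

text \<open>Numerator and denominator of the iterates of the duplication map
  \<open>x \<mapsto> ((x\<^sup>2 + h\<^sub>2/4)\<^sup>2 + 2 h\<^sub>3 x) / (4 x\<^sup>3 - h\<^sub>2 x - h\<^sub>3)\<close>.\<close>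
fun dup_poly :: "complex \<Rightarrow> complex \<Rightarrow> nat \<Rightarrow> complex poly \<times> complex poly" where
  "dup_poly h2 h3 0 = ([:0, 1:], 1)"
| "dup_poly h2 h3 (Suc k) = (let (N, D) = dup_poly h2 h3 k in
     ((N ^ 2 + Polynomial.smult (h2 / 4) (D ^ 2)) ^ 2 + Polynomial.smult (2 * h3) (N * D ^ 3),
      D * (Polynomial.smult 4 (N ^ 3) - Polynomial.smult h2 (N * D ^ 2) - Polynomial.smult h3 (D ^ 3))))"

text \<open>Near the pole \<open>P (m * s)\<close> behaves like \<open>P s / m\<^sup>2\<close>; for
  \<open>m = 2 ^ k\<close> this accounts for the ratio \<open>4 ^ k\<close> of the leading
  coefficients. The distinct leading coefficients will show that torsion relations are
  nontrivial.\<close>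

lemma dup_poly_top:
  "top_coeff (fst (dup_poly h2 h3 k)) (4 ^ k) 1 \<and> top_coeff (snd (dup_poly h2 h3 k)) (4 ^ k - 1) (4 ^ k)"
proof (induction k)
  case 0
  then show ?case by (simp add: top_coeff_def)
next
  case (Suc k)
  obtain N D where ND: "dup_poly h2 h3 k = (N, D)" by (cases "dup_poly h2 h3 k")
  define d :: nat where "d = 4 ^ k"
  define e :: complex where "e = 4 ^ k"
  have d: "d \<ge> 1" by (simp add: d_def)
  have N: "top_coeff N d 1" and D: "top_coeff D (d - 1) e"
    using Suc ND by (simp_all add: d_def e_def)
  have N2: "top_coeff (N ^ 2) (2 * d) 1" and N3: "top_coeff (N ^ 3) (3 * d) 1"
    using top_coeff_power[OF N, of 2] top_coeff_power[OF N, of 3] by simp_all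
  have D2: "top_coeff (D ^ 2) (2 * d) 0" and D2': "top_coeff (D ^ 2) (2 * (d - 1)) (e ^ 2)"
    using top_coeff_power[OF D, of 2] top_coeff_raise[OF top_coeff_power[OF D, of 2], of "2 * d"] d by simp_all
  have D3: "top_coeff (D ^ 3) (3 * d) 0" and D3': "top_coeff (D ^ 3) (3 * (d - 1)) (e ^ 3)"
    using top_coeff_power[OF D, of 3] top_coeff_raise[OF top_coeff_power[OF D, of 3], of "3 * d"] d by simp_all
  have 1: "top_coeff ((N ^ 2 + Polynomial.smult (h2 / 4) (D ^ 2)) ^ 2) (4 * d) 1"
    using top_coeff_power[OF top_coeff_add[OF N2 top_coeff_smult[OF D2, of "h2 / 4"]], of 2] by simp
  have 2: "top_coeff (N * D ^ 3) (4 * d) 0"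
    using top_coeff_raise[OF top_coeff_mult[OF N D3'], of "4 * d"] d by simp
  have 3: "top_coeff (N * D ^ 2) (3 * d) 0"
    using top_coeff_raise[OF top_coeff_mult[OF N D2'], of "3 * d"] d by simp
  have num: "top_coeff ((N ^ 2 + Polynomial.smult (h2 / 4) (D ^ 2)) ^ 2 + Polynomial.smult (2 * h3) (N * D ^ 3)) (4 * d) 1"
    using top_coeff_add[OF 1 top_coeff_smult[OF 2, of "2 * h3"]] by simp
  have "top_coeff (Polynomial.smult 4 (N ^ 3) - Polynomial.smult h2 (N * D ^ 2) - Polynomial.smult h3 (D ^ 3)) (3 * d) 4"
    using top_coeff_diff[OF top_coeff_diff[OF top_coeff_smult[OF N3, of 4] top_coeff_smult[OF 3, of h2]] top_coeff_smult[OF D3, of h3]] by simp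
  from top_coeff_mult[OF D this]
  have den: "top_coeff (D * (Polynomial.smult 4 (N ^ 3) - Polynomial.smult h2 (N * D ^ 2) - Polynomial.smult h3 (D ^ 3))) (4 * d - 1) (4 * e)"
    using d by (simp add: mult.commute)
  show ?case using num den by (simp add: ND d_def e_def)
qed

lemma (in complex_subfield) dup_poly_coeff:
  assumes "h2 \<in> K" "h3 \<in> K"
  shows "(\<forall>i. poly.coeff (fst (dup_poly h2 h3 k)) i \<in> K) \<and> (\<forall>i. poly.coeff (snd (dup_poly h2 h3 k)) i \<in> K)"
proof (induction k)
  case 0
  then show ?case using coeff_1 by (auto simp: coeff_pCons zero one split: nat.split)
next
  case (Suc k)
  obtain N D where ND: "dup_poly h2 h3 k = (N, D)" by (cases "dup_poly h2 h3 k")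
  have N: "\<forall>i. poly.coeff N i \<in> K" and D: "\<forall>i. poly.coeff D i \<in> K" using Suc ND by auto
  have h: "h2 / 4 \<in> K" "2 * h3 \<in> K" "4 \<in> K" using assms divide mult numeral by auto
  show ?case
    unfolding dup_poly.simps ND Let_def prod.case fst_conv snd_conv
    by (intro conjI coeff_add coeff_mult coeff_diff coeff_smult coeff_power N D h assms)
qed

section \<open>Values of \<open>Y\<close> at the half periods\<close>

context imaginary_tau
begin

lemma real_in_Lat:
  assumes "of_real x + of_real y * \<tau> \<in> Lat" shows "x \<in> \<int> \<and> y \<in> \<int>"
proof -
  obtain k l :: int where kl: "of_real x + of_real y * \<tau> = of_int k + of_int l * \<tau>" using assms Lat_iff by blast
  have "Re (of_real x + of_real y * \<tau>) = of_int k" "Im (of_real x + of_real y * \<tau>) = of_int l * Im \<tau>"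
    unfolding kl using Re_tau by simp_all
  then have "x = of_int k" "y = of_int l" using Re_tau Im_tau by simp_all
  then show ?thesis by simp
qed

lemma half_not_int: "(1/2 :: real) \<notin> \<int>"
proof
  assume "(1/2 :: real) \<in> \<int>"
  then obtain k :: int where "1/2 = real_of_int k" by (elim Ints_cases)
  then have "real_of_int (2 * k) = real_of_int 1" by simp
  then have "2 * k = 1" by (simp only: of_int_eq_iff)
  then show False by presburger
qed

lemma half_periods_not_Lat: "1/2 \<notin> Lat" "\<tau>/2 \<notin> Lat" "(1 + \<tau>)/2 \<notin> Lat"
  using real_in_Lat[of "1/2" 0] real_in_Lat[of 0 "1/2"] real_in_Lat[of "1/2" "1/2"] half_not_int
  by (auto simp: add_divide_distrib)

text \<open>Negating a half period and translating back by \<open>\<tau>\<close>, with a further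
  shift by 1 in the second case, exchanges \<open>th2\<close> and \<open>th3\<close>. This forces
  the multiplier to satisfy \<open>e^2 = -1\<close> or \<open>e^2 = 1\<close>, so the squares of
  \<open>th2\<close> and \<open>th3\<close> are opposite or equal.\<close>

lemma Y_half_tau: "Y (\<tau>/2) = - 2" "Y ((1 + \<tau>)/2) = 2"
proof -
  obtain e where e: "th2 (- (\<tau>/2) + \<tau>) = e * th3 (- (\<tau>/2))" "th3 (- (\<tau>/2) + \<tau>) = e * th2 (- (\<tau>/2))"
    using th_shift_tau by blast
  have x: "th2 (\<tau>/2) = e * th3 (\<tau>/2)" "th3 (\<tau>/2) = - e * th2 (\<tau>/2)"
    using e unfolding th_minus by (simp_all add: field_simps)
  have nz: "th2 (\<tau>/2) \<noteq> 0" "th3 (\<tau>/2) \<noteq> 0" using th_zero_iff half_periods_not_Lat(2) by (metis mult_eq_0_iff)+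
  have "th2 (\<tau>/2) * (1 + e^2) = th2 (\<tau>/2) - e * (- e * th2 (\<tau>/2))" by (simp add: power2_eq_square algebra_simps)
  also have "\<dots> = 0" unfolding x(2)[symmetric] using x(1) by simp
  finally have "th2 (\<tau>/2) * (1 + e^2) = 0" .
  then have "e^2 = -1" using nz by (simp add: add_eq_0_iff)
  then have "(th2 (\<tau>/2))^2 = - ((th3 (\<tau>/2))^2)" using x(1) by (simp add: power_mult_distrib)
  then have sq: "(th2 (\<tau>/2))^2 = - ((th3 (\<tau>/2))^2)" .
  have "th2 (\<tau>/2) ^ 4 + th3 (\<tau>/2) ^ 4 = ((th2 (\<tau>/2))^2)^2 + ((th3 (\<tau>/2))^2)^2" by (simp flip: power_mult)
  also have "\<dots> = - 2 * ((th2 (\<tau>/2))^2 * (th3 (\<tau>/2))^2)" unfolding sq by (simp add: power2_eq_square)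
  also have "\<dots> = - 2 * (th2 (\<tau>/2) * th3 (\<tau>/2))^2" by (simp add: power_mult_distrib)
  finally show "Y (\<tau>/2) = - 2" using nz by (simp add: Y_def)
next
  let ?h = "(1 + \<tau>)/2"
  obtain e where e: "th2 ((1 - \<tau>)/2 + \<tau>) = e * th3 ((1 - \<tau>)/2)" "th3 ((1 - \<tau>)/2 + \<tau>) = e * th2 ((1 - \<tau>)/2)"
    using th_shift_tau by blast
  have h: "(1 - \<tau>)/2 + \<tau> = ?h" "(1 - \<tau>)/2 = - ?h + 1" by (simp_all add: field_simps)
  have x: "th2 ?h = e * th3 ?h" "th3 ?h = e * th2 ?h"
    using e unfolding h(1) unfolding h(2) th_shift_1 th_minus by simp_all
  have nz: "th2 ?h \<noteq> 0" "th3 ?h \<noteq> 0" using th_zero_iff half_periods_not_Lat(3) by (metis mult_eq_0_iff)+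
  have "t * (1 - e^2) = t - e * (e * t)" for t by (simp add: power2_eq_square algebra_simps)
  then have "th2 ?h * (1 - e^2) = th2 ?h - e * (e * th2 ?h)" .
  also have "\<dots> = 0" unfolding x(2)[symmetric] using x(1) by simp
  finally have "th2 ?h * (1 - e^2) = 0" .
  then have "e^2 = 1" using nz by simp
  then have "(th2 ?h)^2 = (th3 ?h)^2" using x(1) by (simp add: power_mult_distrib)
  then have sq: "(th2 ?h)^2 = (th3 ?h)^2" .
  have "th2 ?h ^ 4 + th3 ?h ^ 4 = ((th2 ?h)^2)^2 + ((th3 ?h)^2)^2" by (simp flip: power_mult)
  also have "\<dots> = 2 * ((th2 ?h)^2 * (th3 ?h)^2)" unfolding sq by (simp add: power2_eq_square)
  also have "\<dots> = 2 * (th2 ?h * th3 ?h)^2" by (simp add: power_mult_distrib)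
  finally show "Y ?h = 2" using nz by (simp add: Y_def)
qed

text \<open>Here \<open>v = pi\<close>, and the theta quotient is a real \<open>r\<close> with
  absolute value below 1, whereas the values 2 and -2 would need \<open>r^2 = 1\<close> and
  \<open>r^2 = -1\<close>. Hence the third half-period value differs from the other two.\<close>

lemma Y_half: "Y (1/2) \<noteq> 2" "Y (1/2) \<noteq> - 2"
proof -
  obtain r where r: "theta2 (of_real pi) \<tau> / theta3 (of_real pi) \<tau> = of_real r" "\<bar>r\<bar> < 1"
    using theta_ratio_real[of pi] by blast
  have pp: "of_real pi / 2 + of_real pi * (1 / 2) = (of_real pi :: complex)" by simp
  define x y where "x = th2 (1/2)" and "y = th3 (1/2)"
  have xy: "x / y = of_real r" using r(1) unfolding x_def y_def th2_def th3_def pp .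
  have nz: "x \<noteq> 0" "y \<noteq> 0" unfolding x_def y_def using th_zero_iff half_periods_not_Lat(1) by (metis mult_eq_0_iff)+
  have xr: "x = of_real r * y" using xy nz by (simp add: field_simps)
  have r0: "r \<noteq> 0" using xr nz by auto
  have r1: "r^2 \<noteq> 1" using r(2) by (metis abs_square_less_1 less_irrefl)
  have Y: "Y (1/2) = (of_real r ^ 4 + 1) / of_real r ^ 2"
  proof -
    have num: "(of_real r * y) ^ 4 + y ^ 4 = (of_real r ^ 4 + 1) * y ^ 4"
      by (simp add: power_mult_distrib distrib_right)
    have den: "(of_real r * y * y) ^ 2 = of_real r ^ 2 * y ^ 4"
      by (simp add: power_mult_distrib mult.assoc flip: power_add)
    have "Y (1/2) = ((of_real r ^ 4 + 1) * y ^ 4) / (of_real r ^ 2 * y ^ 4)"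
      unfolding Y_def x_def[symmetric] y_def[symmetric] xr num den ..
    then show ?thesis using nz by simp
  qed
  have "of_real r ^ 4 + 1 \<noteq> (2 * of_real r ^ 2 :: complex)"
  proof
    assume "of_real r ^ 4 + 1 = (2 * of_real r ^ 2 :: complex)"
    then have "(of_real (r ^ 4 + 1) :: complex) = of_real (2 * r ^ 2)" by simp
    then have "r ^ 4 + 1 = 2 * r ^ 2" by (simp only: of_real_eq_iff)
    then have "(r^2 - 1)^2 = 0" by (simp add: power2_eq_square algebra_simps eval_nat_numeral)
    then show False using r1 by simp
  qed
  then show "Y (1/2) \<noteq> 2" unfolding Y using r0 by (simp add: divide_eq_eq)
  have "of_real r ^ 4 + 1 \<noteq> (- 2 * of_real r ^ 2 :: complex)"
  proof
    assume "of_real r ^ 4 + 1 = (- 2 * of_real r ^ 2 :: complex)"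
    then have "(of_real (r ^ 4 + 1) :: complex) = of_real (- 2 * r ^ 2)" by simp
    then have "r ^ 4 + 1 = - 2 * r ^ 2" by (simp only: of_real_eq_iff)
    moreover have "r ^ 4 \<ge> 0" "r ^ 2 \<ge> 0" by simp_all
    ultimately show False by linarith
  qed
  then show "Y (1/2) \<noteq> - 2" unfolding Y using r0 by (simp add: divide_eq_eq)
qed

lemma Lat_of_nat: "s \<in> Lat \<Longrightarrow> of_nat m * s \<in> Lat"
  by (induction m) (auto simp: ring_distribs intro: Lat_add Lat_0)

end

context weierstrass
begin

text \<open>Dividing by \<open>\<delta>\<close>, \<open>\<delta>^2\<close>,
  \<open>\<delta>^3\<close> matches the weights of \<open>P\<close>, \<open>g2\<close>,
  \<open>g3\<close>, so that \<open>\<delta>^4\<close> cancels from the duplication formula. The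
  cross-multiplied form makes no claim about the denominator.\<close>

lemma dup_poly_eval:
  assumes \<delta>: "\<delta> \<noteq> 0" and s: "\<And>j. j \<le> k \<Longrightarrow> of_nat (2 ^ j) * s \<notin> Lat"
  shows "poly (fst (dup_poly (g2 / \<delta>^2) (g3 / \<delta>^3) k)) (P s / \<delta>)
       = P (of_nat (2 ^ k) * s) / \<delta> * poly (snd (dup_poly (g2 / \<delta>^2) (g3 / \<delta>^3) k)) (P s / \<delta>)"
  using s
proof (induction k)
  case 0
  then show ?case by simp
next
  case (Suc k)
  define N D where "N = fst (dup_poly (g2 / \<delta>^2) (g3 / \<delta>^3) k)" and "D = snd (dup_poly (g2 / \<delta>^2) (g3 / \<delta>^3) k)"
  define h2 h3 where "h2 = g2 / \<delta>^2" and "h3 = g3 / \<delta>^3"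
  define w where "w = of_nat (2 ^ k) * s"
  define n d y where "n = poly N (P s / \<delta>)" and "d = poly D (P s / \<delta>)" and "y = P w / \<delta>"
  have IH: "n = y * d" using Suc unfolding n_def d_def y_def w_def N_def D_def by simp
  have w2: "of_nat (2 ^ Suc k) * s = 2 * w" by (simp add: w_def)
  have "2 * w \<notin> Lat" using Suc.prems[of "Suc k"] unfolding w2 by blast
  note dup = duplication[OF this]
  have gs: "g2 = h2 * \<delta>^2" "g3 = h3 * \<delta>^3" using \<delta> by (simp_all add: h2_def h3_def)
  have y: "P w = y * \<delta>" using \<delta> by (simp add: y_def)
  define z where "z = P (2 * w) / \<delta>"
  have z: "P (2 * w) = z * \<delta>" using \<delta> by (simp add: z_def)
  have "\<delta>^4 * (z * (4 * y^3 - h2 * y - h3)) = P (2 * w) * (4 * P w ^ 3 - g2 * P w - g3)"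
    unfolding y z gs by (simp add: algebra_simps power_mult_distrib eval_nat_numeral)
  also have "\<dots> = \<delta>^4 * ((y^2 + h2/4)^2 + 2 * h3 * y)"
    unfolding dup unfolding y gs by (simp add: algebra_simps power_mult_distrib eval_nat_numeral)
  finally have D1: "z * (4 * y^3 - h2 * y - h3) = (y^2 + h2/4)^2 + 2 * h3 * y" using \<delta> by simp
  have ND: "dup_poly h2 h3 k = (N, D)" by (simp add: N_def D_def h2_def h3_def)
  have "(n^2 + h2/4 * d^2)^2 + 2 * h3 * (n * d^3) = d^4 * ((y^2 + h2/4)^2 + 2 * h3 * y)"
    unfolding IH by (simp add: algebra_simps power_mult_distrib eval_nat_numeral)
  also have "\<dots> = z * (d * (4 * n^3 - h2 * (n * d^2) - h3 * d^3))"
    unfolding D1[symmetric] IH by (simp add: algebra_simps power_mult_distrib eval_nat_numeral)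
  finally show ?case
    unfolding w2 h2_def[symmetric] h3_def[symmetric] z_def[symmetric]
    by (simp add: ND flip: n_def d_def)
qed

lemma torsion_algebraic:
  assumes K: "complex_subfield K" and \<delta>: "\<delta> \<noteq> 0" "g2 / \<delta>^2 \<in> K" "g3 / \<delta>^3 \<in> K"
    and s: "s \<notin> Lat" "N \<ge> (1::nat)" "of_nat N * s \<in> Lat"
  shows "P s / \<delta> \<in> algebraic_over K"
proof -
  interpret K: complex_subfield K by (rule K)
  define A where "A k = fst (dup_poly (g2 / \<delta>^2) (g3 / \<delta>^3) k)" for k
  define D where "D k = snd (dup_poly (g2 / \<delta>^2) (g3 / \<delta>^3) k)" for k
  have AK: "\<forall>i. poly.coeff (A k) i \<in> K" and DK: "\<forall>i. poly.coeff (D k) i \<in> K" for k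
    using K.dup_poly_coeff[OF \<delta>(2,3), of k] by (simp_all add: A_def D_def)
  have At: "top_coeff (A k) (4 ^ k) 1" and Dt: "top_coeff (D k) (4 ^ k - 1) (4 ^ k)" for k
    using dup_poly_top[of "g2 / \<delta>^2" "g3 / \<delta>^3" k] by (simp_all add: A_def D_def)
  show ?thesis
  proof (cases "\<exists>k. of_nat (2 ^ k) * s \<in> Lat")
    \<comment> \<open>The last iterate off the lattice is a half period, whose abscissa is a root of
      the cubic; so the denominator of the next iterate vanishes at the abscissa of
      \<open>s\<close>.\<close>
    case True
    define k where "k = (LEAST k. of_nat (2 ^ k) * s \<in> Lat)"
    have k: "of_nat (2 ^ k) * s \<in> Lat" unfolding k_def using True by (rule LeastI_ex)
    have less: "of_nat (2 ^ j) * s \<notin> Lat" if "j < k" for j using not_less_Least that unfolding k_def by blast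
    have "k \<noteq> 0" using k s(1) by (metis mult_1 of_nat_1 power_0)
    then obtain l where l: "k = Suc l" by (cases k) auto
    define w where "w = of_nat (2 ^ l) * s"
    have w2: "of_nat (2 ^ k) * s = 2 * w" by (simp add: w_def l)
    have w: "w \<notin> Lat" "2 * w \<in> Lat" using less[of l] k unfolding w2 by (simp_all add: w_def l)
    have root: "4 * P w ^ 3 - g2 * P w - g3 = 0" by (rule P_half_root[OF w(2,1)])
    define n d y where "n = poly (A l) (P s / \<delta>)" and "d = poly (D l) (P s / \<delta>)" and "y = P w / \<delta>"
    have nd: "n = y * d" using dup_poly_eval[OF \<delta>(1), of l s] less l
      unfolding n_def d_def y_def w_def A_def D_def by (simp add: less_Suc_eq_le)
    define h2 h3 where "h2 = g2 / \<delta>^2" and "h3 = g3 / \<delta>^3"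
    have gs: "g2 = h2 * \<delta>^2" "g3 = h3 * \<delta>^3" using \<delta> by (simp_all add: h2_def h3_def)
    have y: "P w = y * \<delta>" using \<delta> by (simp add: y_def)
    have "\<delta>^3 * (4 * y^3 - h2 * y - h3) = 4 * P w ^ 3 - g2 * P w - g3" unfolding y gs by (simp add: algebra_simps power_mult_distrib eval_nat_numeral)
    then have r: "4 * y^3 - h2 * y - h3 = 0" using \<delta> root by simp
    have AD: "dup_poly h2 h3 l = (A l, D l)" by (simp add: A_def D_def h2_def h3_def)
    have "d * (4 * n^3 - h2 * (n * d^2) - h3 * d^3) = d^4 * (4 * y^3 - h2 * y - h3)" unfolding nd by (simp add: algebra_simps power_mult_distrib eval_nat_numeral)
    then have "d * (4 * n^3 - h2 * (n * d^2) - h3 * d^3) = 0" unfolding r by simp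
    then have "poly (D (Suc l)) (P s / \<delta>) = 0"
      unfolding D_def h2_def[symmetric] h3_def[symmetric] by (simp add: AD flip: n_def d_def)
    moreover have "D (Suc l) \<noteq> 0" using Dt[of "Suc l"] by (auto simp: top_coeff_def)
    ultimately show ?thesis unfolding algebraic_over_def using DK by blast
  next
    \<comment> \<open>By pigeonhole two powers of 2 agree modulo \<open>N\<close>; the corresponding
      iterates differ by a lattice point and share their abscissa.\<close>
    case False
    have "finite (range (\<lambda>k::nat. (2::nat) ^ k mod N))"
      by (rule finite_subset[of _ "{..<N}"]) (use s(2) in auto)
    then have "\<not> inj (\<lambda>k::nat. (2::nat) ^ k mod N)" using finite_imageD by blast
    then obtain i j where ij: "i < j" "(2::nat) ^ i mod N = 2 ^ j mod N"
      unfolding inj_def by (metis linorder_neqE_nat)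
    have "(2::nat) ^ i \<le> 2 ^ j" using ij by (intro power_increasing) auto
    then have "N dvd 2 ^ j - 2 ^ i" using ij(2) mod_eq_dvd_iff_nat by metis
    then obtain m where m: "2 ^ j - 2 ^ i = N * m" by (elim dvdE)
    then have m': "2 ^ j = 2 ^ i + m * N" using le_add_diff_inverse[OF \<open>(2::nat) ^ i \<le> 2 ^ j\<close>] by (metis mult.commute)
    have "of_nat (2 ^ j) * s = of_nat (2 ^ i) * s + of_nat m * (of_nat N * s)"
      unfolding m' by (simp add: ring_distribs mult.assoc)
    then have eqP: "P (of_nat (2 ^ j) * s) = P (of_nat (2 ^ i) * s)"
      using periodic_Lat[OF P_periodic(1,2) Lat_of_nat[OF s(3)]] by metis
    \<comment> \<open>Equality of the two iterates, cross-multiplied. Both products have degree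
      \<open>4 ^ i + 4 ^ j - 1\<close>, with leading coefficients \<open>4 ^ j\<close> and
      \<open>4 ^ i\<close>, so they do not cancel.\<close>
    define E where "E = A i * D j - A j * D i"
    have "poly (A i) (P s / \<delta>) = P (of_nat (2 ^ i) * s) / \<delta> * poly (D i) (P s / \<delta>)"
         "poly (A j) (P s / \<delta>) = P (of_nat (2 ^ i) * s) / \<delta> * poly (D j) (P s / \<delta>)"
      using dup_poly_eval[OF \<delta>(1), of i s] dup_poly_eval[OF \<delta>(1), of j s] False eqP by (simp_all add: A_def D_def)
    then have "poly E (P s / \<delta>) = 0" by (simp add: E_def)
    moreover have "\<forall>i. poly.coeff E i \<in> K"
      unfolding E_def by (intro K.coeff_diff K.coeff_mult AK DK)
    moreover have "E \<noteq> 0"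
    proof -
      have p: "(4::nat) ^ i \<ge> 1" "(4::nat) ^ j \<ge> 1" by simp_all
      have "top_coeff (A i * D j) (4 ^ i + 4 ^ j - 1) (4 ^ j)"
        using top_coeff_mult[OF At[of i] Dt[of j]] p by simp
      moreover have "top_coeff (A j * D i) (4 ^ i + 4 ^ j - 1) (4 ^ i)"
        using top_coeff_mult[OF At[of j] Dt[of i]] p by (simp add: add.commute)
      ultimately have "top_coeff E (4 ^ i + 4 ^ j - 1) (4 ^ j - 4 ^ i)" unfolding E_def by (rule top_coeff_diff)
      moreover have "(4::complex) ^ j - 4 ^ i \<noteq> 0"
      proof
        assume "(4::complex) ^ j - 4 ^ i = 0"
        then have "complex_of_nat (4 ^ j) = of_nat (4 ^ i)" by simp
        then have "(4::nat) ^ j = 4 ^ i" by (simp only: of_nat_eq_iff)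
        then show False using ij(1) by (simp add: power_inject_exp)
      qed
      ultimately show ?thesis unfolding top_coeff_def by auto
    qed
    ultimately show ?thesis unfolding algebraic_over_def by blast
  qed
qed

end

section \<open>Algebraicity over the field generated by the invariant\<close>

lemma (in complex_subfield) algebraic_idem:
  "x \<in> algebraic_over (algebraic_over K) \<Longrightarrow> x \<in> algebraic_over K"
  unfolding algebraic_over_def[of "algebraic_over K"] using algebraic_closed by blast

context weierstrass
begin

definition e1 where "e1 = P (1/2)"
definition e2 where "e2 = P (\<tau>/2)"
definition e3 where "e3 = P ((1 + \<tau>)/2)"
text \<open>Of the differences of half-period values this is the one known through \<open>Y\<close>,
  whose values 2 and -2 give \<open>A * \<delta> = 4\<close>.\<close>

definition \<delta> where "\<delta> = e3 - e2"
text \<open>A parameter of weight 0: \<open>e2\<close>, \<open>e3\<close>, \<open>e1\<close> are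
  \<open>\<mu>\<close>, \<open>\<mu> + 1\<close> and \<open>- (2 * \<mu> + 1)\<close> times
  \<open>\<delta>\<close>.\<close>

definition \<mu> where "\<mu> = e2 / \<delta>"

lemma Y_e: "A * e2 + B = - 2" "A * e3 + B = 2" "A * e1 + B \<noteq> 2" "A * e1 + B \<noteq> - 2"
  using Y_half_tau Y_half unfolding Y_eq e1_def e2_def e3_def by auto

lemma e_distinct: "e1 \<noteq> e2" "e1 \<noteq> e3" "e2 \<noteq> e3"
  using Y_e by auto

lemma delta_nonzero: "\<delta> \<noteq> 0" using e_distinct by (simp add: \<delta>_def)

lemma A_delta: "A * \<delta> = 4"
proof -
  have "A * \<delta> = (A * e3 + B) - (A * e2 + B)" by (simp add: \<delta>_def right_diff_distrib)
  then show ?thesis by (simp add: Y_e)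
qed

text \<open>The value -2 at \<open>\<tau>/2\<close> and \<open>A * \<delta> = 4\<close> eliminate
  the unknown \<open>A\<close> and \<open>B\<close>.\<close>

lemma Y_delta: "Y s = 4 * (P s / \<delta>) - 4 * \<mu> - 2"
proof -
  have "Y s = A * (P s - e2) + (A * e2 + B)" by (simp add: Y_eq right_diff_distrib)
  also have "A * (P s - e2) = (A * \<delta>) * ((P s - e2) / \<delta>)" using delta_nonzero by simp
  finally show ?thesis unfolding A_delta Y_e(1) \<mu>_def by (simp add: diff_divide_distrib right_diff_distrib)
qed

lemma e_roots: "4 * e1 ^ 3 - g2 * e1 - g3 = 0" "4 * e2 ^ 3 - g2 * e2 - g3 = 0" "4 * e3 ^ 3 - g2 * e3 - g3 = 0"
proof -
  have two: "2 * (x / 2) = x" for x :: complex by simp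
  show "4 * e1 ^ 3 - g2 * e1 - g3 = 0" unfolding e1_def
    by (rule P_half_root[OF _ half_periods_not_Lat(1)]) (simp only: two Lat_1)
  show "4 * e2 ^ 3 - g2 * e2 - g3 = 0" unfolding e2_def
    by (rule P_half_root[OF _ half_periods_not_Lat(2)]) (simp only: two Lat_tau)
  show "4 * e3 ^ 3 - g2 * e3 - g3 = 0" unfolding e3_def
    by (rule P_half_root[OF _ half_periods_not_Lat(3)]) (simp only: two Lat_add[OF Lat_1 Lat_tau])
qed

text \<open>Subtract the cubic equations in pairs and divide by the nonzero differences of the
  roots.\<close>

lemma e_sums: "e1 = - e2 - e3" "g2 = 4 * (e2^2 + e2 * e3 + e3^2)" "g3 = 4 * e2^3 - g2 * e2"
proof -
  have d: "4 * (x^2 + x * y + y^2) = g2" if "4 * x ^ 3 - g2 * x - g3 = 0" "4 * y ^ 3 - g2 * y - g3 = 0" "x \<noteq> y" for x y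
  proof -
    have "(x - y) * (4 * (x^2 + x * y + y^2) - g2) = (4 * x ^ 3 - g2 * x - g3) - (4 * y ^ 3 - g2 * y - g3)"
      by (simp add: algebra_simps eval_nat_numeral)
    then show ?thesis using that by simp
  qed
  have 12: "4 * (e1^2 + e1 * e2 + e2^2) = g2" and 13: "4 * (e1^2 + e1 * e3 + e3^2) = g2" and 23: "4 * (e2^2 + e2 * e3 + e3^2) = g2"
    using d e_roots e_distinct by blast+
  have "(e2 - e3) * (4 * (e1 + e2 + e3)) = 4 * (e1^2 + e1 * e2 + e2^2) - 4 * (e1^2 + e1 * e3 + e3^2)"
    by (simp add: algebra_simps eval_nat_numeral)
  also have "\<dots> = 0" unfolding 12 13 by simp
  finally have "e1 + e2 + e3 = 0" using e_distinct(3) by (simp del: distrib_left_numeral)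
  then show "e1 = - e2 - e3" by (simp add: eq_neg_iff_add_eq_0 algebra_simps)
  show "g2 = 4 * (e2^2 + e2 * e3 + e3^2)" using 23 by simp
  show "g3 = 4 * e2^3 - g2 * e2" using e_roots(2) by simp
qed

lemma g_delta: "g2 / \<delta>^2 = 4 * (3 * \<mu>^2 + 3 * \<mu> + 1)" "g3 / \<delta>^3 = - 4 * \<mu> * (\<mu> + 1) * (2 * \<mu> + 1)"
proof -
  have e: "e2 = \<mu> * \<delta>" "e3 = \<mu> * \<delta> + \<delta>" using delta_nonzero by (simp_all add: \<mu>_def, simp add: \<delta>_def)
  have g2: "g2 = 4 * (3 * \<mu>^2 + 3 * \<mu> + 1) * \<delta>^2"
    unfolding e_sums(2) e by (simp add: algebra_simps eval_nat_numeral)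
  have g3: "g3 = - 4 * \<mu> * (\<mu> + 1) * (2 * \<mu> + 1) * \<delta>^3"
    unfolding e_sums(3) g2 e by (simp add: algebra_simps eval_nat_numeral)
  show "g2 / \<delta>^2 = 4 * (3 * \<mu>^2 + 3 * \<mu> + 1)" using delta_nonzero by (simp add: g2)
  show "g3 / \<delta>^3 = - 4 * \<mu> * (\<mu> + 1) * (2 * \<mu> + 1)" using delta_nonzero by (simp add: g3)
qed

lemma mu_nonzero: "3 * \<mu> + 1 \<noteq> 0" "3 * \<mu> + 2 \<noteq> 0"
proof -
  have e: "e2 = \<mu> * \<delta>" "e3 = \<mu> * \<delta> + \<delta>" using delta_nonzero by (simp_all add: \<mu>_def, simp add: \<delta>_def)
  have "e2 - e1 = (3 * \<mu> + 1) * \<delta>" "e3 - e1 = (3 * \<mu> + 2) * \<delta>"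
    unfolding e_sums(1) e by (simp_all add: algebra_simps)
  then show "3 * \<mu> + 1 \<noteq> 0" "3 * \<mu> + 2 \<noteq> 0" using e_distinct by auto
qed

text \<open>This is 16 times the product of the squared differences of the roots:
  \<open>3 * \<mu> + 1\<close> and \<open>3 * \<mu> + 2\<close> are
  \<open>(e2 - e1) / \<delta>\<close> and \<open>(e3 - e1) / \<delta>\<close>.\<close>

lemma discriminant: "g2 ^ 3 - 27 * g3\<^sup>2 = 16 * ((3 * \<mu> + 1) * (3 * \<mu> + 2))\<^sup>2 * \<delta> ^ 6"
proof -
  have g: "g2 = 4 * (3 * \<mu>^2 + 3 * \<mu> + 1) * \<delta>^2" "g3 = - 4 * \<mu> * (\<mu> + 1) * (2 * \<mu> + 1) * \<delta>^3"
    using g_delta delta_nonzero by (simp_all add: divide_eq_eq)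
  show ?thesis unfolding g by (simp add: algebra_simps eval_nat_numeral)
qed

lemma g_eisenstein: "60 * eisenstein_G 4 \<tau> = g2" "140 * eisenstein_G 6 \<tau> = g3"
  by (simp_all add: g2_def g3_def a_def b_def)

lemma j_mu: "j_invariant \<tau> * (16 * ((3 * \<mu> + 1) * (3 * \<mu> + 2))\<^sup>2) = 1728 * (4 * (3 * \<mu>^2 + 3 * \<mu> + 1)) ^ 3"
proof -
  have g: "g2 ^ 3 = (4 * (3 * \<mu>^2 + 3 * \<mu> + 1)) ^ 3 * \<delta> ^ 6"
    unfolding g_delta(1)[symmetric] using delta_nonzero by (simp add: power_divide flip: power_mult)
  have "j_invariant \<tau> = 1728 * g2 ^ 3 / (g2 ^ 3 - 27 * g3\<^sup>2)"
    unfolding j_invariant_def Let_def g_eisenstein ..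
  then show ?thesis unfolding discriminant unfolding g
    using mu_nonzero delta_nonzero by simp
qed

lemma mu_algebraic:
  assumes "complex_subfield K" "j_invariant \<tau> \<in> K"
  shows "\<mu> \<in> algebraic_over K"
proof -
  interpret K: complex_subfield K by fact
  define p where "p = Polynomial.smult (1728 * 64) ([:1, 3, 3:] ^ 3) - Polynomial.smult (j_invariant \<tau> * 16) (([:1, 3:] * [:2, 3:]) ^ 2)"
  have ev: "poly p x = 1728 * (4 * (3 * x^2 + 3 * x + 1)) ^ 3 - j_invariant \<tau> * (16 * ((3 * x + 1) * (3 * x + 2))\<^sup>2)" for x
    by (simp add: p_def algebra_simps eval_nat_numeral)
  have "poly p \<mu> = 0" unfolding ev j_mu by simp
  \<comment> \<open>At \<open>-1/3\<close> the factor \<open>3 * x + 1\<close> kills the term with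
    \<open>j\<close>, while \<open>3 * x^2 + 3 * x + 1\<close> is \<open>1/3\<close>.\<close>
  moreover have "poly p (- 1/3) \<noteq> 0" unfolding ev by (simp add: eval_nat_numeral)
  then have "p \<noteq> 0" by auto
  moreover have "\<forall>i. poly.coeff p i \<in> K"
    unfolding p_def
    by (intro K.coeff_diff K.coeff_smult K.coeff_power K.coeff_mult K.mult assms(2) K.numeral)
       (auto simp: coeff_pCons K.zero K.one K.numeral split: nat.split)
  ultimately show ?thesis unfolding algebraic_over_def by blast
qed

text \<open>The number is \<open>W\<^sup>2\<close> at a point \<open>s\<close> with
  \<open>2 * n * s\<close> in the lattice, hence a root of a quadratic with middle coefficient
  \<open>- Y s\<close>. The normalised invariants are only known to lie in
  \<open>algebraic_over K\<close>, so the torsion argument runs over that field and transitivity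
  leads back to \<open>K\<close>.\<close>

lemma cb_b_algebraic:
  assumes K: "complex_subfield K" "j_invariant \<tau> \<in> K" and i: "i \<in> {1..n div 2}"
  shows "cb_b n i \<tau> \<in> algebraic_over K"
proof -
  interpret K: complex_subfield K by fact
  interpret A: complex_subfield "algebraic_over K" by unfold_locales (rule K.algebraic_subfield)
  have mu: "\<mu> \<in> algebraic_over K" by (rule mu_algebraic[OF K])
  have n: "n \<ge> 1" using i by auto
  \<comment> \<open>Solves \<open>pi/2 + pi * x = (2 * i - 1) * pi / (2 * n)\<close>; the range of
    \<open>i\<close> puts \<open>x\<close> strictly between -1 and 0, off the lattice.\<close>
  define x where "x = (2 * real i - 1 - real n) / (2 * real n)"
  define s where "s = complex_of_real x"
  have "2 * i \<le> n" "i \<ge> 1" using i by auto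
  then have x: "- 1 < x" "x < 0" using n by (auto simp: x_def field_simps)
  have "x \<notin> \<int>"
  proof
    assume "x \<in> \<int>"
    then obtain k :: int where "x = of_int k" by (elim Ints_cases)
    then show False using x by simp
  qed
  then have sL: "s \<notin> Lat" using real_in_Lat[of x 0] by (auto simp: s_def)
  have "of_nat (2 * n) * s = complex_of_real (real (2 * n) * x)" by (simp add: s_def)
  also have "real (2 * n) * x = of_int (2 * int i - 1 - int n)" using n by (simp add: x_def)
  finally have "of_nat (2 * n) * s = of_int (2 * int i - 1 - int n) + of_int 0 * \<tau>" by simp
  then have NL: "of_nat (2 * n) * s \<in> Lat" unfolding Lat_iff by blast
  have g: "g2 / \<delta>^2 \<in> algebraic_over K" "g3 / \<delta>^3 \<in> algebraic_over K"
    unfolding g_delta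
    by (intro A.mult A.add A.power A.uminus A.numeral A.one mu | simp only: minus_mult_left[symmetric])+
  have "P s / \<delta> \<in> algebraic_over (algebraic_over K)"
    by (rule torsion_algebraic[OF A.complex_subfield_axioms delta_nonzero g sL _ NL]) (use n in auto)
  then have "P s / \<delta> \<in> algebraic_over K" by (rule K.algebraic_idem)
  then have Ya: "Y s \<in> algebraic_over K"
    unfolding Y_delta by (intro A.diff A.mult A.numeral mu)
  define v where "v = complex_of_real ((2 * real i - 1) * pi / (2 * real n))"
  have v: "of_real pi / 2 + of_real pi * s = v"
  proof -
    have "pi / 2 + pi * x = (2 * real i - 1) * pi / (2 * real n)" using n by (simp add: x_def field_simps)
    then show ?thesis unfolding s_def v_def by (metis of_real_add of_real_divide of_real_mult of_real_numeral)
  qed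
  have th: "th2 s = theta2 v \<tau>" "th3 s = theta3 v \<tau>" by (simp_all add: th2_def th3_def v)
  have nz: "th2 s \<noteq> 0" "th3 s \<noteq> 0" using th_zero_iff sL by (metis mult_eq_0_iff)+
  have b: "cb_b n i \<tau> = (th2 s)^2 / (th3 s)^2" unfolding cb_b_def Let_def th v_def ..
  have "(cb_b n i \<tau>)^2 - Y s * cb_b n i \<tau> + 1 = 0"
    unfolding b Y_def using nz by (simp add: field_simps eval_nat_numeral)
  then have root: "poly [:1, - Y s, 1:] (cb_b n i \<tau>) = 0" by (simp add: algebra_simps power2_eq_square)
  have co: "poly.coeff [:1, - Y s, 1:] k \<in> algebraic_over K" for k
    by (auto simp: coeff_pCons A.zero A.one A.uminus Ya split: nat.split)
  show ?thesis by (rule K.algebraic_closed[OF _ co root]) simp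
qed

lemma cb_S_algebraic:
  assumes K: "complex_subfield K" "j_invariant \<tau> \<in> K"
  shows "cb_S n j \<tau> \<in> algebraic_over K"
proof -
  interpret K: complex_subfield K by fact
  interpret A: complex_subfield "algebraic_over K" by unfold_locales (rule K.algebraic_subfield)
  show ?thesis unfolding cb_S_def
    by (intro A.sum A.prod) (use cb_b_algebraic[OF K] in blast)
qed

end

context imaginary_tau
begin

lemma weierstrass_exists: "\<exists>A B U. weierstrass \<tau> A B U"
  using Y_expansion by (metis imaginary_tau_axioms weierstrass.intro weierstrass_axioms.intro)

lemma cb_S_algebraic:
  assumes "complex_subfield K" "j_invariant \<tau> \<in> K"
  shows "cb_S n j \<tau> \<in> algebraic_over K"
  using weierstrass_exists weierstrass.cb_S_algebraic assms by blast

end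

section \<open>From single points to meromorphic functions\<close>

definition rat_poly_eval :: "rat poly \<Rightarrow> complex \<Rightarrow> complex" where
  "rat_poly_eval p z = poly (map_poly of_rat p) z"

lemma rat_poly_eval_hom:
  "rat_poly_eval (p + r) z = rat_poly_eval p z + rat_poly_eval r z" "rat_poly_eval (p * r) z = rat_poly_eval p z * rat_poly_eval r z"
  "rat_poly_eval 1 z = 1" "rat_poly_eval (- p) z = - rat_poly_eval p z" "rat_poly_eval [:0, 1:] z = z" "rat_poly_eval 0 z = 0"
proof -
  interpret h: map_poly_comm_ring_hom "of_rat :: rat \<Rightarrow> complex" ..
  show "rat_poly_eval (p + r) z = rat_poly_eval p z + rat_poly_eval r z" "rat_poly_eval (p * r) z = rat_poly_eval p z * rat_poly_eval r z"
    "rat_poly_eval 1 z = 1" "rat_poly_eval (- p) z = - rat_poly_eval p z" "rat_poly_eval [:0, 1:] z = z" "rat_poly_eval 0 z = 0"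
    by (simp_all add: rat_poly_eval_def h.hom_add h.hom_mult h.hom_uminus map_poly_pCons)
qed

text \<open>The field Q(z). As \<open>z\<close> may itself be algebraic, the denominator must be
  nonzero as a value and not just as a polynomial.\<close>

definition rat_field :: "complex \<Rightarrow> complex set" where
  "rat_field z = {rat_poly_eval p z / rat_poly_eval r z | p r. rat_poly_eval r z \<noteq> 0}"

lemma rat_field_subfield: "complex_subfield (rat_field z)"
proof
  have I: "rat_poly_eval p z / rat_poly_eval r z \<in> rat_field z" if "rat_poly_eval r z \<noteq> 0" for p r
    using that unfolding rat_field_def by blast
  have "1 \<in> rat_field z" using I[of 1 1] by (simp add: rat_poly_eval_hom)
  moreover have "x + y \<in> rat_field z" "x * y \<in> rat_field z" if xy: "x \<in> rat_field z" "y \<in> rat_field z" for x y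
  proof -
    obtain p r p' r' where x: "x = rat_poly_eval p z / rat_poly_eval r z" "rat_poly_eval r z \<noteq> 0"
      and y: "y = rat_poly_eval p' z / rat_poly_eval r' z" "rat_poly_eval r' z \<noteq> 0"
      using xy unfolding rat_field_def by blast
    have nz: "rat_poly_eval (r * r') z \<noteq> 0" using x y by (simp add: rat_poly_eval_hom)
    have "x + y = rat_poly_eval (p * r' + p' * r) z / rat_poly_eval (r * r') z"
      unfolding x(1) y(1) add_frac_eq[OF x(2) y(2)] rat_poly_eval_hom ..
    then show "x + y \<in> rat_field z" using I[OF nz] by simp
    have "x * y = rat_poly_eval (p * p') z / rat_poly_eval (r * r') z" using x y by (simp add: rat_poly_eval_hom)
    then show "x * y \<in> rat_field z" using I[OF nz] by simp
  qed
  moreover have "- x \<in> rat_field z" "inverse x \<in> rat_field z" if "x \<in> rat_field z" for x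
  proof -
    obtain p r where x: "x = rat_poly_eval p z / rat_poly_eval r z" "rat_poly_eval r z \<noteq> 0"
      using \<open>x \<in> rat_field z\<close> unfolding rat_field_def by blast
    have "- x = rat_poly_eval (- p) z / rat_poly_eval r z" using x by (simp add: rat_poly_eval_hom)
    then show "- x \<in> rat_field z" using I[OF x(2)] by simp
    show "inverse x \<in> rat_field z"
    proof (cases "rat_poly_eval p z = 0")
      case True
      then show ?thesis using x I[of 1 0] by (simp add: rat_poly_eval_hom)
    next
      case False
      then show ?thesis using x I[of p r] by simp
    qed
  qed
  ultimately show "subfield_of_complex (rat_field z)"
    unfolding subfield_of_complex_def by simp
qed

lemma rat_field_self: "z \<in> rat_field z"
  unfolding rat_field_def using rat_poly_eval_hom(3,5)[of z]
  by (intro CollectI exI[of _ "[:0, 1:]"] exI[of _ 1]) simp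

lemma open_upper_half_plane: "open upper_half_plane"
  unfolding upper_half_plane_def by (rule open_halfspace_Im_gt)

lemma connected_upper_half_plane: "connected upper_half_plane"
  unfolding upper_half_plane_def by (intro convex_connected convex_halfspace_Im_gt)

text \<open>On a connected domain a meromorphic function either vanishes off a sparse set or is
  nonzero off one, and sparse sets are countable.\<close>

lemma meromorphic_uncountable_zeros:
  assumes g: "g meromorphic_on upper_half_plane" and Z: "uncountable Z" "Z \<subseteq> upper_half_plane" "\<And>z. z \<in> Z \<Longrightarrow> g z = 0"
  shows "\<forall>\<^sub>\<approx>\<tau>\<in>upper_half_plane. g \<tau> = 0"
proof -
  have "\<not> (\<forall>\<^sub>\<approx>\<tau>\<in>upper_half_plane. g \<tau> \<noteq> 0)"
  proof
    assume "\<forall>\<^sub>\<approx>\<tau>\<in>upper_half_plane. g \<tau> \<noteq> 0"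
    then have "{\<tau>. \<not> g \<tau> \<noteq> 0} sparse_in upper_half_plane" by (simp add: eventually_cosparse)
    then have "countable (upper_half_plane \<inter> {\<tau>. \<not> g \<tau> \<noteq> 0})"
      by (rule sparse_imp_countable[OF open_upper_half_plane])
    moreover have "Z \<subseteq> upper_half_plane \<inter> {\<tau>. \<not> g \<tau> \<noteq> 0}" using Z by auto
    ultimately show False using Z(1) countable_subset by blast
  qed
  then show ?thesis
    using meromorphic_imp_constant_or_avoid[OF g open_upper_half_plane connected_upper_half_plane, of 0] by blast
qed

lemma rat_poly_eval_meromorphic:
  assumes "f meromorphic_on A" shows "(\<lambda>\<tau>. rat_poly_eval p (f \<tau>)) meromorphic_on A"
  unfolding rat_poly_eval_def poly_altdef using assms by (intro meromorphic_intros)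

lemma j_invariant_meromorphic: "j_invariant meromorphic_on upper_half_plane"
proof -
  have "eisenstein_G k meromorphic_on upper_half_plane" if "k \<ge> 3" for k
    using eisenstein_G_holomorphic[OF that] open_upper_half_plane
    by (intro analytic_on_imp_meromorphic_on) (simp add: analytic_on_open)
  from this[of 4] this[of 6] show ?thesis
    unfolding j_invariant_def[abs_def] Let_def by (intro meromorphic_intros) auto
qed

lemma cb_S_meromorphic: "cb_S n j meromorphic_on upper_half_plane"
proof -
  have "(\<lambda>\<tau>. theta2 v \<tau>) meromorphic_on upper_half_plane" "(\<lambda>\<tau>. theta3 v \<tau>) meromorphic_on upper_half_plane" for v
  proof -
    have "(\<lambda>\<tau>. theta2 v \<tau>) holomorphic_on upper_half_plane" "(\<lambda>\<tau>. theta3 v \<tau>) holomorphic_on upper_half_plane"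
      using open_upper_half_plane
      by (intro theta2_holomorphic theta3_holomorphic holomorphic_intros; simp add: upper_half_plane_def)+
    then show "(\<lambda>\<tau>. theta2 v \<tau>) meromorphic_on upper_half_plane" "(\<lambda>\<tau>. theta3 v \<tau>) meromorphic_on upper_half_plane"
      using open_upper_half_plane by (auto intro!: analytic_on_imp_meromorphic_on simp: analytic_on_open)
  qed
  then have "(\<lambda>\<tau>. cb_b n i \<tau>) meromorphic_on upper_half_plane" for i
    unfolding cb_b_def Let_def by (intro meromorphic_intros)
  then show ?thesis unfolding cb_S_def[abs_def] by (intro meromorphic_intros)
qed

text \<open>There are only countably many relations with rational coefficients, so one of them
  holds at uncountably many points of the imaginary axis, hence identically.\<close>
lemma mero_algebraic_if_pointwise:
  assumes F: "F meromorphic_on upper_half_plane"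
    and alg: "\<And>t::real. t > 0 \<Longrightarrow> F (\<i> * of_real t) \<in> algebraic_over (rat_field (j_invariant (\<i> * of_real t)))"
  shows "mero_algebraic_over rational_functions_of_j F"
proof -
  \<comment> \<open>A relation is coded by the coefficient lists of the numerators and denominators
    of its coefficients, so that the codes form a countable type.\<close>
  define cf :: "(rat list \<times> rat list) list \<Rightarrow> nat \<Rightarrow> complex \<Rightarrow> complex" where
    "cf D i \<tau> = rat_poly_eval (Poly (fst (D ! i))) (j_invariant \<tau>) / rat_poly_eval (Poly (snd (D ! i))) (j_invariant \<tau>)" for D i \<tau>
  \<comment> \<open>Demanding nonzero denominators guards against \<open>x / 0 = 0\<close>, and
    shows later that the denominators are nonzero polynomials.\<close>
  define good where "good D \<tau> \<longleftrightarrow> (\<forall>i<length D. rat_poly_eval (Poly (snd (D ! i))) (j_invariant \<tau>) \<noteq> 0) \<and>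
     (\<exists>i<length D. cf D i \<tau> \<noteq> 0) \<and> (\<Sum>i<length D. cf D i \<tau> * F \<tau> ^ i) = 0" for D \<tau>
  have ex: "\<exists>D. good D (\<i> * of_real t)" if t: "t > 0" for t :: real
  proof -
    define \<tau> where "\<tau> = \<i> * complex_of_real t"
    obtain p where p: "p \<noteq> 0" "\<And>i. poly.coeff p i \<in> rat_field (j_invariant \<tau>)" "poly p (F \<tau>) = 0"
      using alg[OF t] unfolding algebraic_over_def \<tau>_def by blast
    have "\<forall>i. \<exists>a r. poly.coeff p i = rat_poly_eval a (j_invariant \<tau>) / rat_poly_eval r (j_invariant \<tau>) \<and> rat_poly_eval r (j_invariant \<tau>) \<noteq> 0"
      using p(2) unfolding rat_field_def by blast
    then obtain a r where ar: "\<And>i. poly.coeff p i = rat_poly_eval (a i) (j_invariant \<tau>) / rat_poly_eval (r i) (j_invariant \<tau>)"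
      "\<And>i. rat_poly_eval (r i) (j_invariant \<tau>) \<noteq> 0" by metis
    define D where "D = map (\<lambda>i. (coeffs (a i), coeffs (r i))) [0..<Suc (Polynomial.degree p)]"
    have len: "length D = Suc (Polynomial.degree p)" by (simp add: D_def)
    have nth: "D ! i = (coeffs (a i), coeffs (r i))" if "i < length D" for i
      using that by (simp add: D_def del: upt_Suc)
    have c: "cf D i \<tau> = poly.coeff p i" if "i < length D" for i
      unfolding cf_def nth[OF that] by (simp add: ar)
    have "(\<Sum>i<length D. cf D i \<tau> * F \<tau> ^ i) = (\<Sum>i<length D. poly.coeff p i * F \<tau> ^ i)"
      by (intro sum.cong) (auto simp: c)
    also have "\<dots> = poly p (F \<tau>)" unfolding len poly_altdef lessThan_Suc_atMost ..
    finally have g1: "(\<Sum>i<length D. cf D i \<tau> * F \<tau> ^ i) = 0" using p(3) by simp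
    have "cf D (Polynomial.degree p) \<tau> \<noteq> 0" using c[of "Polynomial.degree p"] p(1) len by simp
    then have g2: "\<exists>i<length D. cf D i \<tau> \<noteq> 0" using len by auto
    have g3: "\<forall>i<length D. rat_poly_eval (Poly (snd (D ! i))) (j_invariant \<tau>) \<noteq> 0"
      using nth ar(2) by simp
    have "good D \<tau>" unfolding good_def by (intro conjI g1 g2 g3)
    then show ?thesis unfolding \<tau>_def by blast
  qed
  have "\<exists>D. uncountable {t::real. t > 0 \<and> good D (\<i> * of_real t)}"
  proof (rule ccontr)
    assume "\<not> ?thesis"
    then have "countable (\<Union>D. {t::real. t > 0 \<and> good D (\<i> * of_real t)})" by (intro countable_UN) auto
    moreover have "{0<..<1::real} \<subseteq> (\<Union>D. {t. t > 0 \<and> good D (\<i> * of_real t)})" using ex by auto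
    ultimately have "countable {0<..<1::real}" by (rule countable_subset[rotated])
    then show False using uncountable_open_interval[of 0 "1::real"] by simp
  qed
  then obtain D where D: "uncountable {t::real. t > 0 \<and> good D (\<i> * of_real t)}" by blast
  define Z where "Z = (\<lambda>t. \<i> * complex_of_real t) ` {t::real. t > 0 \<and> good D (\<i> * of_real t)}"
  have "inj_on (\<lambda>t. \<i> * complex_of_real t) X" for X by (auto simp: inj_on_def)
  then have Z: "uncountable Z" unfolding Z_def using D countable_image_inj_on by blast
  have ZH: "Z \<subseteq> upper_half_plane" by (auto simp: Z_def upper_half_plane_def)
  have good: "good D z" if "z \<in> Z" for z using that by (auto simp: Z_def)
  obtain z0 where z0: "z0 \<in> Z" using Z by (metis all_not_in_conv countable_empty)
  have len: "length D > 0" using good[OF z0] unfolding good_def by (metis gr_zeroI not_less_zero)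
  define d where "d = length D - 1"
  have "length D = Suc d" using len by (simp add: d_def)
  then have ld: "{..<length D} = {..d}" "\<And>i. i < length D \<longleftrightarrow> i \<le> d"
    by (simp_all add: lessThan_Suc_atMost less_Suc_eq_le)
  have cmero: "cf D i meromorphic_on upper_half_plane" for i
    unfolding cf_def[abs_def] by (intro meromorphic_intros rat_poly_eval_meromorphic j_invariant_meromorphic)
  have 1: "cf D i \<in> rational_functions_of_j" if "i \<le> d" for i
  proof -
    have "Poly (snd (D ! i)) \<noteq> 0"
      using good[OF z0] that rat_poly_eval_hom(6) unfolding good_def ld(2) by metis
    then show ?thesis unfolding rational_functions_of_j_def cf_def[abs_def] rat_poly_eval_def by blast
  qed
  \<comment> \<open>The index of a nonzero coefficient may vary with the point. If every coefficient
    vanished off a sparse set, \<open>Z\<close> would lie in a finite union of countable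
    sets.\<close>
  have 2: "\<exists>i\<le>d. \<not> (\<forall>\<^sub>\<approx>\<tau>\<in>upper_half_plane. cf D i \<tau> = 0)"
  proof (rule ccontr)
    assume "\<not> ?thesis"
    then have "{\<tau>. cf D i \<tau> \<noteq> 0} sparse_in upper_half_plane" if "i \<le> d" for i
      using that by (auto simp: eventually_cosparse)
    then have "countable (\<Union>i\<in>{..d}. upper_half_plane \<inter> {\<tau>. cf D i \<tau> \<noteq> 0})"
      by (intro countable_UN sparse_imp_countable open_upper_half_plane) auto
    moreover have "Z \<subseteq> (\<Union>i\<in>{..d}. upper_half_plane \<inter> {\<tau>. cf D i \<tau> \<noteq> 0})"
    proof
      fix z assume z: "z \<in> Z"
      obtain i where "i \<le> d" "cf D i z \<noteq> 0" using good[OF z] unfolding good_def ld(2) by auto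
      then show "z \<in> (\<Union>i\<in>{..d}. upper_half_plane \<inter> {\<tau>. cf D i \<tau> \<noteq> 0})" using z ZH by auto
    qed
    ultimately show False using Z countable_subset by blast
  qed
  have 3: "\<forall>\<^sub>\<approx>\<tau>\<in>upper_half_plane. (\<Sum>i\<le>d. cf D i \<tau> * F \<tau> ^ i) = 0"
  proof (rule meromorphic_uncountable_zeros[OF _ Z ZH])
    show "(\<lambda>\<tau>. \<Sum>i\<le>d. cf D i \<tau> * F \<tau> ^ i) meromorphic_on upper_half_plane"
      by (intro meromorphic_intros cmero F)
    show "z \<in> Z \<Longrightarrow> (\<Sum>i\<le>d. cf D i z * F z ^ i) = 0" for z
      using good[of z] unfolding good_def ld(1) by simp
  qed
  show ?thesis unfolding mero_algebraic_over_def using F 1 2 3 by blast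
qed

theorem theorem9p6:
  fixes n :: nat
  assumes "n \<ge> 1"
  shows "(\<forall>\<tau> f. Re \<tau> = 0 \<and> Im \<tau> > 0 \<and> is_chebyshev_blaschke n \<tau> f \<longrightarrow>
            (\<forall>z\<in>ball 0 1.
               f z = z ^ (n mod 2) *
                 ((z ^ (2 * (n div 2)) +
                    (\<Sum>j = 1..n div 2. (-1) ^ j * cb_S n j \<tau> * z ^ (2 * (n div 2) - 2 * j))) /
                  (1 + (\<Sum>j = 1..n div 2. (-1) ^ j * cb_S n j \<tau> * z ^ (2 * j))))))
       \<and> (\<forall>j\<in>{1..n div 2}. mero_algebraic_over rational_functions_of_j (cb_S n j))"
proof (intro conjI allI impI ballI)
  fix \<tau> f and z :: complex
  assume *: "Re \<tau> = 0 \<and> Im \<tau> > 0 \<and> is_chebyshev_blaschke n \<tau> f" and z: "z \<in> ball 0 1"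
  then interpret chebyshev_theta \<tau> n by unfold_locales (use assms in auto)
  show "f z = z ^ (n mod 2) *
                 ((z ^ (2 * (n div 2)) +
                    (\<Sum>j = 1..n div 2. (-1) ^ j * cb_S n j \<tau> * z ^ (2 * (n div 2) - 2 * j))) /
                  (1 + (\<Sum>j = 1..n div 2. (-1) ^ j * cb_S n j \<tau> * z ^ (2 * j))))"
    using chebyshev_blaschke_formula[OF _ z] * unfolding cb_prod_numerator cb_prod_denominator by blast
next
  fix j assume "j \<in> {1..n div 2}"
  show "mero_algebraic_over rational_functions_of_j (cb_S n j)"
  proof (rule mero_algebraic_if_pointwise[OF cb_S_meromorphic])
    fix t :: real assume "t > 0"
    then interpret imaginary_tau "\<i> * complex_of_real t" by unfold_locales auto
    show "cb_S n j (\<i> * complex_of_real t) \<in> algebraic_over (rat_field (j_invariant (\<i> * complex_of_real t)))"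
      by (rule cb_S_algebraic[OF rat_field_subfield rat_field_self])
  qed
qed

end
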